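(* Let $\Gamma$ be a temporal constraint language preserved by an operation $h \in \{ \min, \mathrm{mx} \}$. The problem $\mathrm{QCSP}(\Gamma)$ is polynomial-time decidable.
   Context: A temporal constraint language is a structure with domain $\mathbb{Q}$ (here with finite relational signature) whose relations are first-order definable over $(\mathbb{Q};<)$. $\mathrm{QCSP}(\Gamma)$ is the problem of deciding whether a given sentence $Q_1 v_1 \dots Q_n v_n (\psi_1\wedge\dots\wedge\psi_m)$ with $Q_i\in\{\exists,\forall\}$ and each $\psi_i$ an atomic formula $R(y_1,\dots,y_k)$ with $R$ a relation symbol of $\Gamma$, is true in $\Gamma$. The binary operation $\mathrm{mx}$ on $\mathbb{Q}$ is defined by $\mathrm{mx}(x,y)=\alpha(\min(x,y))$ if $x\neq y$ and $\mathrm{mx}(x,y)=\beta(x)$ if $x=y$, where $\alpha,\beta$ are unary operations preserving $<$ such that $\alpha(x)<\beta(x)<\alpha(x+\varepsilon)$ for all $x\in\mathbb{Q}$ and all rational $\varepsilon>0$. An operation preserves $\Gamma$ if applying it componentwise to tuples of each relation yields a tuple of that relation. *)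

theory Defs
  imports Complex_Main "HOL-Computational_Algebra.Polynomial"
begin

section \<open>Temporal constraint languages\<close>

text \<open>First-order formulas with equality over the signature of \<open>(\<rat>; <)\<close>.\<close>

datatype fo_formula =
    Less nat nat
  | Equal nat nat
  | Neg fo_formula
  | Conj fo_formula fo_formula
  | Exists nat fo_formula

primrec sat :: "(nat \<Rightarrow> rat) \<Rightarrow> fo_formula \<Rightarrow> bool" where
  "sat s (Less x y) \<longleftrightarrow> s x < s y"
| "sat s (Equal x y) \<longleftrightarrow> s x = s y"
| "sat s (Neg \<phi>) \<longleftrightarrow> \<not> sat s \<phi>"
| "sat s (Conj \<phi> \<psi>) \<longleftrightarrow> sat s \<phi> \<and> sat s \<psi>"
| "sat s (Exists x \<phi>) \<longleftrightarrow> (\<exists>a. sat (s(x := a)) \<phi>)"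

primrec free_vars :: "fo_formula \<Rightarrow> nat set" where
  "free_vars (Less x y) = {x, y}"
| "free_vars (Equal x y) = {x, y}"
| "free_vars (Neg \<phi>) = free_vars \<phi>"
| "free_vars (Conj \<phi> \<psi>) = free_vars \<phi> \<union> free_vars \<psi>"
| "free_vars (Exists x \<phi>) = free_vars \<phi> - {x}"

definition fo_definable :: "nat \<Rightarrow> rat list set \<Rightarrow> bool" where
  "fo_definable k R \<longleftrightarrow>
     (\<exists>\<phi>. free_vars \<phi> \<subseteq> {..<k} \<and> R = {t. length t = k \<and> sat (\<lambda>i. t ! i) \<phi>})"

text \<open>
  A structure with domain \<open>\<rat>\<close> and finite relational signature: the relation symbols are
  the positions in the list, and each symbol comes with its arity and its interpretation.
\<close>

type_synonym rat_structure = "(nat \<times> rat list set) list"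

definition temporal_constraint_language :: "rat_structure \<Rightarrow> bool" where
  "temporal_constraint_language \<Gamma> \<longleftrightarrow> (\<forall>(k, R) \<in> set \<Gamma>. fo_definable k R)"

definition preserves :: "(rat \<Rightarrow> rat \<Rightarrow> rat) \<Rightarrow> rat_structure \<Rightarrow> bool" where
  "preserves h \<Gamma> \<longleftrightarrow> (\<forall>(k, R) \<in> set \<Gamma>. \<forall>s \<in> R. \<forall>t \<in> R. map2 h s t \<in> R)"

text \<open>
  The operation mx depends on auxiliary functions \<open>\<alpha>\<close>, \<open>\<beta>\<close>; the predicate holds of the
  operation obtained from any admissible choice of them.
\<close>

definition is_mx :: "(rat \<Rightarrow> rat \<Rightarrow> rat) \<Rightarrow> bool" where
  "is_mx h \<longleftrightarrow>
     (\<exists>\<alpha> \<beta> :: rat \<Rightarrow> rat. strict_mono \<alpha> \<and> strict_mono \<beta> \<and>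
        (\<forall>x \<epsilon>. \<epsilon> > 0 \<longrightarrow> \<alpha> x < \<beta> x \<and> \<beta> x < \<alpha> (x + \<epsilon>)) \<and>
        (\<forall>x y. h x y = (if x \<noteq> y then \<alpha> (min x y) else \<beta> x)))"


section \<open>Quantified constraints\<close>

datatype quantifier = ForallQ | ExistsQ

text \<open>
  A sentence \<open>Q\<^sub>1 v\<^sub>1 \<dots> Q\<^sub>n v\<^sub>n (\<psi>\<^sub>1 \<and> \<dots> \<and> \<psi>\<^sub>m)\<close>.  The variable bound by the quantifier at
  position \<open>i\<close> of the prefix (counted from 0) is named \<open>i\<close>; an atom is a relation symbol
  together with its list of argument variables.
\<close>

type_synonym atom = "nat \<times> nat list"

record sentence =
  quants :: "quantifier list"
  atoms :: "atom list"

definition sentence_of :: "rat_structure \<Rightarrow> sentence \<Rightarrow> bool" where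
  "sentence_of \<Gamma> \<Phi> \<longleftrightarrow>
     (\<forall>(r, ys) \<in> set (atoms \<Phi>).
        r < length \<Gamma> \<and> length ys = fst (\<Gamma> ! r) \<and> (\<forall>y \<in> set ys. y < length (quants \<Phi>)))"

text \<open>The list \<open>env\<close> holds the values of the variables that are already quantified.\<close>

primrec qtrue :: "rat_structure \<Rightarrow> atom list \<Rightarrow> quantifier list \<Rightarrow> rat list \<Rightarrow> bool" where
  "qtrue \<Gamma> \<psi>s [] env \<longleftrightarrow> (\<forall>(r, ys) \<in> set \<psi>s. map (\<lambda>y. env ! y) ys \<in> snd (\<Gamma> ! r))"
| "qtrue \<Gamma> \<psi>s (Q # Qs) env \<longleftrightarrow>
     (case Q of
        ForallQ \<Rightarrow> (\<forall>a. qtrue \<Gamma> \<psi>s Qs (env @ [a]))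
      | ExistsQ \<Rightarrow> (\<exists>a. qtrue \<Gamma> \<psi>s Qs (env @ [a])))"

definition true_in :: "rat_structure \<Rightarrow> sentence \<Rightarrow> bool" where
  "true_in \<Gamma> \<Phi> \<longleftrightarrow> qtrue \<Gamma> (atoms \<Phi>) (quants \<Phi>) []"


section \<open>Polynomial-time decidability\<close>

text \<open>
  Deterministic Turing machines with finitely many two-way infinite tapes.  The states are
  \<open>{..<num_states}\<close>; the tape alphabet consists of the blank, the letters of the (finite)
  input alphabet, and the additional symbols \<open>Mark i\<close> with \<open>i < num_marks\<close>.
\<close>

datatype 'a cell = Blank | Letter 'a | Mark nat

datatype move = MoveLeft | Stay | MoveRight

record 'a tm =
  num_tapes :: nat
  num_states :: nat
  num_marks :: nat
  start_state :: nat
  accept_state :: nat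
  reject_state :: nat
  delta :: "nat \<Rightarrow> 'a cell list \<Rightarrow> nat \<times> ('a cell \<times> move) list"

definition tape_alphabet :: "'a tm \<Rightarrow> 'a cell set" where
  "tape_alphabet M = {Blank} \<union> range Letter \<union> Mark ` {..<num_marks M}"

definition wf_tm :: "'a tm \<Rightarrow> bool" where
  "wf_tm M \<longleftrightarrow>
     num_tapes M \<ge> 1 \<and>
     start_state M < num_states M \<and> accept_state M < num_states M \<and>
     reject_state M < num_states M \<and> accept_state M \<noteq> reject_state M \<and>
     (\<forall>q < num_states M. \<forall>cs. length cs = num_tapes M \<and> set cs \<subseteq> tape_alphabet M \<longrightarrow>
        (case delta M q cs of (q', acts) \<Rightarrow>
           q' < num_states M \<and> length acts = num_tapes M \<and>
           fst ` set acts \<subseteq> tape_alphabet M))"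

text \<open>A tape is its contents together with the position of the head.\<close>

type_synonym 'a tape = "(int \<Rightarrow> 'a cell) \<times> int"
type_synonym 'a config = "nat \<times> 'a tape list"

fun read_tape :: "'a tape \<Rightarrow> 'a cell" where
  "read_tape (f, p) = f p"

fun act_tape :: "'a cell \<times> move \<Rightarrow> 'a tape \<Rightarrow> 'a tape" where
  "act_tape (c, d) (f, p) =
     (f(p := c), case d of MoveLeft \<Rightarrow> p - 1 | Stay \<Rightarrow> p | MoveRight \<Rightarrow> p + 1)"

text \<open>Configurations in the accepting or the rejecting state are halting, hence fixed.\<close>

fun tm_step :: "'a tm \<Rightarrow> 'a config \<Rightarrow> 'a config" where
  "tm_step M (q, ts) =
     (if q = accept_state M \<or> q = reject_state M then (q, ts)
      else case delta M q (map read_tape ts) of (q', acts) \<Rightarrow> (q', map2 act_tape acts ts))"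

definition tm_init :: "'a tm \<Rightarrow> 'a list \<Rightarrow> 'a config" where
  "tm_init M w =
     (start_state M,
      ((\<lambda>i. if 0 \<le> i \<and> i < int (length w) then Letter (w ! nat i) else Blank), 0)
        # replicate (num_tapes M - 1) ((\<lambda>_. Blank), 0))"

definition polytime_decidable :: "'a::finite list set \<Rightarrow> bool" where
  "polytime_decidable L \<longleftrightarrow>
     (\<exists>(M :: 'a tm) (p :: nat poly). wf_tm M \<and>
        (\<forall>w. \<exists>t \<le> poly p (length w).
           fst ((tm_step M ^^ t) (tm_init M w)) =
             (if w \<in> L then accept_state M else reject_state M)))"


section \<open>The problem QCSP\<close>

text \<open>
  A sentence is written as its quantifier prefix followed by its atoms; an atom is an
  \<open>AtomSym\<close>, the relation symbol in unary, and, for each argument, an \<open>ArgSym\<close> and the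
  variable in unary.  As the variables are numbered consecutively, and each has its own
  symbol in the prefix, this is at most quadratically longer than writing them in binary.
\<close>

datatype symbol = QuantSym quantifier | AtomSym | ArgSym | Tick

instance symbol :: finite
proof
  have "x \<in> {QuantSym ForallQ, QuantSym ExistsQ, AtomSym, ArgSym, Tick}" for x
    by (cases x; cases "case x of QuantSym Q \<Rightarrow> Q | _ \<Rightarrow> ForallQ") auto
  then have "UNIV \<subseteq> {QuantSym ForallQ, QuantSym ExistsQ, AtomSym, ArgSym, Tick}"
    by blast
  then show "finite (UNIV :: symbol set)"
    by (rule finite_subset) simp
qed

fun encode_atom :: "atom \<Rightarrow> symbol list" where
  "encode_atom (r, ys) =
     AtomSym # replicate r Tick @ concat (map (\<lambda>y. ArgSym # replicate y Tick) ys)"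

definition encode :: "sentence \<Rightarrow> symbol list" where
  "encode \<Phi> = map QuantSym (quants \<Phi>) @ concat (map encode_atom (atoms \<Phi>))"

lemma replicate_Tick_append:
  assumes "replicate r Tick @ xs = replicate s Tick @ ys"
    and "takeWhile ((=) Tick) xs = []" and "takeWhile ((=) Tick) ys = []"
  shows "r = s \<and> xs = ys"
  using assms
proof (induction r arbitrary: s)
  case 0 then show ?case by (cases s) auto
next
  case (Suc r) then show ?case by (cases s) auto
qed

lemma encode_args_append:
  assumes "concat (map (\<lambda>y. ArgSym # replicate y Tick) ys) @ u =
             concat (map (\<lambda>y. ArgSym # replicate y Tick) zs) @ v"
    and "u = [] \<or> hd u = AtomSym" and "v = [] \<or> hd v = AtomSym"
  shows "ys = zs \<and> u = v"
  using assms(1)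
proof (induction ys arbitrary: zs)
  case Nil then show ?case using assms by (cases zs) auto
next
  case (Cons y ys)
  have tw: "takeWhile ((=) Tick) (concat (map (\<lambda>y. ArgSym # replicate y Tick) ws) @ x) = []"
    if "x = [] \<or> hd x = AtomSym" for ws x
    using that by (cases ws; cases x) auto
  show ?case
  proof (cases zs)
    case Nil then show ?thesis using Cons.prems assms by auto
  next
    case (Cons z zs')
    then show ?thesis
      using Cons.prems Cons.IH[of zs']
        replicate_Tick_append[of y _ z, OF _ tw[OF assms(2), of ys] tw[OF assms(3), of zs']]
      by auto
  qed
qed

lemma encode_atoms_inj:
  "concat (map encode_atom as) = concat (map encode_atom bs) \<Longrightarrow> as = bs"
proof (induction as arbitrary: bs)
  case Nil then show ?case by (cases bs) auto
next
  case (Cons a as)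
  let ?args = "concat \<circ> map (\<lambda>y. ArgSym # replicate y Tick)"
  have hd: "concat (map encode_atom cs) = [] \<or> hd (concat (map encode_atom cs)) = AtomSym" for cs
    by (cases cs) auto
  have tw: "takeWhile ((=) Tick) (?args ys @ concat (map encode_atom cs)) = []" for ys cs
    by (cases ys; cases cs) auto
  obtain b bs' where bs: "bs = b # bs'" using Cons.prems by (cases bs; cases a) auto
  obtain r ys s zs where ab: "a = (r, ys)" "b = (s, zs)" by (cases a; cases b)
  have "r = s \<and> ?args ys @ concat (map encode_atom as) = ?args zs @ concat (map encode_atom bs')"
    using Cons.prems by (intro replicate_Tick_append tw) (simp add: bs ab)
  with encode_args_append[OF _ hd hd] Cons.IH[of bs'] show ?case by (auto simp: bs ab)
qed

lemma inj_encode: "inj encode"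
proof (rule injI)
  fix \<Phi> \<Psi> :: sentence assume e: "encode \<Phi> = encode \<Psi>"
  have hd: "concat (map encode_atom cs) = [] \<or> hd (concat (map encode_atom cs)) = AtomSym" for cs
    by (cases cs) auto
  have "map QuantSym qs @ u = map QuantSym qs' @ v \<Longrightarrow> u = [] \<or> hd u = AtomSym
     \<Longrightarrow> v = [] \<or> hd v = AtomSym \<Longrightarrow> qs = qs' \<and> u = v" for qs qs' u v
  proof (induction qs arbitrary: qs')
    case Nil then show ?case by (cases qs') auto
  next
    case (Cons q qs) then show ?case by (cases qs') auto
  qed
  from this[OF e[unfolded encode_def] hd hd] show "\<Phi> = \<Psi>"
    by (auto dest!: encode_atoms_inj)
qed

text \<open>Words that are not the encoding of a sentence over the signature have to be rejected.\<close>

definition QCSP :: "rat_structure \<Rightarrow> symbol list set" where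
  "QCSP \<Gamma> = {encode \<Phi> | \<Phi>. sentence_of \<Gamma> \<Phi> \<and> true_in \<Gamma> \<Phi>}"

end

theory Submission
  imports Defs
begin

text \<open>
  The operations min and mx preserve \<open><\<close> and satisfy \<open>h x y = \<alpha> (min x y)\<close> for \<open>x \<noteq> y\<close>.
  Applying \<open>h\<close> to two solutions, one of which is shifted above the other on a set of variables,
  therefore copies the order of the other one on that set.  In the quantifier game this lets
  the existential player win as soon as she wins two kinds of simplified games: one in which
  each universal variable is played above everything that precedes it, and, for each universal
  variable \<open>u\<close>, one in which \<open>u\<close> is played below everything that precedes it and the others
  above.  These simplified games are constraint satisfaction problems.  Such a problem is
  solved by repeatedly removing a nonempty set of variables that can be the set of minimal
  variables.  The candidates for such a set are closed under union if \<open>h\<close> is min, where the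
  largest candidate is found by deleting variables, and under symmetric difference if \<open>h\<close> is
  mx, where Gaussian elimination over the field with two elements finds a candidate.

  For the time bound, Turing machines simulate structured programs on stacks, data are
  binary trees in prefix code on top of a stack, and the functions computable by such programs
  in polynomial time are closed under composition and under folds with polynomially bounded
  intermediate results.  All tables that depend on the language are finite functions.
\<close>

section \<open>Stack programs on Turing machines\<close>

text \<open>The existential player keeps a full solution in which the pending universal variables
  lie above all their predecessors. When \<open>u\<close> receives a value, a solution with
  \<open>u\<close> low supplies that value, the kept solution supplies the earlier ones, and a
  single application of \<open>h\<close> merges them. The later universal variables are high in
  both, so \<open>h_mono\<close> keeps them high. As this handles one universal move at a time,
  games with several low variables never arise. Peeling may be greedy: a solution has minimal
  variables on every set of remaining variables, so no earlier choice can block a satisfiable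
  instance. Symmetric difference comes from ties: mx sends them to \<beta>, above \<alpha> of the
  same argument, so the least value is attained where exactly one argument is least. The equations
  of the resulting subspace depend on which variables remain; instead of computing them, the
  algorithm tests all hyperplanes that contain it, and for a given language only finitely many come
  into question. A fold of polynomial steps may grow exponentially, hence the size bounds on
  folds.\<close>

text \<open>
  A machine needs two steps for \<open>Push\<close>: it moves left, and then writes by an \<open>Overwrite\<close>, which
  is not meant to occur in programs and has no rule in \<open>exec\<close>.
\<close>

datatype 'a com =
    Push nat "'a cell"
  | Overwrite nat "'a cell"
  | Pop nat
  | Seq "'a com" "'a com"
  | Cond nat "'a cell set" "'a com" "'a com"
  | Loop nat "'a cell set" "'a com"

type_synonym 'a stacks = "nat \<Rightarrow> 'a cell list"

definition top_cell :: "'a cell list \<Rightarrow> 'a cell" where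
  "top_cell xs = (case xs of [] \<Rightarrow> Blank | x # _ \<Rightarrow> x)"

lemma top_cell_simps [simp]: "top_cell [] = Blank" "top_cell (x # xs) = x"
  by (simp_all add: top_cell_def)

text \<open>The counts are the exact machine steps: unfolding a \<open>Seq\<close>, branching, and
  each test of a loop cost one step, and a push costs two.\<close>

inductive exec :: "'a com \<Rightarrow> 'a stacks \<Rightarrow> nat \<Rightarrow> 'a stacks \<Rightarrow> bool" where
  Push: "exec (Push i x) s 2 (s(i := x # s i))"
| Pop: "exec (Pop i) s 1 (s(i := tl (s i)))"
| Seq: "exec c s t s' \<Longrightarrow> exec d s' t' s'' \<Longrightarrow> exec (Seq c d) s (t + t' + 1) s''"
| CondTrue: "top_cell (s i) \<in> X \<Longrightarrow> exec c s t s' \<Longrightarrow> exec (Cond i X c d) s (t + 1) s'"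
| CondFalse: "top_cell (s i) \<notin> X \<Longrightarrow> exec d s t s' \<Longrightarrow> exec (Cond i X c d) s (t + 1) s'"
| LoopFalse: "top_cell (s i) \<notin> X \<Longrightarrow> exec (Loop i X c) s 1 s"
| LoopTrue: "top_cell (s i) \<in> X \<Longrightarrow> exec c s t s' \<Longrightarrow> exec (Loop i X c) s' t' s'' \<Longrightarrow>
    exec (Loop i X c) s (t + t' + 1) s''"

primrec ok_com :: "nat \<Rightarrow> 'a cell set \<Rightarrow> 'a com \<Rightarrow> bool" where
  "ok_com K A (Push i x) \<longleftrightarrow> i < K \<and> x \<in> A"
| "ok_com K A (Overwrite i x) \<longleftrightarrow> i < K \<and> x \<in> A"
| "ok_com K A (Pop i) \<longleftrightarrow> i < K"
| "ok_com K A (Seq c d) \<longleftrightarrow> ok_com K A c \<and> ok_com K A d"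
| "ok_com K A (Cond i X c d) \<longleftrightarrow> i < K \<and> ok_com K A c \<and> ok_com K A d"
| "ok_com K A (Loop i X c) \<longleftrightarrow> i < K \<and> ok_com K A c"

text \<open>The states of the machine are the continuations of the program.\<close>

definition idle :: "'a cell list \<Rightarrow> ('a cell \<times> move) list" where
  "idle cs = map (\<lambda>c. (c, Stay)) cs"

fun control :: "'a com list \<Rightarrow> 'a cell list \<Rightarrow> 'a com list \<times> ('a cell \<times> move) list" where
  "control [] cs = ([], idle cs)"
| "control (Push i x # k) cs = (Overwrite i x # k, (idle cs)[i := (cs ! i, MoveLeft)])"
| "control (Overwrite i x # k) cs = (k, (idle cs)[i := (x, Stay)])"
| "control (Pop i # k) cs = (k, (idle cs)[i := (cs ! i, MoveRight)])"
| "control (Seq c d # k) cs = (c # d # k, idle cs)"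
| "control (Cond i X c d # k) cs = ((if cs ! i \<in> X then c else d) # k, idle cs)"
| "control (Loop i X c # k) cs = (if cs ! i \<in> X then c # Loop i X c # k else k, idle cs)"

text \<open>Contains the continuations that can occur from \<open>c # k\<close> until
  \<open>k\<close> is reached. A loop puts itself back below its body, so the set stays finite
  although runs are unbounded, and it can serve as the set of states.\<close>

primrec conts :: "'a com \<Rightarrow> 'a com list \<Rightarrow> 'a com list set" where
  "conts (Push i x) k = {Push i x # k, Overwrite i x # k}"
| "conts (Overwrite i x) k = {Overwrite i x # k}"
| "conts (Pop i) k = {Pop i # k}"
| "conts (Seq c d) k = {Seq c d # k} \<union> conts c (d # k) \<union> conts d k"
| "conts (Cond i X c d) k = {Cond i X c d # k} \<union> conts c k \<union> conts d k"
| "conts (Loop i X c) k = {Loop i X c # k} \<union> conts c (Loop i X c # k)"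

lemma finite_conts: "finite (conts c k)"
  by (induction c arbitrary: k) auto

lemma start_conts: "c # k \<in> conts c k"
  by (cases c) auto

lemma control_conts: "l \<in> conts c k \<Longrightarrow> fst (control l cs) \<in> insert k (conts c k)"
proof (induction c arbitrary: k)
  case (Seq c d)
  then show ?case using start_conts[of c "d # k"] start_conts[of d k] by fastforce
next
  case (Cond i X c d)
  then consider "l = Cond i X c d # k" | "l \<in> conts c k" | "l \<in> conts d k" by auto
  then show ?case using Cond.IH[of k] start_conts[of c k] start_conts[of d k] by cases auto
next
  case (Loop i X c)
  then show ?case using start_conts[of c "Loop i X c # k"] by fastforce
qed auto

lemma conts_ok:
  "l \<in> conts c k \<Longrightarrow> ok_com K A c \<Longrightarrow> list_all (ok_com K A) k \<Longrightarrow> list_all (ok_com K A) l"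
  by (induction c arbitrary: k) fastforce+

lemma control_acts:
  assumes "list_all (ok_com K A) l" and "length cs = K" and "set cs \<subseteq> A"
  shows "length (snd (control l cs)) = K" "fst ` set (snd (control l cs)) \<subseteq> A"
proof -
  have i: "fst ` set (idle cs) \<subseteq> A" "length (idle cs) = K"
    using assms by (auto simp: idle_def)
  have u: "fst ` set ((idle cs)[i := a]) \<subseteq> A" if "fst a \<in> A" for i a
    using i that set_update_subset_insert[of "idle cs" i a] by blast
  have "cs ! i \<in> A" if "i < K" for i
    using that assms nth_mem by blast
  then show "length (snd (control l cs)) = K" "fst ` set (snd (control l cs)) \<subseteq> A"
    using assms i u by (cases "(l, cs)" rule: control.cases; simp)+
qed

text \<open>The top of the stack is under the head; to the left of the head there may be garbage.\<close>

definition represents :: "'a tape \<Rightarrow> 'a cell list \<Rightarrow> bool" where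
  "represents T xs \<longleftrightarrow> (\<forall>i. fst T (snd T + int i) = (if i < length xs then xs ! i else Blank))"

lemma represents_read: "represents T xs \<Longrightarrow> read_tape T = top_cell xs"
  unfolding represents_def by (cases T; cases xs) (auto dest: spec[of _ 0])

lemma represents_pop:
  assumes "represents T xs"
  shows "represents (act_tape (read_tape T, MoveRight) T) (tl xs)"
proof -
  obtain f p where T: "T = (f, p)" by (cases T)
  have "f (p + int (Suc i)) = (if Suc i < length xs then xs ! Suc i else Blank)" for i
    using assms unfolding represents_def T fst_conv snd_conv by blast
  then have "f (p + 1 + int i) = (if i < length (tl xs) then tl xs ! i else Blank)" for i
    by (cases xs) (simp_all add: algebra_simps)
  then show ?thesis by (simp add: represents_def T)
qed

text \<open>The cell to the left of the head is overwritten, so garbage left there by earlier pops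
  does no harm.\<close>

lemma represents_push:
  assumes "represents T xs"
  shows "represents (act_tape (x, Stay) (act_tape (read_tape T, MoveLeft) T)) (x # xs)"
proof -
  obtain f p where T: "T = (f, p)" by (cases T)
  have r: "f (p + int i) = (if i < length xs then xs ! i else Blank)" for i
    using assms by (simp add: represents_def T)
  have "(f(p := f p, p - 1 := x)) (p - 1 + int i) = (if i < length (x # xs) then (x # xs) ! i else Blank)" for i
  proof (cases i)
    case (Suc j)
    then have e: "p - 1 + int i = p + int j" by simp
    show ?thesis unfolding e using Suc r[of j] by simp
  qed simp
  then show ?thesis by (simp add: represents_def T)
qed

definition all_represent :: "nat \<Rightarrow> 'a tape list \<Rightarrow> 'a stacks \<Rightarrow> bool" where
  "all_represent K Ts s \<longleftrightarrow> length Ts = K \<and> (\<forall>i<K. represents (Ts ! i) (s i))"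

lemma idle_acts [simp]: "map2 act_tape (idle (map read_tape Ts)) Ts = Ts"
proof (rule nth_equalityI)
  fix i assume "i < length (map2 act_tape (idle (map read_tape Ts)) Ts)"
  then show "map2 act_tape (idle (map read_tape Ts)) Ts ! i = Ts ! i"
    by (cases "Ts ! i") (simp add: idle_def)
qed (simp add: idle_def)

lemma update_acts:
  "i < length Ts \<Longrightarrow> map2 act_tape ((idle (map read_tape Ts))[i := a]) Ts = Ts[i := act_tape a (Ts ! i)]"
proof (rule nth_equalityI)
  fix j assume "i < length Ts" "j < length (map2 act_tape ((idle (map read_tape Ts))[i := a]) Ts)"
  then show "map2 act_tape ((idle (map read_tape Ts))[i := a]) Ts ! j = Ts[i := act_tape a (Ts ! i)] ! j"
    by (cases "Ts ! j") (auto simp: idle_def nth_list_update)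
qed (simp add: idle_def)

definition run1 :: "'a com list \<times> 'a tape list \<Rightarrow> 'a com list \<times> 'a tape list" where
  "run1 kT = (case control (fst kT) (map read_tape (snd kT)) of
      (k', acts) \<Rightarrow> (k', map2 act_tape acts (snd kT)))"

text \<open>The continuation \<open>k\<close> is arbitrary: for \<open>Seq\<close> and
  \<open>Loop\<close> the induction hypothesis on the first part is used with the rest of the
  program still pending.\<close>

lemma exec_run:
  assumes "exec c s t s'" and "all_represent K Ts s" and "ok_com K A c"
  shows "\<exists>Ts'. (run1 ^^ t) (c # k, Ts) = (k, Ts') \<and> all_represent K Ts' s'"
  using assms
proof (induction arbitrary: Ts k rule: exec.induct)
  case (Push i x s)
  then have i: "i < length Ts" "represents (Ts ! i) (s i)" by (auto simp: all_represent_def)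
  let ?U = "Ts[i := act_tape (read_tape (Ts ! i), MoveLeft) (Ts ! i)]"
  let ?V = "?U[i := act_tape (x, Stay) (?U ! i)]"
  have "run1 (Push i x # k, Ts) = (Overwrite i x # k, ?U)"
    using i by (simp add: run1_def update_acts)
  moreover have "run1 (Overwrite i x # k, ?U) = (k, ?V)"
    using i by (simp add: run1_def update_acts)
  ultimately have "(run1 ^^ 2) (Push i x # k, Ts) = (k, ?V)"
    by (simp add: numeral_2_eq_2)
  moreover have "all_represent K ?V (s(i := x # s i))"
    using Push.prems i represents_push[OF i(2), of x]
    by (auto simp: all_represent_def nth_list_update)
  ultimately show ?case by blast
next
  case (Pop i s)
  then have i: "i < length Ts" "represents (Ts ! i) (s i)" by (auto simp: all_represent_def)
  let ?U = "Ts[i := act_tape (read_tape (Ts ! i), MoveRight) (Ts ! i)]"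
  have "run1 (Pop i # k, Ts) = (k, ?U)"
    using i by (simp add: run1_def update_acts)
  then have "(run1 ^^ 1) (Pop i # k, Ts) = (k, ?U)" by simp
  moreover have "all_represent K ?U (s(i := tl (s i)))"
    using Pop.prems i represents_pop[OF i(2)]
    by (auto simp: all_represent_def nth_list_update)
  ultimately show ?case by blast
next
  case (Seq c s t s' d t' s'')
  have "run1 (Seq c d # k, Ts) = (c # d # k, Ts)" by (simp add: run1_def)
  moreover obtain Us where "(run1 ^^ t) (c # d # k, Ts) = (d # k, Us)" "all_represent K Us s'"
    using Seq by fastforce
  moreover obtain Vs where "(run1 ^^ t') (d # k, Us) = (k, Vs)" "all_represent K Vs s''"
    using Seq calculation by fastforce
  ultimately have "(run1 ^^ (t' + t + 1)) (Seq c d # k, Ts) = (k, Vs) \<and> all_represent K Vs s''"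
    by (simp add: funpow_add funpow_Suc_right del: funpow.simps(2))
  then show ?case by (metis add.commute)
next
  case (CondTrue s i X c t s' d)
  then have "run1 (Cond i X c d # k, Ts) = (c # k, Ts)"
    by (auto simp: run1_def all_represent_def represents_read)
  then show ?case using CondTrue by (auto simp: funpow_swap1 simp del: funpow.simps(2) simp: funpow_Suc_right)
next
  case (CondFalse s i X d t s' c)
  then have "run1 (Cond i X c d # k, Ts) = (d # k, Ts)"
    by (auto simp: run1_def all_represent_def represents_read)
  then show ?case using CondFalse by (auto simp: funpow_swap1 simp del: funpow.simps(2) simp: funpow_Suc_right)
next
  case (LoopFalse s i X c)
  then have "run1 (Loop i X c # k, Ts) = (k, Ts)"
    by (auto simp: run1_def all_represent_def represents_read)
  then show ?case using LoopFalse by simp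
next
  case (LoopTrue s i X c t s' t' s'')
  have "run1 (Loop i X c # k, Ts) = (c # Loop i X c # k, Ts)"
    using LoopTrue by (auto simp: run1_def all_represent_def represents_read)
  moreover obtain Us where "(run1 ^^ t) (c # Loop i X c # k, Ts) = (Loop i X c # k, Us)" "all_represent K Us s'"
    using LoopTrue by fastforce
  moreover obtain Vs where "(run1 ^^ t') (Loop i X c # k, Us) = (k, Vs)" "all_represent K Vs s''"
    using LoopTrue calculation by blast
  ultimately have "(run1 ^^ (t' + t + 1)) (Loop i X c # k, Ts) = (k, Vs) \<and> all_represent K Vs s''"
    by (simp add: funpow_add funpow_Suc_right del: funpow.simps(2))
  then show ?case by (metis add.commute)
qed

lemma exec_tm:
  fixes c :: "'a com"
  assumes "ok_com K A c" and "K \<ge> 1" and A: "A = {Blank} \<union> range Letter \<union> Mark ` {..<m}"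
  obtains M :: "'a tm" where "wf_tm M" and
    "\<And>w t s'. exec c (\<lambda>i. if i = 0 then map Letter w else []) t s' \<Longrightarrow>
       fst ((tm_step M ^^ (t + 1)) (tm_init M w)) =
         (if top_cell (s' 0) = Mark 1 then accept_state M else reject_state M)"
proof -
  define C where "C = insert [] (conts c [])"
  have "finite C" by (simp add: C_def finite_conts)
  then obtain ix where ix: "bij_betw ix C {..<card C}"
    using ex_bij_betw_finite_nat[of C] atLeast0LessThan by metis
  define un where "un = inv_into C ix"
  have un_ix: "un (ix k) = k" if "k \<in> C" for k
    using ix that unfolding un_def bij_betw_def by simp
  have un_C: "un i \<in> C" if "i < card C" for i
    using ix that unfolding un_def bij_betw_def by (metis inv_into_into lessThan_iff)
  have ix_less: "ix k < card C" if "k \<in> C" for k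
    using ix that unfolding bij_betw_def by blast
  have C_control: "fst (control k cs) \<in> C" if "k \<in> C" for k cs
    using that control_conts[of k c "[]" cs] by (auto simp: C_def)
  have C_ok: "list_all (ok_com K A) k" if "k \<in> C" for k
    using that conts_ok[of k c "[]"] assms(1) by (auto simp: C_def)
  \<comment> \<open>States 0 and 1 halt, so the continuations are numbered from 2. The empty
    continuation inspects stack 0; \<open>Mark 1\<close> will be the first symbol of the code of
    \<open>True\<close>.\<close>
  define M :: "'a tm" where "M = \<lparr>num_tapes = K, num_states = card C + 2, num_marks = m,
    start_state = ix [c] + 2, accept_state = 0, reject_state = 1,
    delta = (\<lambda>q cs. if q < 2 then (q, idle cs)
      else let k = un (q - 2) in
        if k = [] then (if cs ! 0 = Mark 1 then 0 else 1, idle cs)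
        else (ix (fst (control k cs)) + 2, snd (control k cs)))\<rparr>"
  have M: "num_tapes M = K" "accept_state M = 0" "reject_state M = 1" by (simp_all add: M_def)
  have cC: "[c] \<in> C" by (simp add: C_def start_conts)
  have wf: "wf_tm M"
  proof -
    have "case delta M q cs of (q', acts) \<Rightarrow> q' < num_states M \<and> length acts = num_tapes M \<and>
       fst ` set acts \<subseteq> tape_alphabet M"
      if "q < num_states M" "length cs = num_tapes M" "set cs \<subseteq> tape_alphabet M" for q cs
    proof -
      have cs: "length cs = K" "set cs \<subseteq> A" "tape_alphabet M = A"
        using that by (auto simp: M_def A tape_alphabet_def)
      have i: "fst ` set (idle cs) \<subseteq> A" "length (idle cs) = K"
        using cs by (auto simp: idle_def)
      show ?thesis
      proof (cases "q < 2")
        case True then show ?thesis using i cs by (simp add: M_def)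
      next
        case False
        then have k: "un (q - 2) \<in> C" using that un_C by (simp add: M_def)
        show ?thesis using False i cs(3) control_acts[OF C_ok[OF k] cs(1,2)] ix_less[OF C_control[OF k, of cs]]
          by (simp add: M_def Let_def)
      qed
    qed
    then show ?thesis unfolding wf_tm_def using ix_less[OF cC] assms(2)
      by (simp add: M_def)
  qed
  have step: "tm_step M (ix k + 2, Ts) = (ix (fst (run1 (k, Ts))) + 2, snd (run1 (k, Ts)))"
    if "k \<in> C" "k \<noteq> []" for k Ts
    using that by (simp add: M_def un_ix run1_def Let_def split: prod.split)
  have run1_C: "fst (run1 (k, Ts)) \<in> C" if "k \<in> C" for k Ts
    using that C_control by (auto simp: run1_def split: prod.split) (metis fst_conv)
  have nil_run: "(run1 ^^ j) ([], Ts) = ([], Ts)" for j and Ts :: "'a tape list"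
    by (induction j) (simp_all add: run1_def)
  have steps: "(tm_step M ^^ j) (ix k + 2, Ts) = (ix (fst ((run1 ^^ j) (k, Ts))) + 2, snd ((run1 ^^ j) (k, Ts)))"
    if "k \<in> C" "\<And>i. i < j \<Longrightarrow> fst ((run1 ^^ i) (k, Ts)) \<noteq> []" for j k Ts
    using that
  proof (induction j arbitrary: k Ts)
    case (Suc j)
    obtain k' Ts' where r: "run1 (k, Ts) = (k', Ts')" by fastforce
    have "k \<noteq> []" using Suc.prems(2)[of 0] by simp
    moreover have "fst ((run1 ^^ i) (k', Ts')) \<noteq> []" if "i < j" for i
      using Suc.prems(2)[of "Suc i"] that r by (simp add: funpow_Suc_right del: funpow.simps)
    moreover have "k' \<in> C" using run1_C[OF Suc.prems(1), of Ts] r by simp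
    ultimately show ?case using Suc.IH[of k' Ts'] step[OF Suc.prems(1)] r
      by (simp add: funpow_Suc_right del: funpow.simps)
  qed simp
  have main: "fst ((tm_step M ^^ (t + 1)) (tm_init M w)) =
         (if top_cell (s' 0) = Mark 1 then accept_state M else reject_state M)"
    if e: "exec c (\<lambda>i. if i = 0 then map Letter w else []) t s'" for w t s'
  proof -
    obtain Ts where init: "tm_init M w = (ix [c] + 2, Ts)" by (simp add: tm_init_def M_def)
    have rep: "all_represent K Ts (\<lambda>i. if i = 0 then map Letter w else [])"
      using init assms(2)
      by (auto simp: tm_init_def M_def all_represent_def represents_def nth_Cons split: nat.split)
    obtain Ts' where fin: "(run1 ^^ t) ([c], Ts) = ([], Ts')" "all_represent K Ts' s'"
      using exec_run[OF e rep assms(1)] by blast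
    \<comment> \<open>\<open>steps\<close> needs nonempty continuations before step
      \<open>j\<close>, because the machine leaves the empty one for a halting state while
      \<open>run1\<close> stays there. Hence the first time at which it is empty; under
      \<open>run1\<close> the tapes no longer change after it.\<close>
    define j where "j = (LEAST j. fst ((run1 ^^ j) ([c], Ts)) = [])"
    have j: "fst ((run1 ^^ j) ([c], Ts)) = []" "j \<le> t"
      unfolding j_def using fin(1) by (auto intro: LeastI[of _ t] Least_le)
    have before: "fst ((run1 ^^ i) ([c], Ts)) \<noteq> []" if "i < j" for i
      using not_less_Least that unfolding j_def by blast
    obtain Tj where Tj: "(run1 ^^ j) ([c], Ts) = ([], Tj)" using j by (metis prod.collapse)
    have "(run1 ^^ ((t - j) + j)) ([c], Ts) = (run1 ^^ (t - j)) ([], Tj)"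
      by (simp only: funpow_add o_apply Tj)
    then have "(run1 ^^ t) ([c], Ts) = (run1 ^^ (t - j)) ([], Tj)"
      using j(2) by simp
    then have "Tj = Ts'" using fin nil_run by simp
    then have "(tm_step M ^^ j) (tm_init M w) = (ix [] + 2, Ts')"
      using steps[OF cC before] Tj init by simp
    moreover have "map read_tape Ts' ! 0 = top_cell (s' 0)"
      using fin(2) assms(2) by (auto simp: all_represent_def represents_read)
    ultimately have s1: "fst ((tm_step M ^^ Suc j) (tm_init M w)) = (if top_cell (s' 0) = Mark 1 then 0 else 1)"
      using un_ix[of "[]"] by (simp add: C_def M_def split: prod.split)
    \<comment> \<open>The halting state is reached after \<open>j + 1\<close> steps and has to
      persist until step \<open>t + 1\<close>.\<close>
    have stay: "fst ((tm_step M ^^ i) q) = fst q" if "fst q \<in> {0, 1}" for i q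
    proof -
      have fix1: "fst (tm_step M r) = fst r" if "fst r \<in> {0, 1}" for r
        using that by (cases r) (auto simp: M)
      show ?thesis using that by (induction i) (simp_all add: fix1)
    qed
    have t: "t + 1 = (t - j) + Suc j" using j by simp
    have "(tm_step M ^^ (t + 1)) (tm_init M w) = (tm_step M ^^ (t - j)) ((tm_step M ^^ Suc j) (tm_init M w))"
      unfolding t by (simp only: funpow_add o_apply)
    then show ?thesis using s1 stay[of "(tm_step M ^^ Suc j) (tm_init M w)" "t - j"] by (simp add: M)
  qed
  show ?thesis using that wf main by blast
qed

section \<open>Binary trees and their prefix codes\<close>

datatype tree = Leaf | Node tree tree

text \<open>The end of a tree is found by counting pending subtrees, so trees can lie on a stack
  without separators.\<close>

primrec code :: "tree \<Rightarrow> symbol cell list" where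
  "code Leaf = [Mark 0]"
| "code (Node l r) = Mark 1 # code l @ code r"

primrec tsize :: "tree \<Rightarrow> nat" where
  "tsize Leaf = 1"
| "tsize (Node l r) = 1 + tsize l + tsize r"

lemma length_code [simp]: "length (code t) = tsize t"
  by (induction t) auto

lemma set_code: "set (code t) \<subseteq> {Mark 0, Mark 1}"
  by (induction t) auto

lemma tsize_pos [simp]: "0 < tsize t"
  by (induction t) auto

class enc =
  fixes to_tree :: "'a \<Rightarrow> tree"
  assumes inj_to_tree: "to_tree x = to_tree y \<Longrightarrow> x = y"

abbreviation size_of :: "'a::enc \<Rightarrow> nat" where "size_of x \<equiv> tsize (to_tree x)"
abbreviation code_of :: "'a::enc \<Rightarrow> symbol cell list" where "code_of x \<equiv> code (to_tree x)"

instantiation unit :: enc begin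
definition "to_tree (u :: unit) = Leaf"
instance by standard simp
end

instantiation bool :: enc begin
definition "to_tree b = (if b then Node Leaf Leaf else Leaf)"
instance by standard (auto simp: to_tree_bool_def split: if_splits)
end

text \<open>Unary, with the same tree as a list of units: a number can be used as a list to fold
  over without conversion.\<close>

instantiation nat :: enc begin
primrec to_tree_nat :: "nat \<Rightarrow> tree" where
  "to_tree_nat 0 = Leaf"
| "to_tree_nat (Suc n) = Node Leaf (to_tree_nat n)"
instance
proof
  show "to_tree m = to_tree n \<Longrightarrow> m = n" for m n :: nat
  proof (induction m arbitrary: n)
    case 0 then show ?case by (cases n) auto
  next
    case (Suc m) then show ?case by (cases n) auto
  qed
qed
end

instantiation prod :: (enc, enc) enc begin
definition "to_tree p = Node (to_tree (fst p)) (to_tree (snd p))"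
instance by standard (auto simp: to_tree_prod_def prod_eq_iff dest: inj_to_tree)
end

instantiation list :: (enc) enc begin
primrec to_tree_list :: "'a list \<Rightarrow> tree" where
  "to_tree_list [] = Leaf"
| "to_tree_list (x # xs) = Node (to_tree x) (to_tree_list xs)"
instance
proof
  show "to_tree xs = to_tree ys \<Longrightarrow> xs = ys" for xs ys :: "'a list"
  proof (induction xs arbitrary: ys)
    case Nil then show ?case by (cases ys) auto
  next
    case (Cons x xs) then show ?case by (cases ys) (auto dest: inj_to_tree)
  qed
qed
end

instantiation quantifier :: enc begin
definition "to_tree q = (case q of ForallQ \<Rightarrow> Leaf | ExistsQ \<Rightarrow> Node Leaf Leaf)"
instance by standard (auto simp: to_tree_quantifier_def split: quantifier.splits)
end

instantiation symbol :: enc begin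
primrec to_tree_symbol :: "symbol \<Rightarrow> tree" where
  "to_tree_symbol (QuantSym q) = Node Leaf (to_tree q)"
| "to_tree_symbol AtomSym = Leaf"
| "to_tree_symbol ArgSym = Node (Node Leaf Leaf) Leaf"
| "to_tree_symbol Tick = Node (Node Leaf Leaf) (Node Leaf Leaf)"
instance
proof
  show "to_tree x = to_tree y \<Longrightarrow> x = y" for x y :: symbol
    by (cases x; cases y) (auto dest: inj_to_tree)
qed
end

lemma to_tree_pair [simp]: "to_tree (x, y) = Node (to_tree x) (to_tree y)"
  by (simp add: to_tree_prod_def)

section \<open>Polynomial bounds\<close>

text \<open>The base \<open>n + 2\<close> is at least 2 even for \<open>n = 0\<close>, so that a
  single power absorbs constants, sums and products.\<close>

definition pb :: "(nat \<Rightarrow> nat) \<Rightarrow> bool" where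
  "pb g \<longleftrightarrow> (\<exists>k. \<forall>n. g n \<le> (n + 2) ^ k)"

lemma pb_mono: "pb g \<Longrightarrow> (\<And>n. f n \<le> g n) \<Longrightarrow> pb f"
  unfolding pb_def using le_trans by blast

lemma pb_id: "pb (\<lambda>n. n)"
  unfolding pb_def by (rule exI[of _ 1]) simp

lemma pb_const: "pb (\<lambda>n. c)"
  unfolding pb_def
proof (intro exI[of _ c] allI)
  fix n :: nat
  have "c \<le> 2 ^ c" by (rule less_imp_le) simp
  also have "(2::nat) ^ c \<le> (n + 2) ^ c" by (rule power_mono) auto
  finally show "c \<le> (n + 2) ^ c" .
qed

lemma pb_mult:
  assumes "pb f" and "pb g"
  shows "pb (\<lambda>n. f n * g n)"
proof -
  obtain k l where "\<And>n. f n \<le> (n + 2) ^ k" "\<And>n. g n \<le> (n + 2) ^ l"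
    using assms unfolding pb_def by blast
  then have "f n * g n \<le> (n + 2) ^ (k + l)" for n
    by (metis mult_le_mono power_add)
  then show ?thesis unfolding pb_def by blast
qed

lemma pb_add:
  assumes "pb f" and "pb g"
  shows "pb (\<lambda>n. f n + g n)"
proof -
  have "pb (\<lambda>n. (f n + 1) * (g n + 1))"
  proof -
    obtain k l where kl: "\<And>n. f n \<le> (n + 2) ^ k" "\<And>n. g n \<le> (n + 2) ^ l"
      using assms unfolding pb_def by blast
    have "m + 1 \<le> (n + 2) ^ (k + 1)" if "m \<le> (n + 2) ^ k" for m n k :: nat
    proof -
      have "1 \<le> (n + 2) ^ k" by simp
      then have "m + 1 \<le> 2 * (n + 2) ^ k" using that by linarith
      also have "\<dots> \<le> (n + 2) * (n + 2) ^ k" by (rule mult_right_mono) auto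
      finally show ?thesis by simp
    qed
    then have "pb (\<lambda>n. f n + 1)" "pb (\<lambda>n. g n + 1)"
      using kl unfolding pb_def by blast+
    then show ?thesis by (rule pb_mult)
  qed
  then show ?thesis by (rule pb_mono) simp
qed

lemma pb_power: "pb f \<Longrightarrow> pb (\<lambda>n. f n ^ k)"
  by (induction k) (simp_all add: pb_const pb_mult)

lemma pb_Suc: "pb f \<Longrightarrow> pb (\<lambda>n. Suc (f n))"
  using pb_add[OF _ pb_const[of 1]] by simp

lemmas pb_intros = pb_id pb_const pb_mult pb_add pb_power pb_Suc

lemma pb_poly:
  assumes "pb f"
  obtains p :: "nat poly" where "\<And>n. f n \<le> poly p n"
proof -
  obtain k where "\<And>n. f n \<le> (n + 2) ^ k" using assms unfolding pb_def by blast
  then have "f n \<le> poly ([:2, 1:] ^ k) n" for n by (simp add: add.commute)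
  then show ?thesis using that by blast
qed

section \<open>Programs for operations on trees\<close>

text \<open>\<open>Mark 0\<close> and \<open>Mark 1\<close> write trees, \<open>Mark 2\<close>
  separates a lifted tree from what lies below it. Of the four stacks, 0 holds the data, 1 and 2
  buffer trees, and 3 is a counter.\<close>

abbreviation "cells \<equiv> insert Blank (range Letter \<union> Mark ` {..<3}) :: symbol cell set"
abbreviation "ok_prog \<equiv> ok_com 4 cells"

lemma exec_time: "exec c s t s' \<Longrightarrow> t = t' \<Longrightarrow> s' = s'' \<Longrightarrow> exec c s t' s''"
  by simp

definition skip :: "symbol com" where "skip = Loop 0 {} (Pop 0)"

lemma exec_skip: "exec skip s 1 s"
  unfolding skip_def by (rule LoopFalse) simp

primrec pushes :: "nat list \<Rightarrow> symbol cell \<Rightarrow> symbol com" where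
  "pushes [] x = skip"
| "pushes (j # js) x = Seq (Push j x) (pushes js x)"

lemma exec_pushes:
  "distinct js \<Longrightarrow> exec (pushes js x) s (3 * length js + 1) (\<lambda>i. if i \<in> set js then x # s i else s i)"
proof (induction js arbitrary: s)
  case Nil then show ?case using exec_skip by simp
next
  case (Cons j js)
  then have "exec (pushes js x) (s(j := x # s j)) (3 * length js + 1)
     (\<lambda>i. if i \<in> set js then x # (s(j := x # s j)) i else (s(j := x # s j)) i)" by simp
  from exec.Seq[OF exec.Push this] show ?case using Cons.prems
    unfolding pushes.simps by - (erule exec_time, auto simp: fun_eq_iff)
qed

definition lift_body :: "nat list \<Rightarrow> symbol com" where
  "lift_body js = Cond 0 {Mark 1}
     (Seq (pushes js (Mark 1)) (Seq (Push 3 (Mark 1)) (Pop 0)))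
     (Seq (pushes js (Mark 0)) (Seq (Pop 3) (Pop 0)))"

definition lift_loop :: "nat list \<Rightarrow> symbol com" where
  "lift_loop js = Loop 3 {Mark 1} (lift_body js)"

definition lifted :: "nat list \<Rightarrow> symbol cell list \<Rightarrow> symbol cell list \<Rightarrow> symbol stacks \<Rightarrow> symbol stacks" where
  "lifted js xs rest s = (\<lambda>i. if i = 0 then rest else if i \<in> set js then xs @ s i else s i)"

text \<open>Stack 3 counts in unary the subtrees that remain to be read.\<close>

lemma exec_lift_loop:
  assumes js: "distinct js" "0 \<notin> set js" "3 \<notin> set js"
    and "exec (lift_loop js) (lifted js (rev (code t)) rest s) T s'"
    and "s 0 = code t @ rest"
  shows "\<exists>T'\<le>T + (3 * length js + 8) * tsize t.
    exec (lift_loop js) (s(3 := Mark 1 # s 3)) T' s'"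
  using assms(4,5)
proof (induction t arbitrary: rest s T)
  case Leaf
  let ?s = "s(3 := Mark 1 # s 3)"
  let ?s1 = "\<lambda>i. if i \<in> set js then Mark 0 # ?s i else ?s i"
  let ?s2 = "?s1(3 := tl (?s1 3))"
  let ?s3 = "?s2(0 := tl (?s2 0))"
  have e: "?s3 = lifted js (rev (code Leaf)) rest s"
    using Leaf.prems(2) js by (auto simp: lifted_def fun_eq_iff)
  have "exec (lift_body js) ?s (3 * length js + 1 + (1 + 1 + 1) + 1 + 1) ?s3"
    unfolding lift_body_def
    by (rule CondFalse, use Leaf.prems(2) in simp)
      (rule exec.Seq[OF exec_pushes[OF js(1)] exec.Seq[OF exec.Pop exec.Pop]])
  moreover have "top_cell (?s 3) \<in> {Mark 1}" by simp
  ultimately have "exec (lift_loop js) ?s (3 * length js + 1 + (1 + 1 + 1) + 1 + 1 + T + 1) s'"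
    using Leaf.prems(1) unfolding e lift_loop_def by (intro LoopTrue)
  then show ?case
    by (intro exI[of _ "3 * length js + 1 + (1 + 1 + 1) + 1 + 1 + T + 1"] conjI) (simp, assumption)
next
  case (Node l r)
  let ?s = "s(3 := Mark 1 # s 3)"
  let ?s1 = "\<lambda>i. if i \<in> set js then Mark 1 # ?s i else ?s i"
  let ?s2 = "?s1(3 := Mark 1 # ?s1 3)"
  let ?s3 = "?s2(0 := tl (?s2 0))"
  let ?u = "lifted js [Mark 1] (code l @ code r @ rest) (s(3 := Mark 1 # s 3))"
  let ?v = "lifted js (rev (code l) @ [Mark 1]) (code r @ rest) s"
  have e: "?s3 = ?u(3 := Mark 1 # ?u 3)"
    using Node.prems(2) js by (auto simp: lifted_def fun_eq_iff)
  have "exec (lift_body js) ?s (3 * length js + 1 + (2 + 1 + 1) + 1 + 1) ?s3"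
    unfolding lift_body_def
    by (rule CondTrue, use Node.prems(2) in simp)
      (rule exec.Seq[OF exec_pushes[OF js(1)] exec.Seq[OF exec.Push exec.Pop]])
  note body = this[unfolded e]
  \<comment> \<open>The induction hypotheses prepend the reading of one tree to a given run of the
    loop, so the run is built backwards: first \<open>r\<close>, then \<open>l\<close>, then the
    mark of the node.\<close>
  have "lifted js (rev (code r)) rest ?v = lifted js (rev (code (Node l r))) rest s"
    by (auto simp: lifted_def fun_eq_iff)
  with Node.prems have "exec (lift_loop js) (lifted js (rev (code r)) rest ?v) T s'"
    by simp
  moreover have "?v 0 = code r @ rest" by (simp add: lifted_def)
  ultimately obtain T1 where T1: "T1 \<le> T + (3 * length js + 8) * tsize r"
    "exec (lift_loop js) (?v(3 := Mark 1 # ?v 3)) T1 s'"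
    using Node.IH(2)[of rest ?v T] by blast
  have "?v(3 := Mark 1 # ?v 3) = lifted js (rev (code l)) (code r @ rest) ?u"
    using js by (auto simp: lifted_def fun_eq_iff)
  with T1(2) have "exec (lift_loop js) (lifted js (rev (code l)) (code r @ rest) ?u) T1 s'"
    by simp
  moreover have "?u 0 = code l @ code r @ rest" by (simp add: lifted_def)
  ultimately obtain T2 where T2: "T2 \<le> T1 + (3 * length js + 8) * tsize l"
    "exec (lift_loop js) (?u(3 := Mark 1 # ?u 3)) T2 s'"
    using Node.IH(1)[of "code r @ rest" ?u T1] by blast
  have "top_cell (?s 3) \<in> {Mark 1}" by simp
  from LoopTrue[where i = 3, OF this body T2(2)[unfolded lift_loop_def], folded lift_loop_def]
  have "exec (lift_loop js) ?s (3 * length js + 1 + (2 + 1 + 1) + 1 + 1 + T2 + 1) s'" .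
  then show ?case using T1(1) T2(1)
    by (intro exI[of _ "3 * length js + 1 + (2 + 1 + 1) + 1 + 1 + T2 + 1"] conjI) (simp add: algebra_simps, assumption)
qed

text \<open>The \<open>Mark 0\<close> on stack 3 closes the counter, and the \<open>Mark 1\<close>
  above it announces one tree to be read.\<close>

definition lift :: "nat list \<Rightarrow> symbol com" where
  "lift js = Seq (pushes js (Mark 2)) (Seq (Push 3 (Mark 0)) (Seq (Push 3 (Mark 1))
     (Seq (lift_loop js) (Pop 3))))"

lemma exec_lift:
  assumes js: "distinct js" "0 \<notin> set js" "3 \<notin> set js" and s: "s 0 = code t @ rest"
  shows "\<exists>T\<le>(3 * length js + 8) * tsize t + 3 * length js + 11.
    exec (lift js) s T (lifted js (rev (code t) @ [Mark 2]) rest s)"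
proof -
  let ?s1 = "\<lambda>i. if i \<in> set js then Mark 2 # s i else s i"
  let ?s2 = "?s1(3 := Mark 0 # ?s1 3)"
  let ?s3 = "?s2(3 := Mark 1 # ?s2 3)"
  let ?s4 = "lifted js (rev (code t)) rest ?s2"
  let ?s5 = "?s4(3 := tl (?s4 3))"
  have "exec (lift_loop js) ?s4 1 ?s4"
    unfolding lift_loop_def using js by (intro LoopFalse) (auto simp: lifted_def)
  from exec_lift_loop[OF js this] s js
  obtain T where T: "T \<le> 1 + (3 * length js + 8) * tsize t"
    "exec (lift_loop js) ?s3 T ?s4" by auto
  have "?s5 = lifted js (rev (code t) @ [Mark 2]) rest s"
    using js by (auto simp: lifted_def fun_eq_iff)
  moreover have "exec (lift js) s (3 * length js + 1 + (2 + (2 + (T + 1 + 1) + 1) + 1) + 1) ?s5"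
    unfolding lift_def
    by (rule exec.Seq[OF exec_pushes[OF js(1)] exec.Seq[OF exec.Push exec.Seq[OF exec.Push exec.Seq[OF T(2) exec.Pop]]]])
  ultimately show ?thesis using T(1) by (intro exI[of _ "3 * length js + 1 + (2 + (2 + (T + 1 + 1) + 1) + 1) + 1"]) auto
qed

definition lower_loop :: "nat \<Rightarrow> symbol com" where
  "lower_loop j = Loop j {Mark 0, Mark 1} (Seq (Cond j {Mark 1} (Push 0 (Mark 1)) (Push 0 (Mark 0))) (Pop j))"

definition lower :: "nat \<Rightarrow> symbol com" where
  "lower j = Seq (lower_loop j) (Pop j)"

lemma exec_lower_loop:
  assumes "set xs \<subseteq> {Mark 0, Mark 1}" and "j \<noteq> 0" and "s j = xs @ ys" and "top_cell ys \<notin> {Mark 0, Mark 1}"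
  shows "exec (lower_loop j) s (6 * length xs + 1) (s(0 := rev xs @ s 0, j := ys))"
  using assms
proof (induction xs arbitrary: s)
  case Nil
  then show ?case unfolding lower_loop_def
    by (auto intro!: exec_time[OF LoopFalse] simp: fun_eq_iff)
next
  case (Cons x xs)
  let ?s1 = "s(0 := x # s 0)"
  let ?s2 = "?s1(j := tl (?s1 j))"
  have "exec (Cond j {Mark 1} (Push 0 (Mark 1)) (Push 0 (Mark 0))) s (2 + 1) ?s1"
  proof (cases "x = Mark 1")
    case True
    show ?thesis unfolding True by (rule CondTrue) (use Cons.prems True in simp, rule exec.Push)
  next
    case False
    then have x: "x = Mark 0" using Cons.prems by auto
    show ?thesis unfolding x by (rule CondFalse) (use Cons.prems x in simp, rule exec.Push)
  qed
  then have b: "exec (Seq (Cond j {Mark 1} (Push 0 (Mark 1)) (Push 0 (Mark 0))) (Pop j)) s (2 + 1 + 1 + 1) ?s2"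
    by (rule exec.Seq[OF _ exec.Pop])
  have t: "top_cell (s j) \<in> {Mark 0, Mark 1}" using Cons.prems by auto
  have "exec (lower_loop j) ?s2 (6 * length xs + 1) (?s2(0 := rev xs @ ?s2 0, j := ys))"
    using Cons.prems by (intro Cons.IH) auto
  from LoopTrue[where s = s and i = j, OF t b this[unfolded lower_loop_def]] show ?case
    unfolding lower_loop_def by (rule exec_time) (use Cons.prems in \<open>auto simp: fun_eq_iff\<close>)
qed

lemma exec_lower:
  assumes "j \<noteq> 0" and "s j = rev (code t) @ Mark 2 # ys"
  shows "exec (lower j) s (6 * tsize t + 3) (s(0 := code t @ s 0, j := ys))"
proof -
  have "exec (lower_loop j) s (6 * length (rev (code t)) + 1) (s(0 := rev (rev (code t)) @ s 0, j := Mark 2 # ys))"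
    using set_code[of t] by (intro exec_lower_loop assms) auto
  from exec.Seq[OF this exec.Pop[of j]] show ?thesis unfolding lower_def
    by - (erule exec_time, auto simp: fun_eq_iff)
qed

text \<open>A Hoare triple for stack 0 with the frame built in: what lies below \<open>u\<close>,
  and all other stacks, are as before at the end. So a program can be applied to the topmost item
  wherever it occurs.\<close>

definition runs :: "symbol com \<Rightarrow> symbol cell list \<Rightarrow> symbol cell list \<Rightarrow> nat \<Rightarrow> bool" where
  "runs c u v T \<longleftrightarrow> (\<forall>s rest. s 0 = u @ rest \<longrightarrow> (\<exists>t\<le>T. exec c s t (s(0 := v @ rest))))"

lemma runs_mono: "runs c u v T \<Longrightarrow> T \<le> T' \<Longrightarrow> runs c u v T'"
  unfolding runs_def using le_trans by blast

lemma runs_frame: "runs c u v T \<Longrightarrow> runs c (u @ r) (v @ r) T"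
  unfolding runs_def by simp

lemma runs_Cons: "runs c u v T \<Longrightarrow> u' = u @ r \<Longrightarrow> v' = v @ r \<Longrightarrow> runs c u' v' T"
  using runs_frame by simp

lemma runs_Seq:
  assumes "runs c u v T" and "runs d v w T'"
  shows "runs (Seq c d) u w (T + T' + 1)"
  unfolding runs_def
proof (intro allI impI)
  fix s :: "symbol stacks" and rest assume s: "s 0 = u @ rest"
  obtain t where t: "t \<le> T" "exec c s t (s(0 := v @ rest))"
    using assms(1) s unfolding runs_def by blast
  obtain t' where t': "t' \<le> T'" "exec d (s(0 := v @ rest)) t' (s(0 := w @ rest))"
    using assms(2)[unfolded runs_def, rule_format, of "s(0 := v @ rest)" rest] by auto
  show "\<exists>t\<le>T + T' + 1. exec (Seq c d) s t (s(0 := w @ rest))"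
    using exec.Seq[OF t(2) t'(2)] t(1) t'(1) by (intro exI conjI) auto
qed

lemma runs_Push: "runs (Push 0 x) u (x # u) 2"
  unfolding runs_def
proof (intro allI impI)
  fix s :: "symbol stacks" and rest assume "s 0 = u @ rest"
  then show "\<exists>t\<le>2. exec (Push 0 x) s t (s(0 := (x # u) @ rest))"
    using exec.Push[of 0 x s] by (intro exI[of _ 2]) simp
qed

lemma runs_Pop: "runs (Pop 0) (x # u) u 1"
  unfolding runs_def
proof (intro allI impI)
  fix s :: "symbol stacks" and rest assume "s 0 = (x # u) @ rest"
  then show "\<exists>t\<le>1. exec (Pop 0) s t (s(0 := u @ rest))"
    using exec.Pop[of 0 s] by (intro exI[of _ 1]) simp
qed

lemma runs_skip: "runs skip u u 1"
  unfolding runs_def using exec_skip by (metis fun_upd_triv order_refl)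

lemma runs_Cond:
  assumes "x \<in> X \<Longrightarrow> runs c (x # u) v T" and "x \<notin> X \<Longrightarrow> runs d (x # u) v T"
  shows "runs (Cond 0 X c d) (x # u) v (T + 1)"
  unfolding runs_def
proof (intro allI impI)
  fix s :: "symbol stacks" and rest assume s: "s 0 = (x # u) @ rest"
  have top: "top_cell (s 0) = x" using s by simp
  obtain t where "t \<le> T" "exec (Cond 0 X c d) s (t + 1) (s(0 := v @ rest))"
  proof (cases "x \<in> X")
    case True
    then obtain t where "t \<le> T" "exec c s t (s(0 := v @ rest))"
      using assms(1) s unfolding runs_def by blast
    then show ?thesis using that CondTrue[of s 0 X c] True top by simp
  next
    case False
    then obtain t where "t \<le> T" "exec d s t (s(0 := v @ rest))"
      using assms(2) s unfolding runs_def by blast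
    then show ?thesis using that CondFalse[of s 0 X d] False top by simp
  qed
  then show "\<exists>t\<le>T + 1. exec (Cond 0 X c d) s t (s(0 := v @ rest))"
    by (meson add_le_mono1)
qed

lemma runs_LoopFalse:
  assumes "x \<notin> X"
  shows "runs (Loop 0 X c) (x # u) (x # u) 1"
  unfolding runs_def
proof (intro allI impI)
  fix s :: "symbol stacks" and rest assume s: "s 0 = (x # u) @ rest"
  then have "exec (Loop 0 X c) s 1 s" using assms by (intro LoopFalse) simp
  then show "\<exists>t\<le>1. exec (Loop 0 X c) s t (s(0 := (x # u) @ rest))"
    using s by (metis fun_upd_triv order_refl)
qed

lemma runs_LoopTrue:
  assumes "x \<in> X" and "runs c (x # u) v T" and "runs (Loop 0 X c) v w T'"
  shows "runs (Loop 0 X c) (x # u) w (T + T' + 1)"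
  unfolding runs_def
proof (intro allI impI)
  fix s :: "symbol stacks" and rest assume s: "s 0 = (x # u) @ rest"
  then obtain t where t: "t \<le> T" "exec c s t (s(0 := v @ rest))"
    using assms(2) unfolding runs_def by blast
  obtain t' where t': "t' \<le> T'" "exec (Loop 0 X c) (s(0 := v @ rest)) t' (s(0 := w @ rest))"
    using assms(3)[unfolded runs_def, rule_format, of "s(0 := v @ rest)" rest] by auto
  have "top_cell (s 0) \<in> X" using s assms(1) by simp
  from LoopTrue[where i = 0, OF this t(2) t'(2)]
  show "\<exists>t\<le>T + T' + 1. exec (Loop 0 X c) s t (s(0 := w @ rest))"
    using t(1) t'(1) by (intro exI conjI) auto
qed

definition dup :: "symbol com" where "dup = Seq (lift [1, 2]) (Seq (lower 1) (lower 2))"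
definition drop_tree :: "symbol com" where "drop_tree = lift []"
definition swap :: "symbol com" where "swap = Seq (lift [1]) (Seq (lift [2]) (Seq (lower 1) (lower 2)))"

lemma runs_drop: "runs drop_tree (code t) [] (8 * tsize t + 11)"
  unfolding runs_def drop_tree_def
proof (intro allI impI)
  fix s :: "symbol stacks" and rest assume "s 0 = code t @ rest"
  with exec_lift[of "[]" s t rest]
  obtain T where "T \<le> 8 * tsize t + 11" "exec (lift []) s T (lifted [] (rev (code t) @ [Mark 2]) rest s)"
    by auto
  moreover have "lifted [] (rev (code t) @ [Mark 2]) rest s = s(0 := [] @ rest)"
    by (auto simp: lifted_def fun_eq_iff)
  ultimately show "\<exists>T\<le>8 * tsize t + 11. exec (lift []) s T (s(0 := [] @ rest))" by auto
qed

lemma runs_dup: "runs dup (code t) (code t @ code t) (26 * tsize t + 25)"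
  unfolding runs_def dup_def
proof (intro allI impI)
  fix s :: "symbol stacks" and rest assume "s 0 = code t @ rest"
  with exec_lift[of "[1, 2]" s t rest]
  have "\<exists>T\<le>14 * tsize t + 17. exec (lift [1, 2]) s T (lifted [1, 2] (rev (code t) @ [Mark 2]) rest s)"
    by (simp add: add.commute)
  then obtain T where T: "T \<le> 14 * tsize t + 17"
    "exec (lift [1, 2]) s T (lifted [1, 2] (rev (code t) @ [Mark 2]) rest s)" by blast
  let ?s1 = "lifted [1, 2] (rev (code t) @ [Mark 2]) rest s"
  let ?s2 = "?s1(0 := code t @ ?s1 0, 1 := s 1)"
  let ?s3 = "?s2(0 := code t @ ?s2 0, 2 := s 2)"
  have "exec (lower 1) ?s1 (6 * tsize t + 3) ?s2" by (rule exec_lower) (auto simp: lifted_def)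
  moreover have "exec (lower 2) ?s2 (6 * tsize t + 3) ?s3" by (rule exec_lower) (auto simp: lifted_def)
  moreover have "?s3 = s(0 := (code t @ code t) @ rest)"
    by (auto simp: lifted_def fun_eq_iff)
  moreover note exec.Seq[OF T(2) exec.Seq[OF calculation(1,2)]]
  ultimately have "exec (Seq (lift [1, 2]) (Seq (lower 1) (lower 2))) s
    (T + (6 * tsize t + 3 + (6 * tsize t + 3) + 1) + 1) (s(0 := (code t @ code t) @ rest))"
    by simp
  with T(1) show "\<exists>T\<le>26 * tsize t + 25. exec (Seq (lift [1, 2]) (Seq (lower 1) (lower 2))) s T
    (s(0 := (code t @ code t) @ rest))"
    by (intro exI[of _ "T + (6 * tsize t + 3 + (6 * tsize t + 3) + 1) + 1"] conjI) (simp, assumption)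
qed

lemma runs_swap: "runs swap (code t @ code u) (code u @ code t) (17 * (tsize t + tsize u) + 37)"
  unfolding runs_def swap_def
proof (intro allI impI)
  fix s :: "symbol stacks" and rest assume s: "s 0 = (code t @ code u) @ rest"
  from exec_lift[of "[1]" s t "code u @ rest"] s
  have "\<exists>T\<le>11 * tsize t + 14. exec (lift [1]) s T (lifted [1] (rev (code t) @ [Mark 2]) (code u @ rest) s)"
    by (simp add: add.commute)
  then obtain T where T: "T \<le> 11 * tsize t + 14"
    "exec (lift [1]) s T (lifted [1] (rev (code t) @ [Mark 2]) (code u @ rest) s)" by blast
  let ?s1 = "lifted [1] (rev (code t) @ [Mark 2]) (code u @ rest) s"
  let ?s2 = "lifted [2] (rev (code u) @ [Mark 2]) rest ?s1"
  have "?s1 0 = code u @ rest" by (simp add: lifted_def)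
  with exec_lift[of "[2]" ?s1 u rest]
  have "\<exists>T\<le>11 * tsize u + 14. exec (lift [2]) ?s1 T ?s2"
    by (simp add: add.commute)
  then obtain T' where T': "T' \<le> 11 * tsize u + 14" "exec (lift [2]) ?s1 T' ?s2" by blast
  let ?s3 = "?s2(0 := code t @ ?s2 0, 1 := s 1)"
  let ?s4 = "?s3(0 := code u @ ?s3 0, 2 := s 2)"
  have l: "exec (lower 1) ?s2 (6 * tsize t + 3) ?s3" by (rule exec_lower) (auto simp: lifted_def)
  have l': "exec (lower 2) ?s3 (6 * tsize u + 3) ?s4" by (rule exec_lower) (auto simp: lifted_def)
  have "?s4 = s(0 := (code u @ code t) @ rest)"
    by (auto simp: lifted_def fun_eq_iff)
  with exec.Seq[OF T(2) exec.Seq[OF T'(2) exec.Seq[OF l l']]]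
  have "exec (Seq (lift [1]) (Seq (lift [2]) (Seq (lower 1) (lower 2)))) s
    (T + (T' + (6 * tsize t + 3 + (6 * tsize u + 3) + 1) + 1) + 1) (s(0 := (code u @ code t) @ rest))"
    by simp
  then show "\<exists>T\<le>17 * (tsize t + tsize u) + 37. exec (Seq (lift [1]) (Seq (lift [2]) (Seq (lower 1) (lower 2)))) s T
    (s(0 := (code u @ code t) @ rest))" using T(1) T'(1)
    by (intro exI[of _ "T + (T' + (6 * tsize t + 3 + (6 * tsize u + 3) + 1) + 1) + 1"] conjI) (simp, assumption)
qed

lemma ok_skip: "ok_prog skip"
  by (simp add: skip_def)

lemma ok_pushes: "\<forall>j\<in>set js. j < 4 \<Longrightarrow> x \<in> cells \<Longrightarrow> ok_prog (pushes js x)"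
  by (induction js) (auto simp: ok_skip)

lemma ok_lift: "\<forall>j\<in>set js. j < 4 \<Longrightarrow> ok_prog (lift js)"
  unfolding lift_def lift_loop_def lift_body_def ok_com.simps by (intro conjI ok_pushes) auto

lemma ok_lower: "j < 4 \<Longrightarrow> ok_prog (lower j)"
  by (auto simp: lower_def lower_loop_def)

lemma ok_words [simp]: "ok_prog dup" "ok_prog drop_tree" "ok_prog swap" "ok_prog skip"
  unfolding dup_def drop_tree_def swap_def ok_com.simps by (intro conjI ok_lift ok_lower ok_skip; simp)+

section \<open>Functions computable in polynomial time\<close>

abbreviation "fst2 p \<equiv> fst (snd p)"
abbreviation "fst3 p \<equiv> fst2 (snd p)"
abbreviation "fst4 p \<equiv> fst3 (snd p)"
abbreviation "snd2 p \<equiv> snd (snd p)"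
abbreviation "snd3 p \<equiv> snd2 (snd p)"
abbreviation "snd4 p \<equiv> snd3 (snd p)"

text \<open>One function bounds both running time and output size. It is monotone so that it can be
  applied to bounds on intermediate results.\<close>

definition computes :: "symbol com \<Rightarrow> (nat \<Rightarrow> nat) \<Rightarrow> ('a::enc \<Rightarrow> 'b::enc) \<Rightarrow> bool" where
  "computes c g f \<longleftrightarrow> ok_prog c \<and> pb g \<and> mono g \<and> (\<forall>x. size_of (f x) \<le> g (size_of x)) \<and>
     (\<forall>x. runs c (code_of x) (code_of (f x)) (g (size_of x)))"

lemma computesD:
  assumes "computes c g f"
  shows "ok_prog c" "pb g" "mono g" "\<And>x. size_of (f x) \<le> g (size_of x)"
    "\<And>x. runs c (code_of x) (code_of (f x)) (g (size_of x))"
  using assms unfolding computes_def by blast+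

definition polyc :: "('a::enc \<Rightarrow> 'b::enc) \<Rightarrow> bool" where
  "polyc f \<longleftrightarrow> (\<exists>c g. computes c g f)"

lemmas polycD = polyc_def [THEN iffD1]

text \<open>Monotonicity comes for free, as \<open>g\<close> can be enlarged to a power of
  \<open>n + 2\<close>.\<close>

lemma polycI:
  assumes "ok_prog c" and "pb g" and "\<And>x. size_of (f x) \<le> g (size_of x)"
    and "\<And>x. runs c (code_of x) (code_of (f x)) (g (size_of x))"
  shows "polyc f"
proof -
  obtain k where k: "\<And>n. g n \<le> (n + 2) ^ k" using assms(2) unfolding pb_def by blast
  have "mono (\<lambda>n::nat. (n + 2) ^ k)" by (intro monoI power_mono) auto
  moreover have "pb (\<lambda>n. (n + 2) ^ k)" by (intro pb_intros)
  ultimately have "computes c (\<lambda>n. (n + 2) ^ k) f"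
    unfolding computes_def using assms(1,3,4) k by (blast intro: runs_mono le_trans)
  then show ?thesis unfolding polyc_def by blast
qed

lemma polyc_size:
  assumes "polyc f"
  shows "\<exists>g. pb g \<and> mono g \<and> (\<forall>x. size_of (f x) \<le> g (size_of x))"
  using polycD[OF assms] computesD by metis

lemma pb_comp:
  assumes "pb f" and "pb g"
  shows "pb (\<lambda>n. f (g n))"
proof -
  obtain k where k: "\<And>n. f n \<le> (n + 2) ^ k" using assms(1) unfolding pb_def by blast
  have "pb (\<lambda>n. (g n + 2) ^ k)" using assms(2) by (intro pb_intros)
  then show ?thesis by (rule pb_mono) (rule k)
qed

lemma polyc_id: "polyc (\<lambda>x. x)"
  by (rule polycI[of skip "\<lambda>n. n"])
    (auto intro!: pb_intros runs_mono[OF runs_skip] Suc_leI)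

text \<open>Programs see only trees, so a change of type that keeps the tree is free. This yields
  \<open>Cons\<close>, \<open>Suc\<close> and \<open>length\<close> from functions on pairs and
  lists.\<close>

lemma polyc_same:
  assumes "polyc f" and "\<And>x. to_tree (g x) = to_tree (f x)"
  shows "polyc g"
  using assms unfolding polyc_def computes_def by simp

lemma polyc_comp:
  assumes "polyc f" and "polyc g"
  shows "polyc (\<lambda>x. g (f x))"
proof -
  obtain c p where "computes c p f" using polycD[OF assms(1)] by blast
  note f = computesD[OF this]
  obtain d q where "computes d q g" using polycD[OF assms(2)] by blast
  note g = computesD[OF this]
  have q: "q (size_of (f x)) \<le> q (p (size_of x))" for x
    using f(4) g(3) by (simp add: monoD)
  show ?thesis
  proof (rule polycI)
    show "ok_prog (Seq c d)" using f g by simp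
    show "pb (\<lambda>n. p n + q (p n) + 1)" using f g by (intro pb_intros pb_comp[OF g(2)])
    show "size_of (g (f x)) \<le> p (size_of x) + q (p (size_of x)) + 1" for x
      using g(4)[of "f x"] q[of x] by linarith
    show "runs (Seq c d) (code_of x) (code_of (g (f x))) (p (size_of x) + q (p (size_of x)) + 1)" for x
      using runs_Seq[OF f(5) runs_mono[OF g(5) q]] .
  qed
qed

lemma polyc_pair:
  assumes "polyc f" and "polyc g"
  shows "polyc (\<lambda>x. (f x, g x))"
proof -
  obtain c p where "computes c p f" using polycD[OF assms(1)] by blast
  note f = computesD[OF this]
  obtain d q where "computes d q g" using polycD[OF assms(2)] by blast
  note g = computesD[OF this]
  let ?T = "\<lambda>n. (26 * n + 25) + (p n + (17 * (p n + n) + 37 + (q n + (17 * (q n + p n) + 37 + 2 + 1) + 1) + 1) + 1) + 1"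
  show ?thesis
  proof (rule polycI)
    show "ok_prog (Seq dup (Seq c (Seq swap (Seq d (Seq swap (Push 0 (Mark 1)))))))" using f g by simp
    show "pb ?T" using f g by (intro pb_intros)
    fix x
    show "size_of (f x, g x) \<le> ?T (size_of x)"
      using f(4)[of x] g(4)[of x] by simp
    show "runs (Seq dup (Seq c (Seq swap (Seq d (Seq swap (Push 0 (Mark 1)))))))
      (code_of x) (code_of (f x, g x)) (?T (size_of x))"
    proof (intro runs_Seq)
      show "runs dup (code_of x) (code_of x @ code_of x) (26 * size_of x + 25)" by (rule runs_dup)
      show "runs c (code_of x @ code_of x) (code_of (f x) @ code_of x) (p (size_of x))"
        by (rule runs_frame[OF f(5)])
      show "runs swap (code_of (f x) @ code_of x) (code_of x @ code_of (f x)) (17 * (p (size_of x) + size_of x) + 37)"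
        using f(4)[of x] by (intro runs_mono[OF runs_swap]) simp
      show "runs d (code_of x @ code_of (f x)) (code_of (g x) @ code_of (f x)) (q (size_of x))"
        by (rule runs_frame[OF g(5)])
      show "runs swap (code_of (g x) @ code_of (f x)) (code_of (f x) @ code_of (g x)) (17 * (q (size_of x) + p (size_of x)) + 37)"
        using f(4)[of x] g(4)[of x] by (intro runs_mono[OF runs_swap]) simp
      show "runs (Push 0 (Mark 1)) (code_of (f x) @ code_of (g x)) (code_of (f x, g x)) 2"
        using runs_Push by simp
    qed
  qed
qed

lemma polyc_fst1: "polyc (fst :: 'a::enc \<times> 'b::enc \<Rightarrow> 'a)"
proof (rule polycI)
  let ?T = "\<lambda>n. 1 + (17 * n + 37 + (8 * n + 11) + 1) + 1"
  show "ok_prog (Seq (Pop 0) (Seq swap drop_tree))" by simp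
  show "pb ?T" by (intro pb_intros)
  fix x :: "'a \<times> 'b"
  obtain a b where x: "x = (a, b)" by (cases x)
  show "size_of (fst x) \<le> ?T (size_of x)" by (simp add: x)
  show "runs (Seq (Pop 0) (Seq swap drop_tree)) (code_of x) (code_of (fst x)) (?T (size_of x))"
  proof (intro runs_Seq)
    show "runs (Pop 0) (code_of x) (code_of a @ code_of b) 1" using runs_Pop by (simp add: x)
    show "runs swap (code_of a @ code_of b) (code_of b @ code_of a) (17 * size_of x + 37)"
      by (rule runs_mono[OF runs_swap]) (simp add: x)
    show "runs drop_tree (code_of b @ code_of a) (code_of (fst x)) (8 * size_of x + 11)"
      by (rule runs_mono[OF runs_Cons[OF runs_drop]]) (auto simp: x)
  qed
qed

lemma polyc_snd1: "polyc (snd :: 'a::enc \<times> 'b::enc \<Rightarrow> 'b)"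
proof (rule polycI)
  let ?T = "\<lambda>n. 1 + (8 * n + 11) + 1"
  show "ok_prog (Seq (Pop 0) drop_tree)" by simp
  show "pb ?T" by (intro pb_intros)
  fix x :: "'a \<times> 'b"
  obtain a b where x: "x = (a, b)" by (cases x)
  show "size_of (snd x) \<le> ?T (size_of x)" by (simp add: x)
  show "runs (Seq (Pop 0) drop_tree) (code_of x) (code_of (snd x)) (?T (size_of x))"
  proof (intro runs_Seq)
    show "runs (Pop 0) (code_of x) (code_of a @ code_of b) 1" using runs_Pop by (simp add: x)
    show "runs drop_tree (code_of a @ code_of b) (code_of (snd x)) (8 * size_of x + 11)"
      by (rule runs_mono[OF runs_Cons[OF runs_drop]]) (auto simp: x)
  qed
qed

lemma polyc_fst: "polyc f \<Longrightarrow> polyc (\<lambda>x. fst (f x))"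
  by (rule polyc_comp[OF _ polyc_fst1])

lemma polyc_snd: "polyc f \<Longrightarrow> polyc (\<lambda>x. snd (f x))"
  by (rule polyc_comp[OF _ polyc_snd1])

primrec push_all :: "symbol cell list \<Rightarrow> symbol com" where
  "push_all [] = skip"
| "push_all (x # xs) = Seq (push_all xs) (Push 0 x)"

lemma runs_push_all: "runs (push_all xs) [] xs (3 * length xs + 1)"
proof (induction xs)
  case Nil then show ?case using runs_skip by simp
next
  case (Cons x xs)
  from runs_Seq[OF Cons runs_Push[of x]] show ?case by (simp add: runs_mono)
qed

lemma polyc_const: "polyc (\<lambda>x::'a::enc. c :: 'b::enc)"
proof (rule polycI)
  let ?T = "\<lambda>n. 8 * n + 11 + (3 * size_of c + 1) + 1"
  have "set xs \<subseteq> {Mark 0, Mark 1} \<Longrightarrow> ok_prog (push_all xs)" for xs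
    by (induction xs) auto
  then show "ok_prog (Seq drop_tree (push_all (code_of c)))" using set_code by simp
  show "pb ?T" by (intro pb_intros)
  fix x :: 'a
  show "size_of c \<le> ?T (size_of x)" by simp
  show "runs (Seq drop_tree (push_all (code_of c))) (code_of x) (code_of c) (?T (size_of x))"
    using runs_push_all[of "code_of c"] by (intro runs_Seq[OF runs_drop]) simp
qed

lemma polyc_if:
  assumes "polyc b" and "polyc f" and "polyc g"
  shows "polyc (\<lambda>x. if b x then f x else g x)"
proof -
  obtain e r where "computes e r b" using polycD[OF assms(1)] by blast
  note b = computesD[OF this]
  obtain c p where "computes c p f" using polycD[OF assms(2)] by blast
  note f = computesD[OF this]
  obtain d q where "computes d q g" using polycD[OF assms(3)] by blast
  note g = computesD[OF this]
  \<comment> \<open>The code of \<open>True\<close> has three symbols and that of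
    \<open>False\<close> one; the branches have to pop them.\<close>
  let ?C = "Seq (Pop 0) (Seq (Pop 0) (Seq (Pop 0) c))" and ?D = "Seq (Pop 0) d"
  let ?T = "\<lambda>n. (26 * n + 25) + (r n + ((p n + q n + 6) + 1) + 1) + 1"
  show ?thesis
  proof (rule polycI)
    show "ok_prog (Seq dup (Seq e (Cond 0 {Mark 1} ?C ?D)))" using b f g by simp
    show "pb ?T" using b f g by (intro pb_intros)
    fix x
    show "size_of (if b x then f x else g x) \<le> ?T (size_of x)"
      using f(4)[of x] g(4)[of x] by simp
    show "runs (Seq dup (Seq e (Cond 0 {Mark 1} ?C ?D))) (code_of x)
      (code_of (if b x then f x else g x)) (?T (size_of x))"
    proof (intro runs_Seq)
      show "runs dup (code_of x) (code_of x @ code_of x) (26 * size_of x + 25)" by (rule runs_dup)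
      show "runs e (code_of x @ code_of x) (code_of (b x) @ code_of x) (r (size_of x))"
        by (rule runs_frame[OF b(5)])
      show "runs (Cond 0 {Mark 1} ?C ?D) (code_of (b x) @ code_of x)
        (code_of (if b x then f x else g x)) ((p (size_of x) + q (size_of x) + 6) + 1)"
      proof (cases "b x")
        case True
        have "runs ?C (Mark 1 # Mark 0 # Mark 0 # code_of x) (code_of (f x))
          (1 + (1 + (1 + p (size_of x) + 1) + 1) + 1)"
          by (rule runs_Seq[OF runs_Pop runs_Seq[OF runs_Pop runs_Seq[OF runs_Pop f(5)]]])
        from runs_Cond[of "Mark 1" "{Mark 1}", OF runs_mono[OF this, of "p (size_of x) + q (size_of x) + 6"]] True show ?thesis
          by (simp add: to_tree_bool_def)
      next
        case False
        have "runs ?D (Mark 0 # code_of x) (code_of (g x)) (1 + q (size_of x) + 1)"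
          by (rule runs_Seq[OF runs_Pop g(5)])
        from runs_Cond[of "Mark 0" "{Mark 1}", OF _ runs_mono[OF this, of "p (size_of x) + q (size_of x) + 6"]] False show ?thesis
          by (simp add: to_tree_bool_def)
      qed
    qed
  qed
qed

lemma polyc_case_list:
  assumes "polyc h" and "polyc f" and "polyc (\<lambda>p. g (fst p) (fst2 p) (snd2 p))"
  shows "polyc (\<lambda>z. case h z of [] \<Rightarrow> f z | y # ys \<Rightarrow> g z y ys)"
proof -
  obtain e r where "computes e r h" using polycD[OF assms(1)] by blast
  note h = computesD[OF this]
  obtain c p where "computes c p f" using polycD[OF assms(2)] by blast
  note f = computesD[OF this]
  obtain d q where "computes d q (\<lambda>z. g (fst z) (fst2 z) (snd2 z))" using polycD[OF assms(3)] by blast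
  note g = computesD[OF this]
  \<comment> \<open>A nonempty list has the tree of the pair of its head and tail. Hence one mark in
    front of the trees of \<open>z\<close> and \<open>h z\<close> makes the triple
    \<open>(z, y, ys)\<close>.\<close>
  let ?C = "Seq swap (Seq (Push 0 (Mark 1)) d)" and ?D = "Seq (Pop 0) c"
  let ?T = "\<lambda>n. (26 * n + 25) + (r n + ((p n + (17 * (r n + n) + 37) + q (1 + n + r n) + 6) + 1) + 1) + 1"
  show ?thesis
  proof (rule polycI)
    show "ok_prog (Seq dup (Seq e (Cond 0 {Mark 1} ?C ?D)))" using h f g by simp
    show "pb ?T" using h f by (intro pb_intros pb_comp[OF g(2)])
    fix x
    have q: "q (size_of (x, y, ys)) \<le> q (1 + size_of x + r (size_of x))" if "h x = y # ys" for y ys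
      using h(4)[of x] that by (intro monoD[OF g(3)]) simp
    show "size_of (case h x of [] \<Rightarrow> f x | y # ys \<Rightarrow> g x y ys) \<le> ?T (size_of x)"
    proof (cases "h x")
      case Nil then show ?thesis using f(4)[of x] by simp
    next
      case (Cons y ys) then show ?thesis using g(4)[of "(x, y, ys)"] q[OF Cons] by simp
    qed
    show "runs (Seq dup (Seq e (Cond 0 {Mark 1} ?C ?D))) (code_of x)
      (code_of (case h x of [] \<Rightarrow> f x | y # ys \<Rightarrow> g x y ys)) (?T (size_of x))"
    proof (intro runs_Seq)
      show "runs dup (code_of x) (code_of x @ code_of x) (26 * size_of x + 25)" by (rule runs_dup)
      show "runs e (code_of x @ code_of x) (code_of (h x) @ code_of x) (r (size_of x))"
        by (rule runs_frame[OF h(5)])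
      let ?u = "p (size_of x) + (17 * (r (size_of x) + size_of x) + 37) + q (1 + size_of x + r (size_of x)) + 6"
      show "runs (Cond 0 {Mark 1} ?C ?D) (code_of (h x) @ code_of x)
        (code_of (case h x of [] \<Rightarrow> f x | y # ys \<Rightarrow> g x y ys)) (?u + 1)"
      proof (cases "h x")
        case Nil
        have "runs ?D (Mark 0 # code_of x) (code_of (f x)) (1 + p (size_of x) + 1)"
          by (rule runs_Seq[OF runs_Pop f(5)])
        from runs_Cond[of "Mark 0" "{Mark 1}", OF _ runs_mono[OF this, of ?u]] show ?thesis
          by (simp add: Nil)
      next
        case (Cons y ys)
        have "runs ?C (code_of (h x) @ code_of x) (code_of (g x y ys))
          (17 * (r (size_of x) + size_of x) + 37 + (2 + q (size_of (x, y, ys)) + 1) + 1)"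
        proof (intro runs_Seq)
          show "runs swap (code_of (h x) @ code_of x) (code_of x @ code_of (h x)) (17 * (r (size_of x) + size_of x) + 37)"
            using h(4)[of x] by (intro runs_mono[OF runs_swap]) simp
          show "runs (Push 0 (Mark 1)) (code_of x @ code_of (h x)) (code_of (x, y, ys)) 2"
            using runs_Push by (simp add: Cons)
          show "runs d (code_of (x, y, ys)) (code_of (g x y ys)) (q (size_of (x, y, ys)))"
            using g(5)[of "(x, y, ys)"] by simp
        qed
        note C = runs_mono[OF this, of ?u]
        have "runs ?C (code_of (h x) @ code_of x) (code_of (g x y ys)) ?u"
          using q[OF Cons] by (intro C) simp
        then show ?thesis
          using runs_Cond[of "Mark 1" "{Mark 1}" ?C "code_of y @ code_of ys @ code_of x" "code_of (g x y ys)" ?u ?D]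
          by (simp add: Cons)
      qed
    qed
  qed
qed

lemma polyc_Cons:
  assumes "polyc f" and "polyc g"
  shows "polyc (\<lambda>x. f x # g x)"
  by (rule polyc_same[OF polyc_pair[OF assms]]) simp

text \<open>Iterating a polynomial function may produce exponentially large values, for instance by
  repeated doubling. The bound \<open>b\<close> on all intermediate accumulators excludes this, and
  then each round takes polynomial time.\<close>

lemma polyc_foldl:
  fixes h :: "'z::enc \<Rightarrow> 'x::enc list" and f :: "'z \<Rightarrow> 'a::enc" and g :: "'z \<Rightarrow> 'x \<Rightarrow> 'a \<Rightarrow> 'a"
  assumes h: "polyc h" and f: "polyc f" and g: "polyc (\<lambda>p. g (fst p) (fst2 p) (snd2 p))"
    and b: "pb b" "\<And>z xs ys. h z = xs @ ys \<Longrightarrow> size_of (foldl (\<lambda>a x. g z x a) (f z) xs) \<le> b (size_of z)"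
  shows "polyc (\<lambda>z. foldl (\<lambda>a x. g z x a) (f z) (h z))"
proof -
  define G where "G p = (case fst p of [] \<Rightarrow> p | y # ys \<Rightarrow> (ys, fst2 p, g (fst2 p) y (snd2 p)))" for p
  have "polyc (\<lambda>q. (\<lambda>p y ys. (ys, fst2 p, g (fst2 p) y (snd2 p))) (fst q) (fst2 q) (snd2 q))"
  proof -
    have "polyc (\<lambda>q. g (fst2 (fst q)) (fst2 q) (snd2 (fst q)))"
      using polyc_comp[OF _ g, of "\<lambda>q. (fst2 (fst q), fst2 q, snd2 (fst q))"]
      by (simp add: polyc_pair polyc_fst polyc_snd polyc_id)
    then show ?thesis by (intro polyc_pair polyc_fst polyc_snd polyc_id)
  qed
  then have "polyc G" unfolding G_def
    by (intro polyc_case_list polyc_fst polyc_id)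
  then obtain c p where "computes c p G" using polycD by blast
  note c = computesD[OF this]
  have "polyc (\<lambda>z. (h z, z, f z))" by (intro polyc_pair h f polyc_id)
  then obtain d q where "computes d q (\<lambda>z. (h z, z, f z))" using polycD by blast
  note d = computesD[OF this]
  \<comment> \<open>The stack holds the triple of remaining list, parameter and accumulator without
    its first mark, so the topmost symbol tells whether the list is empty. The body restores the
    mark, applies \<open>G\<close> and removes the mark again.\<close>
  let ?L = "Loop 0 {Mark 1} (Seq (Push 0 (Mark 1)) (Seq c (Pop 0)))"
  \<comment> \<open>The time of one application of \<open>G\<close>: the triple has size at most
    \<open>2 + q n + n + b n\<close>.\<close>
  define B where "B n = p (2 + q n + n + b n)" for n
  have loop: "runs ?L (code_of ys @ code_of (z, foldl (\<lambda>a x. g z x a) (f z) xs))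
      (Mark 0 # code_of (z, foldl (\<lambda>a x. g z x a) (f z) (h z))) (length ys * (B (size_of z) + 6) + 1)"
    if "h z = xs @ ys" for z xs ys
    using that
  proof (induction ys arbitrary: xs)
    case Nil
    then show ?case using runs_LoopFalse[of "Mark 0" "{Mark 1}"] by simp
  next
    case (Cons y ys)
    let ?a = "foldl (\<lambda>a x. g z x a) (f z) xs" and ?a' = "foldl (\<lambda>a x. g z x a) (f z) (xs @ [y])"
    have m: "size_of (xs @ ys') \<ge> size_of ys'" for xs ys' :: "'x list"
      by (induction xs) auto
    have "size_of (y # ys, z, ?a) \<le> 2 + q (size_of z) + size_of z + b (size_of z)"
      using m[of "y # ys" xs] b(2)[OF Cons.prems] d(4)[of z] Cons.prems by simp
    then have B: "p (size_of (y # ys, z, ?a)) \<le> B (size_of z)"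
      unfolding B_def by (intro monoD[OF c(3)])
    have "runs (Seq (Push 0 (Mark 1)) (Seq c (Pop 0))) (code_of (y # ys) @ code_of (z, ?a))
      (code_of ys @ code_of (z, ?a')) (2 + (B (size_of z) + 1 + 1) + 1)"
    proof (intro runs_Seq)
      show "runs (Push 0 (Mark 1)) (code_of (y # ys) @ code_of (z, ?a)) (code_of (y # ys, z, ?a)) 2"
        using runs_Push by simp
      show "runs c (code_of (y # ys, z, ?a)) (code_of (ys, z, ?a')) (B (size_of z))"
        using runs_mono[OF c(5)[of "(y # ys, z, ?a)"] B] by (simp add: G_def)
      show "runs (Pop 0) (code_of (ys, z, ?a')) (code_of ys @ code_of (z, ?a')) 1"
        using runs_Pop by simp
    qed
    then have "runs (Seq (Push 0 (Mark 1)) (Seq c (Pop 0))) (Mark 1 # (code_of y @ code_of ys @ code_of (z, ?a)))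
      (code_of ys @ code_of (z, ?a')) (B (size_of z) + 5)" by (simp add: numeral_eq_Suc)
    from runs_LoopTrue[OF _ this Cons.IH[of "xs @ [y]"]] Cons.prems
    have "runs ?L (Mark 1 # (code_of y @ code_of ys @ code_of (z, ?a)))
      (Mark 0 # code_of (z, foldl (\<lambda>a x. g z x a) (f z) (h z)))
      (B (size_of z) + 5 + (length ys * (B (size_of z) + 6) + 1) + 1)" by simp
    then show ?case by (simp add: algebra_simps)
  qed
  let ?T = "\<lambda>n. q n + (1 + (q n * (B n + 6) + 1 + (1 + (1 + (8 * n + 11) + 1) + 1) + 1) + 1) + 1 + b n"
  show ?thesis
  proof (rule polycI)
    show "ok_prog (Seq d (Seq (Pop 0) (Seq ?L (Seq (Pop 0) (Seq (Pop 0) drop_tree)))))"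
      using c d by simp
    have "pb B" unfolding B_def by (intro pb_comp[OF c(2)] pb_intros d b)
    then show "pb ?T" by (intro pb_intros d b)
    fix z
    show "size_of (foldl (\<lambda>a x. g z x a) (f z) (h z)) \<le> ?T (size_of z)"
      using b(2)[of z "h z" "[]"] by simp
    have "length xs \<le> size_of xs" for xs :: "'x list" by (induction xs) auto
    from this[of "h z"] have len: "length (h z) \<le> q (size_of z)" using d(4)[of z] by simp
    have "runs (Seq d (Seq (Pop 0) (Seq ?L (Seq (Pop 0) (Seq (Pop 0) drop_tree))))) (code_of z)
      (code_of (foldl (\<lambda>a x. g z x a) (f z) (h z)))
      (q (size_of z) + (1 + (length (h z) * (B (size_of z) + 6) + 1 + (1 + (1 + (8 * size_of z + 11) + 1) + 1) + 1) + 1) + 1)"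
    proof (intro runs_Seq)
      show "runs d (code_of z) (code_of (h z, z, f z)) (q (size_of z))" by (rule d)
      show "runs (Pop 0) (code_of (h z, z, f z)) (code_of (h z) @ code_of (z, f z)) 1"
        using runs_Pop by simp
      show "runs ?L (code_of (h z) @ code_of (z, f z)) (Mark 0 # code_of (z, foldl (\<lambda>a x. g z x a) (f z) (h z)))
        (length (h z) * (B (size_of z) + 6) + 1)"
        using loop[of z "[]" "h z"] by simp
      show "runs (Pop 0) (Mark 0 # code_of (z, foldl (\<lambda>a x. g z x a) (f z) (h z)))
         (code_of (z, foldl (\<lambda>a x. g z x a) (f z) (h z))) 1" by (rule runs_Pop)
      show "runs (Pop 0) (code_of (z, foldl (\<lambda>a x. g z x a) (f z) (h z)))
        (code_of z @ code_of (foldl (\<lambda>a x. g z x a) (f z) (h z))) 1"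
        using runs_Pop by simp
      show "runs drop_tree (code_of z @ code_of (foldl (\<lambda>a x. g z x a) (f z) (h z)))
        (code_of (foldl (\<lambda>a x. g z x a) (f z) (h z))) (8 * size_of z + 11)"
        by (rule runs_Cons[OF runs_drop]) auto
    qed
    moreover have "length (h z) * (B (size_of z) + 6) \<le> q (size_of z) * (B (size_of z) + 6)"
      using len by (rule mult_right_mono) simp
    ultimately show "runs (Seq d (Seq (Pop 0) (Seq ?L (Seq (Pop 0) (Seq (Pop 0) drop_tree))))) (code_of z)
      (code_of (foldl (\<lambda>a x. g z x a) (f z) (h z))) (?T (size_of z))"
      by (elim runs_mono) linarith
  qed
qed

section \<open>Logic, lists and numbers\<close>

lemma size_append: "size_of (xs @ ys) + 1 = size_of xs + size_of (ys :: 'a::enc list)"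
  by (induction xs) auto

lemma size_nat [simp]: "size_of (n::nat) = 2 * n + 1"
  by (induction n) auto

lemma size_elem: "x \<in> set xs \<Longrightarrow> size_of x < size_of (xs :: 'a::enc list)"
  by (induction xs) auto

lemma length_size: "length xs < size_of (xs :: 'a::enc list)"
  by (induction xs) auto

lemma size_list_le:
  fixes xs :: "'a::enc list"
  assumes "\<And>x. x \<in> set xs \<Longrightarrow> size_of x \<le> b"
  shows "size_of xs \<le> 1 + length xs * (1 + b)"
  using assms
proof (induction xs)
  case (Cons x xs)
  then have "size_of xs \<le> 1 + length xs * (1 + b)" "size_of x \<le> b" by simp_all
  then show ?case by (simp add: algebra_simps)
qed simp

lemma polyc_comp2:
  assumes "polyc (\<lambda>p. g (fst p) (snd p))" and "polyc f" and "polyc f'"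
  shows "polyc (\<lambda>x. g (f x) (f' x))"
  using polyc_comp[OF polyc_pair[OF assms(2,3)] assms(1)] by simp

lemma polyc_comp3:
  assumes "polyc (\<lambda>p. g (fst p) (fst2 p) (snd2 p))" and "polyc f" and "polyc f'" and "polyc f''"
  shows "polyc (\<lambda>x. g (f x) (f' x) (f'' x))"
  using polyc_comp[OF polyc_pair[OF assms(2) polyc_pair[OF assms(3,4)]] assms(1)] by simp

lemma polyc_Not: "polyc b \<Longrightarrow> polyc (\<lambda>x. \<not> b x)"
  by (rule polyc_same[OF polyc_if[OF _ polyc_const[of False] polyc_const[of True]]]) auto

lemma polyc_conj: "polyc b \<Longrightarrow> polyc c \<Longrightarrow> polyc (\<lambda>x. b x \<and> c x)"
  by (rule polyc_same[OF polyc_if[of b c "\<lambda>_. False", OF _ _ polyc_const]]) auto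

lemma polyc_disj: "polyc b \<Longrightarrow> polyc c \<Longrightarrow> polyc (\<lambda>x. b x \<or> c x)"
  using polyc_Not[OF polyc_conj[OF polyc_Not polyc_Not]] by simp

lemma polyc_imp: "polyc b \<Longrightarrow> polyc c \<Longrightarrow> polyc (\<lambda>x. b x \<longrightarrow> c x)"
  unfolding imp_conv_disj by (intro polyc_disj polyc_Not)

lemma polyc_rev: "polyc f \<Longrightarrow> polyc (\<lambda>x. rev (f x :: 'a::enc list))"
proof -
  have s: "size_of (foldl (\<lambda>a x. x # a) ys xs) + 1 = size_of xs + size_of (ys :: 'a list)" for xs ys
    by (induction xs arbitrary: ys) auto
  have r: "foldl (\<lambda>a x. x # a) ys xs = rev xs @ (ys :: 'a list)" for xs ys
    by (induction xs arbitrary: ys) auto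
  have "polyc (\<lambda>z::'a list. foldl (\<lambda>a x. x # a) [] z)"
  proof (rule polyc_foldl)
    fix z xs ys :: "'a list" assume "z = xs @ ys"
    then have "size_of z + 1 = size_of xs + size_of ys" using size_append by simp
    moreover have "size_of (foldl (\<lambda>a x. x # a) [] xs) = size_of xs" using s[of "[]" xs] by simp
    moreover have "0 < size_of ys" by simp
    ultimately show "size_of (foldl (\<lambda>a x. x # a) [] xs) \<le> size_of z" by linarith
  qed (intro pb_intros polyc_Cons polyc_id polyc_const polyc_fst polyc_snd)+
  then have "polyc (rev :: 'a list \<Rightarrow> _)" using r[of "[]"] by simp
  then show "polyc f \<Longrightarrow> polyc (\<lambda>x. rev (f x :: 'a::enc list))"
    using polyc_comp by blast
qed

lemma polyc_foldr:
  fixes h :: "'z::enc \<Rightarrow> 'x::enc list" and f :: "'z \<Rightarrow> 'a::enc" and g :: "'z \<Rightarrow> 'x \<Rightarrow> 'a \<Rightarrow> 'a"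
  assumes h: "polyc h" and f: "polyc f" and g: "polyc (\<lambda>p. g (fst p) (fst2 p) (snd2 p))"
    and b: "pb b" "\<And>z xs ys. h z = xs @ ys \<Longrightarrow> size_of (foldr (\<lambda>x a. g z x a) ys (f z)) \<le> b (size_of z)"
  shows "polyc (\<lambda>z. foldr (\<lambda>x a. g z x a) (h z) (f z))"
proof -
  have "polyc (\<lambda>z. foldl (\<lambda>a x. g z x a) (f z) (rev (h z)))"
  proof (rule polyc_foldl[OF polyc_rev[OF h] f g b(1)])
    fix z xs ys assume "rev (h z) = xs @ ys"
    then have "h z = rev ys @ rev xs" by (metis rev_append rev_rev_ident)
    from b(2)[OF this] show "size_of (foldl (\<lambda>a x. g z x a) (f z) xs) \<le> b (size_of z)"
      by (simp add: foldr_conv_foldl)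
  qed
  then show ?thesis by (simp add: foldr_conv_foldl)
qed

lemma polyc_map:
  fixes h :: "'z::enc \<Rightarrow> 'x::enc list" and g :: "'z \<Rightarrow> 'x \<Rightarrow> 'a::enc"
  assumes h: "polyc h" and g: "polyc (\<lambda>p. g (fst p) (snd p))"
  shows "polyc (\<lambda>z. map (\<lambda>x. g z x) (h z))"
proof -
  obtain p where p: "pb p" "mono p" "\<And>z x. size_of (g z x) \<le> p (size_of (z, x))"
    using polyc_size[OF g] by (metis fst_conv snd_conv)
  obtain q where q: "pb q" "\<And>z. size_of (h z) \<le> q (size_of z)"
    using polyc_size[OF h] by blast
  let ?b = "\<lambda>n. 1 + q n * (1 + p (1 + n + q n))"
  have "polyc (\<lambda>z. foldr (\<lambda>x a. g z x # a) (h z) [])"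
  proof (rule polyc_foldr)
    have "polyc (\<lambda>p. g (fst p) (fst2 p))"
      using polyc_comp2[OF g polyc_fst[OF polyc_id] polyc_fst[OF polyc_snd[OF polyc_id]]] .
    then show "polyc (\<lambda>p. g (fst p) (fst2 p) # snd2 p)"
      by (intro polyc_Cons polyc_snd polyc_id)
    show "pb ?b" by (intro pb_intros q pb_comp[OF p(1)])
    fix z xs ys assume z: "h z = xs @ ys"
    have "size_of (g z x) \<le> p (1 + size_of z + q (size_of z))" if "x \<in> set ys" for x
    proof -
      have "size_of x < size_of (h z)" using that z by (intro size_elem) simp
      then have "size_of (z, x) \<le> 1 + size_of z + q (size_of z)" using q(2)[of z] by simp
      with p(3) show ?thesis using monoD[OF p(2)] le_trans by blast
    qed
    then have "size_of (map (g z) ys) \<le> 1 + length (map (g z) ys) * (1 + p (1 + size_of z + q (size_of z)))"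
      by (intro size_list_le) auto
    also have "\<dots> \<le> ?b (size_of z)"
    proof -
      have "length ys \<le> q (size_of z)" using q(2)[of z] length_size[of "h z"] z by simp
      then show ?thesis by (simp add: mult_right_mono del: mult_Suc_right)
    qed
    also have "map (g z) ys = foldr (\<lambda>x a. g z x # a) ys []" by (induction ys) auto
    finally show "size_of (foldr (\<lambda>x a. g z x # a) ys []) \<le> ?b (size_of z)" .
  qed (intro h polyc_const)+
  moreover have "foldr (\<lambda>x a. g z x # a) xs [] = map (\<lambda>x. g z x) xs" for z xs by (induction xs) auto
  ultimately show ?thesis by simp
qed

lemma size_filter: "size_of (filter P xs) \<le> size_of (xs :: 'a::enc list)"
  by (induction xs) auto

lemma size_append_le: "size_of ys \<le> size_of (xs @ ys :: 'a::enc list)"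
  by (induction xs) auto

lemma polyc_filter:
  fixes h :: "'z::enc \<Rightarrow> 'x::enc list" and g :: "'z \<Rightarrow> 'x \<Rightarrow> bool"
  assumes h: "polyc h" and g: "polyc (\<lambda>p. g (fst p) (snd p))"
  shows "polyc (\<lambda>z. filter (\<lambda>x. g z x) (h z))"
proof -
  obtain q where q: "pb q" "\<And>z. size_of (h z) \<le> q (size_of z)"
    using polyc_size[OF h] by blast
  have e: "foldr (\<lambda>x a. if g z x then x # a else a) xs [] = filter (\<lambda>x. g z x) xs" for z xs
    by (induction xs) auto
  have "polyc (\<lambda>z. foldr (\<lambda>x a. if g z x then x # a else a) (h z) [])"
  proof (rule polyc_foldr)
    have "polyc (\<lambda>p. g (fst p) (fst2 p))"
      using polyc_comp2[OF g polyc_fst[OF polyc_id] polyc_fst[OF polyc_snd[OF polyc_id]]] .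
    then show "polyc (\<lambda>p. if g (fst p) (fst2 p) then fst2 p # snd2 p else snd2 p)"
      by (intro polyc_if polyc_Cons polyc_fst polyc_snd polyc_id)
    fix z xs ys assume z: "h z = xs @ ys"
    have "size_of (filter (g z) ys) \<le> size_of (h z)"
      using size_filter[of "g z" ys] size_append_le[of ys xs] z by simp
    then show "size_of (foldr (\<lambda>x a. if g z x then x # a else a) ys []) \<le> q (size_of z)"
      using q(2)[of z] by (simp add: e)
  qed (intro h polyc_const q)+
  then show ?thesis by (simp add: e)
qed

lemma polyc_ball:
  fixes h :: "'z::enc \<Rightarrow> 'x::enc list" and g :: "'z \<Rightarrow> 'x \<Rightarrow> bool"
  assumes h: "polyc h" and g: "polyc (\<lambda>p. g (fst p) (snd p))"
  shows "polyc (\<lambda>z. \<forall>x\<in>set (h z). g z x)"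
proof -
  have "polyc (\<lambda>z. case filter (\<lambda>x. \<not> g z x) (h z) of [] \<Rightarrow> True | _ # _ \<Rightarrow> False)"
    by (intro polyc_case_list polyc_filter h polyc_Not g polyc_const)
  moreover have "(case filter (\<lambda>x. \<not> g z x) xs of [] \<Rightarrow> True | _ # _ \<Rightarrow> False) = (\<forall>x\<in>set xs. g z x)" for z xs
    by (induction xs) auto
  ultimately show ?thesis by simp
qed

lemma polyc_bex:
  fixes h :: "'z::enc \<Rightarrow> 'x::enc list" and g :: "'z \<Rightarrow> 'x \<Rightarrow> bool"
  assumes h: "polyc h" and g: "polyc (\<lambda>p. g (fst p) (snd p))"
  shows "polyc (\<lambda>z. \<exists>x\<in>set (h z). g z x)"
  using polyc_Not[OF polyc_ball[OF h polyc_Not[OF g]]] by simp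

text \<open>Turns a number into a list to fold over.\<close>

lemma polyc_units: "polyc f \<Longrightarrow> polyc (\<lambda>x. replicate (f x) ())"
proof (erule polyc_same)
  have "to_tree (replicate n ()) = to_tree n" for n
    by (induction n) (auto simp: to_tree_unit_def)
  then show "to_tree (replicate (f x) ()) = to_tree (f x)" for x .
qed

lemma polyc_replicate:
  assumes "polyc f" and "polyc g"
  shows "polyc (\<lambda>x. replicate (f x) (g x :: 'a::enc))"
proof -
  have "polyc (\<lambda>z. map (\<lambda>_. g z) (replicate (f z) ()))"
    by (intro polyc_map polyc_units assms polyc_comp[OF polyc_fst[OF polyc_id] assms(2)])
  then show ?thesis by (simp add: map_replicate)
qed

lemma polyc_Suc: "polyc f \<Longrightarrow> polyc (\<lambda>x. Suc (f x))"
  by (rule polyc_same[OF polyc_pair[OF polyc_const[of "()"]]]) (simp_all add: to_tree_unit_def)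

lemma polyc_length: "polyc h \<Longrightarrow> polyc (\<lambda>x. length (h x :: 'a::enc list))"
proof (rule polyc_same)
  show "polyc h \<Longrightarrow> polyc (\<lambda>x. map (\<lambda>_. ()) (h x))" by (intro polyc_map polyc_const)
  have "to_tree (length xs) = to_tree (map (\<lambda>_. ()) xs)" for xs :: "'a list"
    by (induction xs) (auto simp: to_tree_unit_def)
  then show "to_tree (length (h x)) = to_tree (map (\<lambda>_. ()) (h x))" for x .
qed

lemma polyc_tl: "polyc f \<Longrightarrow> polyc (\<lambda>x. tl (f x :: 'a::enc list))"
  unfolding tl_def by (intro polyc_case_list polyc_snd polyc_id polyc_const)

lemma size_tl: "size_of (tl xs) \<le> size_of (xs :: 'a::enc list)"
  by (cases xs) auto

lemma polyc_drop:
  assumes "polyc f" and "polyc h"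
  shows "polyc (\<lambda>x. drop (f x) (h x :: 'a::enc list))"
proof -
  have e: "foldl (\<lambda>a x. tl a) ys (xs :: unit list) = drop (length xs) (ys :: 'a list)" for xs ys
    by (induction xs arbitrary: ys) (auto simp: drop_Suc)
  have "polyc (\<lambda>z::nat \<times> 'a list. foldl (\<lambda>a x. tl a) (snd z) (replicate (fst z) ()))"
  proof (rule polyc_foldl)
    fix z :: "nat \<times> 'a list" and xs ys :: "unit list"
    have "size_of (foldl (\<lambda>a x. tl a) us xs) \<le> size_of us" for us :: "'a list"
      by (induction xs arbitrary: us) (auto intro: le_trans[OF _ size_tl])
    moreover have "size_of (snd z) \<le> size_of z" by (cases z) simp
    ultimately show "size_of (foldl (\<lambda>a x. tl a) (snd z) xs) \<le> size_of z"
      using le_trans by blast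
  qed (intro pb_intros polyc_units polyc_tl polyc_id polyc_fst polyc_snd)+
  then have "polyc (\<lambda>z::nat \<times> 'a list. drop (fst z) (snd z))" by (simp add: e)
  from polyc_comp[OF polyc_pair[OF assms] this] show ?thesis by simp
qed

lemma polyc_less:
  assumes "polyc f" and "polyc g"
  shows "polyc (\<lambda>x. f x < (g x :: nat))"
proof -
  have "polyc (\<lambda>x. case drop (f x) (replicate (g x) ()) of [] \<Rightarrow> False | _ # _ \<Rightarrow> True)"
    by (intro polyc_case_list polyc_drop polyc_units assms polyc_const)
  moreover have "(case drop m (replicate n ()) of [] \<Rightarrow> False | _ # _ \<Rightarrow> True) = (m < n)" for m n
    by (cases "n - m") auto
  ultimately show ?thesis by simp
qed

lemma polyc_eq_nat:
  assumes "polyc f" and "polyc g"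
  shows "polyc (\<lambda>x. f x = (g x :: nat))"
proof -
  have "polyc (\<lambda>x. \<not> f x < g x \<and> \<not> g x < f x)"
    by (intro polyc_conj polyc_Not polyc_less assms)
  then show ?thesis by (simp add: not_less eq_iff conj_commute)
qed

lemma polyc_member:
  assumes "polyc f" and "polyc h"
  shows "polyc (\<lambda>x. (f x :: nat) \<in> set (h x))"
proof -
  have "polyc (\<lambda>x. \<exists>y\<in>set (h x). y = f x)"
    by (intro polyc_bex polyc_eq_nat polyc_snd polyc_id assms polyc_comp[OF polyc_fst[OF polyc_id] assms(1)])
  then show ?thesis by simp
qed

lemma polyc_append:
  assumes "polyc f" and "polyc g"
  shows "polyc (\<lambda>x. f x @ (g x :: 'a::enc list))"
proof -
  have "polyc (\<lambda>z::'a list \<times> 'a list. foldr (\<lambda>x a. x # a) (fst z) (snd z))"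
  proof (rule polyc_foldr)
    fix z :: "'a list \<times> 'a list" and xs ys assume "fst z = xs @ ys"
    moreover have "foldr (\<lambda>x a. x # a) ys us = ys @ us" for us by (induction ys) auto
    ultimately show "size_of (foldr (\<lambda>x a. x # a) ys (snd z)) \<le> size_of z"
      using size_append[of ys "snd z"] size_append_le[of ys xs] by (cases z) simp
  qed (intro pb_intros polyc_Cons polyc_id polyc_fst polyc_snd)+
  moreover have "foldr (\<lambda>x a. x # a) ys us = ys @ us" for ys us :: "'a list" by (induction ys) auto
  ultimately have "polyc (\<lambda>z::'a list \<times> 'a list. fst z @ snd z)" by simp
  from polyc_comp[OF polyc_pair[OF assms] this] show ?thesis by simp
qed

lemma polyc_concat:
  assumes "polyc f"
  shows "polyc (\<lambda>x. concat (f x :: 'a::enc list list))"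
proof -
  have c: "foldr (\<lambda>x a. x @ a) xs [] = concat xs" for xs :: "'a list list" by (induction xs) auto
  have s: "size_of (concat xs) \<le> size_of xs" for xs :: "'a list list"
  proof (induction xs)
    case (Cons x xs)
    then show ?case using size_append[of x "concat xs"] by simp
  qed simp
  have "polyc (\<lambda>z::'a list list. foldr (\<lambda>x a. x @ a) z [])"
  proof (rule polyc_foldr)
    fix z xs ys :: "'a list list" assume "z = xs @ ys"
    then show "size_of (foldr (\<lambda>x a. x @ a) ys []) \<le> size_of z"
      using s[of ys] size_append_le[of ys xs] by (simp add: c)
  qed (intro pb_intros polyc_append polyc_const polyc_id polyc_fst polyc_snd)+
  then show ?thesis using polyc_comp[OF assms] by (simp add: c)
qed

text \<open>The length of the accumulator is the next number to be prepended, so no separate counter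
  is carried.\<close>

lemma polyc_upt:
  assumes "polyc f"
  shows "polyc (\<lambda>x. [0..<f x])"
proof -
  have e: "foldl (\<lambda>a x. length a # a) [] (xs :: unit list) = rev [0..<length xs]" for xs
    by (induction xs rule: rev_induct) auto
  have "polyc (\<lambda>n::nat. foldl (\<lambda>a x. length a # a) [] (replicate n ()))"
  proof (rule polyc_foldl)
    show "pb (\<lambda>n. 1 + n * (1 + (2 * n + 1)))" by (intro pb_intros)
    fix n :: nat and xs ys assume "replicate n () = xs @ ys"
    then have l: "length xs \<le> n" by (metis length_append length_replicate le_add1)
    have "size_of (rev [0..<length xs]) \<le> 1 + length (rev [0..<length xs]) * (1 + (2 * n + 1))"
      using l by (intro size_list_le) auto
    also have "\<dots> \<le> 1 + size_of n * (1 + (2 * size_of n + 1))"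
      using l by (intro add_mono mult_mono) auto
    finally show "size_of (foldl (\<lambda>a x. length a # a) [] xs) \<le> 1 + size_of n * (1 + (2 * size_of n + 1))"
      by (simp only: e)
  qed (intro polyc_Cons polyc_length polyc_units polyc_const polyc_id polyc_fst polyc_snd)+
  then have "polyc (\<lambda>n. rev [0..<n])" by (simp add: e)
  from polyc_rev[OF polyc_comp[OF assms this]] show ?thesis by simp
qed

section \<open>Comparison with constants and finite tables\<close>

instantiation tree :: enc begin
definition "to_tree (t :: tree) = t"
instance by standard (simp add: to_tree_tree_def)
end

text \<open>A tree read as a list of trees has the same code, so \<open>polyc_case_list\<close>
  gives access to its parts.\<close>

primrec subtrees :: "tree \<Rightarrow> tree list" where
  "subtrees Leaf = []"
| "subtrees (Node l r) = l # subtrees r"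

lemma to_tree_subtrees: "to_tree (subtrees t) = t"
  by (induction t) (auto simp: to_tree_tree_def)

lemma polyc_subtrees: "polyc subtrees"
  by (rule polyc_same[OF polyc_id]) (simp add: to_tree_subtrees to_tree_tree_def)

lemma polyc_eq_tree: "polyc (\<lambda>u. u = (t :: tree))"
proof (induction t)
  case Leaf
  have "polyc (\<lambda>u. case subtrees u of [] \<Rightarrow> True | _ # _ \<Rightarrow> False)"
    by (intro polyc_case_list polyc_const polyc_subtrees)
  moreover have "(case subtrees u of [] \<Rightarrow> True | _ # _ \<Rightarrow> False) = (u = Leaf)" for u
    by (cases u) auto
  ultimately show ?case by simp
next
  case (Node l r)
  have "polyc (\<lambda>p :: tree \<times> tree \<times> tree list. to_tree (snd2 p))"
    by (rule polyc_same[OF polyc_snd[OF polyc_snd[OF polyc_id]]]) (simp add: to_tree_tree_def)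
  then have "polyc (\<lambda>u. case subtrees u of [] \<Rightarrow> False | v # us \<Rightarrow> v = l \<and> to_tree us = r)"
    by (intro polyc_case_list polyc_subtrees polyc_const polyc_conj polyc_comp[OF _ Node.IH(1)]
      polyc_comp[OF _ Node.IH(2)] polyc_fst polyc_snd polyc_id)
  moreover have "(case subtrees u of [] \<Rightarrow> False | v # us \<Rightarrow> v = l \<and> to_tree us = r) = (u = Node l r)" for u
    by (cases u) (auto simp: to_tree_subtrees)
  ultimately show ?case by simp
qed

lemma polyc_eq_const:
  assumes "polyc f"
  shows "polyc (\<lambda>x. f x = (c :: 'a::enc))"
proof -
  have "polyc (\<lambda>x. to_tree (f x))"
    using assms by (rule polyc_same) (simp add: to_tree_tree_def)
  moreover have "(to_tree (f x) = to_tree c) = (f x = c)" for x by (auto dest: inj_to_tree)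
  ultimately show ?thesis using polyc_comp[OF _ polyc_eq_tree[of "to_tree c"]] by fastforce
qed

text \<open>A finite table is a chain of comparisons with constants, one for each point of
  \<open>A\<close>. Questions about the relations of the language are answered by such
  tables.\<close>

lemma polyc_finite_support:
  fixes F :: "'a::enc \<Rightarrow> 'b::enc"
  assumes "finite A" and "\<And>y. y \<notin> A \<Longrightarrow> F y = d" and f: "polyc f"
  shows "polyc (\<lambda>x. F (f x))"
  using assms(1,2)
proof (induction A arbitrary: F rule: finite_induct)
  case empty then show ?case by (simp add: polyc_const)
next
  case (insert a A)
  then have "polyc (\<lambda>x. (F(a := d)) (f x))" by (intro insert.IH) auto
  then have "polyc (\<lambda>x. if f x = a then F a else (F(a := d)) (f x))"
    by (intro polyc_if polyc_eq_const f polyc_const)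
  moreover have "(if y = a then F a else (F(a := d)) y) = F y" for y by simp
  ultimately show ?case by simp
qed

section \<open>Reading the input word\<close>

primrec emit :: "nat \<Rightarrow> symbol cell list \<Rightarrow> symbol com" where
  "emit i [] = skip"
| "emit i (x # xs) = Seq (Push i x) (emit i xs)"

lemma exec_emit: "exec (emit i xs) s (3 * length xs + 1) (s(i := rev xs @ s i))"
proof (induction xs arbitrary: s)
  case Nil then show ?case using exec_skip by simp
next
  case (Cons x xs)
  from exec.Seq[OF exec.Push Cons[of "s(i := x # s i)"]] show ?case
    unfolding emit.simps by (rule exec_time) (auto simp: fun_eq_iff)
qed

primrec read_letter :: "symbol list \<Rightarrow> symbol com" where
  "read_letter [] = skip"
| "read_letter (a # as) = Cond 0 {Letter a} (Seq (Pop 0) (emit 1 (Mark 1 # code_of a))) (read_letter as)"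

lemma exec_read_letter:
  assumes "x \<in> set as" and "s 0 = Letter x # us"
  shows "\<exists>t\<le>length as + 3 * size_of x + 7. exec (read_letter as) s t
    (s(0 := us, 1 := rev (Mark 1 # code_of x) @ s 1))"
  using assms(1)
proof (induction as)
  case (Cons a as)
  show ?case
  proof (cases "a = x")
    case True
    have "exec (read_letter (a # as)) s (1 + (3 * length (Mark 1 # code_of x) + 1) + 1 + 1)
      ((s(0 := tl (s 0)))(1 := rev (Mark 1 # code_of x) @ (s(0 := tl (s 0))) 1))"
      unfolding read_letter.simps True
      by (rule CondTrue, simp add: assms(2)) (rule exec.Seq[OF exec.Pop exec_emit])
    moreover have "(s(0 := tl (s 0)))(1 := rev (Mark 1 # code_of x) @ (s(0 := tl (s 0))) 1) =
      s(0 := us, 1 := rev (Mark 1 # code_of x) @ s 1)" using assms(2) by (auto simp: fun_eq_iff)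
    ultimately show ?thesis
      by (intro exI[of _ "1 + (3 * length (Mark 1 # code_of x) + 1) + 1 + 1"] conjI) (simp, metis)
  next
    case False
    then have "x \<in> set as" using Cons.prems by simp
    from Cons.IH[OF this] obtain t where t: "t \<le> length as + 3 * size_of x + 7"
      "exec (read_letter as) s t (s(0 := us, 1 := rev (Mark 1 # code_of x) @ s 1))" by blast
    have "exec (read_letter (a # as)) s (t + 1) (s(0 := us, 1 := rev (Mark 1 # code_of x) @ s 1))"
      unfolding read_letter.simps by (rule CondFalse[OF _ t(2)]) (use assms(2) False in auto)
    then show ?thesis using t(1) by (intro exI[of _ "t + 1"] conjI) (simp, assumption)
  qed
qed simp

abbreviation "symbols \<equiv> [QuantSym ForallQ, QuantSym ExistsQ, AtomSym, ArgSym, Tick]"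

lemma set_symbols: "x \<in> set symbols"
proof (cases x)
  case (QuantSym q) then show ?thesis by (cases q) auto
qed auto

lemma size_symbol: "size_of (x :: symbol) \<le> 7"
  using set_symbols[of x] by (auto simp: to_tree_quantifier_def)

definition read_loop :: "symbol com" where
  "read_loop = Loop 0 (range Letter) (read_letter symbols)"

text \<open>The code of the word is written reversed onto stack 1, above the separator
  \<open>Mark 2\<close> and ending with the \<open>Mark 0\<close> of the empty list.
  \<open>lower\<close> then reverses it onto stack 0.\<close>

definition read_input :: "symbol com" where
  "read_input = Seq (Push 1 (Mark 2)) (Seq read_loop (Seq (Push 1 (Mark 0)) (lower 1)))"

lemma exec_read_loop:
  assumes "s 0 = map Letter w"
  shows "\<exists>t\<le>34 * length w + 1. exec read_loop s t
    (s(0 := [], 1 := rev (concat (map (\<lambda>x. Mark 1 # code_of x) w)) @ s 1))"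
  using assms
proof (induction w arbitrary: s)
  case Nil
  then show ?case unfolding read_loop_def
    by (intro exI[of _ 1]) (auto intro!: exec_time[OF LoopFalse])
next
  case (Cons x w)
  let ?s = "s(0 := map Letter w, 1 := rev (Mark 1 # code_of x) @ s 1)"
  obtain t where t: "t \<le> length symbols + 3 * size_of x + 7" "exec (read_letter symbols) s t ?s"
    using exec_read_letter[OF set_symbols, of s x "map Letter w"] Cons.prems by auto
  \<comment> \<open>Five symbols of size at most 7 give \<open>5 + 3 * 7 + 7\<close>; the loop test
    makes it 34 per letter.\<close>
  have "t \<le> 33" using t(1) size_symbol[of x] by simp
  have "?s 0 = map Letter w" by simp
  from Cons.IH[of ?s, OF this] obtain t' where t': "t' \<le> 34 * length w + 1" "exec read_loop ?s t'
      (?s(0 := [], 1 := rev (concat (map (\<lambda>x. Mark 1 # code_of x) w)) @ ?s 1))"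
    by blast
  have "top_cell (s 0) \<in> range Letter" using Cons.prems by simp
  from LoopTrue[where s = s and i = 0, OF this t(2) t'(2)[unfolded read_loop_def]]
  have "exec read_loop s (t + t' + 1)
    (s(0 := [], 1 := rev (concat (map (\<lambda>x. Mark 1 # code_of x) (x # w))) @ s 1))"
    unfolding read_loop_def by (rule exec_time) (auto simp: fun_eq_iff)
  then show ?case using \<open>t \<le> 33\<close> t'(1) by (intro exI[of _ "t + t' + 1"] conjI) (simp, assumption)
qed

lemma code_of_list: "code_of (xs :: 'a::enc list) = concat (map (\<lambda>x. Mark 1 # code_of x) xs) @ [Mark 0]"
  by (induction xs) auto

lemma exec_read_input:
  shows "\<exists>t\<le>34 * length w + 6 * size_of w + 11. exec read_input (\<lambda>i. if i = 0 then map Letter w else []) t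
    (\<lambda>i. if i = 0 then code_of w else [])"
proof -
  let ?s0 = "\<lambda>i. if i = (0::nat) then map Letter w else []"
  let ?s1 = "?s0(1 := Mark 2 # ?s0 1)"
  let ?s2 = "?s1(0 := [], 1 := rev (concat (map (\<lambda>x. Mark 1 # code_of x) w)) @ ?s1 1)"
  let ?s3 = "?s2(1 := Mark 0 # ?s2 1)"
  let ?s4 = "?s3(0 := code_of w @ ?s3 0, 1 := [])"
  obtain t where t: "t \<le> 34 * length w + 1" "exec read_loop ?s1 t ?s2"
    using exec_read_loop[of ?s1 w] by auto
  have "exec (lower 1) ?s3 (6 * size_of w + 3) ?s4"
    by (rule exec_lower) (simp_all add: code_of_list)
  from exec.Seq[OF exec.Push exec.Seq[OF t(2) exec.Seq[OF exec.Push this]]]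
  have "exec read_input ?s0 (2 + (t + (2 + (6 * size_of w + 3) + 1) + 1) + 1) ?s4"
    unfolding read_input_def .
  moreover have "?s4 = (\<lambda>i. if i = 0 then code_of w else [])" by (auto simp: fun_eq_iff)
  ultimately show ?thesis using t(1)
    by (intro exI[of _ "2 + (t + (2 + (6 * size_of w + 3) + 1) + 1) + 1"]) auto
qed

lemma ok_read_input: "ok_prog read_input"
proof -
  have "ok_prog (emit 1 xs)" if "set xs \<subseteq> cells" for xs using that by (induction xs) auto
  moreover have "set (Mark 1 # code_of a) \<subseteq> cells" for a :: symbol
    using set_code[of "to_tree a"] by auto
  ultimately have e: "ok_prog (emit 1 (Mark 1 # code_of a))" for a :: symbol by blast
  have "ok_prog (read_letter as)" for as
    by (induction as) (use e in \<open>auto simp del: emit.simps\<close>)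
  then have "ok_prog read_loop" unfolding read_loop_def ok_com.simps by (intro conjI) simp
  then show ?thesis unfolding read_input_def ok_com.simps by (auto intro: ok_lower)
qed

theorem polytime_decidableI:
  fixes L :: "symbol list set"
  assumes "polyc (\<lambda>w. w \<in> L)"
  shows "polytime_decidable L"
proof -
  obtain c p where "computes c p (\<lambda>w. w \<in> L)" using polycD[OF assms] by blast
  note c = computesD[OF this]
  have ok: "ok_com 4 ({Blank} \<union> range Letter \<union> Mark ` {..<3}) (Seq read_input c)"
    using ok_read_input c(1) by simp
  obtain M :: "symbol tm" where M: "wf_tm M"
    "\<And>w t s'. exec (Seq read_input c) (\<lambda>i. if i = 0 then map Letter w else []) t s' \<Longrightarrow>
       fst ((tm_step M ^^ (t + 1)) (tm_init M w)) =
         (if top_cell (s' 0) = Mark 1 then accept_state M else reject_state M)"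
    by (rule exec_tm[OF ok _ refl]) auto
  \<comment> \<open>A letter contributes at most 8 to the size of the word: 7 for its own tree and 1
    for the list cell.\<close>
  let ?b = "\<lambda>n. 34 * n + 6 * (1 + 8 * n) + 13 + p (1 + 8 * n)"
  have "pb ?b" by (intro pb_intros pb_comp[OF c(2)])
  then obtain q :: "nat poly" where q: "\<And>n. ?b n \<le> poly q n" using pb_poly by blast
  have "\<exists>t\<le>poly q (length w). fst ((tm_step M ^^ t) (tm_init M w)) =
    (if w \<in> L then accept_state M else reject_state M)" for w
  proof -
    have size: "size_of w \<le> 1 + 8 * length w"
      using size_list_le[OF size_symbol, of w] by (simp add: mult.commute)
    obtain t where t: "t \<le> 34 * length w + 6 * size_of w + 11" "exec read_input (\<lambda>i. if i = 0 then map Letter w else []) t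
      (\<lambda>i. if i = 0 then code_of w else [])" using exec_read_input by blast
    let ?s = "\<lambda>i. if i = (0::nat) then code_of w else []"
    obtain t' where t': "t' \<le> p (size_of w)" "exec c ?s t' (?s(0 := code_of (w \<in> L) @ []))"
      using c(5)[of w, unfolded runs_def, rule_format, of ?s "[]"] by auto
    have "fst ((tm_step M ^^ (t + t' + 1 + 1)) (tm_init M w)) =
      (if w \<in> L then accept_state M else reject_state M)"
      using M(2)[OF exec.Seq[OF t(2) t'(2)]] by (simp add: to_tree_bool_def del: funpow.simps)
    moreover have "t + t' + 1 + 1 \<le> ?b (length w)"
      using t(1) t'(1) size monoD[OF c(3) size] by simp
    then have "t + t' + 1 + 1 \<le> poly q (length w)" using q le_trans by blast
    ultimately show ?thesis by blast
  qed
  then show ?thesis unfolding polytime_decidable_def using M(1) by blast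
qed

section \<open>The quantifier game\<close>

definition same_order :: "'i set \<Rightarrow> ('i \<Rightarrow> rat) \<Rightarrow> ('i \<Rightarrow> rat) \<Rightarrow> bool" where
  "same_order I s t \<longleftrightarrow> (\<forall>i\<in>I. \<forall>j\<in>I. s i < s j \<longleftrightarrow> t i < t j)"

lemma same_order_sym: "same_order I s t \<Longrightarrow> same_order I t s"
  by (simp add: same_order_def)

lemma same_order_subset: "same_order J s t \<Longrightarrow> I \<subseteq> J \<Longrightarrow> same_order I s t"
  by (auto simp: same_order_def)

lemma same_order_eq: "same_order I s t \<Longrightarrow> i \<in> I \<Longrightarrow> j \<in> I \<Longrightarrow> s i = s j \<longleftrightarrow> t i = t j"
  unfolding same_order_def by (metis less_irrefl linorder_less_linear)

text \<open>Density and unboundedness in one statement: if one side is empty, it yields a value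
  beyond a given finite set.\<close>

lemma ex_between:
  fixes L U :: "rat set"
  assumes "finite L" "finite U" "\<And>l u. l \<in> L \<Longrightarrow> u \<in> U \<Longrightarrow> l < u"
  shows "\<exists>b. (\<forall>l\<in>L. l < b) \<and> (\<forall>u\<in>U. b < u)"
proof (cases "L = {}")
  case True
  obtain b where "\<forall>u\<in>U. b < u"
    using assms(2) by (meson Min_le finite.emptyI lt_ex order_less_le_trans)
  then show ?thesis using True by blast
next
  case L: False
  show ?thesis
  proof (cases "U = {}")
    case True
    obtain b where "\<forall>l\<in>L. l < b"
      using assms(1) by (meson Max_ge gt_ex order_le_less_trans)
    then show ?thesis using True by blast
  next
    case False
    then have "Max L < Min U" using assms L by simp
    then obtain b where "Max L < b" "b < Min U" using dense by blast
    then show ?thesis using assms L False by auto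
  qed
qed

text \<open>The one-point step of a back-and-forth argument: either \<open>s x\<close> repeats an
  old value, or its cut is filled by \<open>ex_between\<close>.\<close>

lemma same_order_insert:
  assumes "finite I" and st: "same_order I s t" and "x \<notin> I"
  shows "\<exists>b. same_order (insert x I) s (t(x := b))"
proof (cases "\<exists>y\<in>I. s y = s x")
  case True
  then obtain y where "y \<in> I" "s y = s x" by blast
  then have "same_order (insert x I) s (t(x := t y))"
    using st assms(3) unfolding same_order_def by (auto, metis+)
  then show ?thesis by blast
next
  case False
  have "\<exists>b. (\<forall>l\<in>t ` {y \<in> I. s y < s x}. l < b) \<and> (\<forall>u\<in>t ` {y \<in> I. s x < s y}. b < u)"
    using assms(1) st by (intro ex_between) (auto simp: same_order_def dest: less_trans)
  then obtain b where b: "\<And>y. y \<in> I \<Longrightarrow> s y < s x \<Longrightarrow> t y < b" "\<And>y. y \<in> I \<Longrightarrow> s x < s y \<Longrightarrow> b < t y"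
    by auto
  have "s y < s x \<longleftrightarrow> t y < b" "s x < s y \<longleftrightarrow> b < t y" if "y \<in> I" for y
    using that False b[of y] by (metis less_asym linorder_less_linear)+
  then have "same_order (insert x I) s (t(x := b))"
    using st assms(3) unfolding same_order_def by auto
  then show ?thesis by blast
qed

lemma same_order_extend:
  assumes "finite J" and "finite I" and "same_order I s t"
  shows "\<exists>t'. (\<forall>i\<in>I. t' i = t i) \<and> same_order (I \<union> J) s t'"
  using assms(1)
proof (induction J rule: finite_induct)
  case empty then show ?case using assms by auto
next
  case (insert x J)
  then obtain t' where t': "\<forall>i\<in>I. t' i = t i" "same_order (I \<union> J) s t'" by blast
  show ?case
  proof (cases "x \<in> I")
    case True
    then have "I \<union> insert x J = I \<union> J" by blast
    then show ?thesis using t' by auto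
  next
    case False
    then obtain b where "same_order (insert x (I \<union> J)) s (t'(x := b))"
      using same_order_insert[of "I \<union> J" s t' x] t' insert assms by auto
    then have "same_order (I \<union> insert x J) s (t'(x := b))" by simp
    moreover have "\<forall>i\<in>I. (t'(x := b)) i = t i" using t'(1) False by auto
    ultimately show ?thesis by blast
  qed
qed

lemma finite_free_vars: "finite (free_vars \<phi>)"
  by (induction \<phi>) auto

text \<open>A witness of the existential quantifier is transferred by
  \<open>same_order_insert\<close>; as \<open>same_order\<close> is symmetric, one direction
  suffices there.\<close>

lemma sat_same_order: "same_order (free_vars \<phi>) s t \<Longrightarrow> sat s \<phi> \<longleftrightarrow> sat t \<phi>"
proof (induction \<phi> arbitrary: s t)
  case (Less x y) then show ?case by (simp add: same_order_def)
next
  case (Equal x y) then show ?case using same_order_eq[of _ s t x y] by simp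
next
  case (Neg \<phi>) then show ?case by simp
next
  case (Conj \<phi> \<psi>)
  then have "sat s \<phi> \<longleftrightarrow> sat t \<phi>" "sat s \<psi> \<longleftrightarrow> sat t \<psi>"
    by (auto intro!: Conj.IH elim: same_order_subset)
  then show ?case by simp
next
  case (Exists x \<phi>)
  have step: "sat t (Exists x \<phi>)" if st: "same_order (free_vars \<phi> - {x}) s t" and ex: "sat s (Exists x \<phi>)" for s t
  proof -
    obtain a where a: "sat (s(x := a)) \<phi>" using ex by auto
    have "same_order (free_vars \<phi> - {x}) (s(x := a)) t" using st by (auto simp: same_order_def)
    then obtain b where "same_order (insert x (free_vars \<phi> - {x})) (s(x := a)) (t(x := b))"
      using same_order_insert[of "free_vars \<phi> - {x}" "s(x := a)" t x] finite_free_vars by auto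
    then have "same_order (free_vars \<phi>) (s(x := a)) (t(x := b))"
      by (rule same_order_subset) auto
    then show ?thesis using Exists.IH a by auto
  qed
  show ?case using step[of s t] step[of t s] same_order_sym[of "free_vars \<phi> - {x}" s t] Exists.prems by auto
qed

text \<open>For a relation on the rationals this is closure under the automorphisms of the order:
  the relation is a union of order types of tuples. Definability enters the proof in this
  form.\<close>

definition order_invariant :: "nat \<Rightarrow> rat list set \<Rightarrow> bool" where
  "order_invariant k R \<longleftrightarrow> (\<forall>s\<in>R. length s = k) \<and>
     (\<forall>s\<in>R. \<forall>t. length t = k \<longrightarrow> same_order {..<k} ((!) s) ((!) t) \<longrightarrow> t \<in> R)"

lemma fo_definable_invariant: "fo_definable k R \<Longrightarrow> order_invariant k R"
proof -
  assume "fo_definable k R"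
  then obtain \<phi> where "free_vars \<phi> \<subseteq> {..<k}" "R = {t. length t = k \<and> sat (\<lambda>i. t ! i) \<phi>}"
    unfolding fo_definable_def by blast
  then show ?thesis unfolding order_invariant_def
    using sat_same_order[of \<phi>] same_order_subset by blast
qed

text \<open>What both operations share. For min, \<alpha> is the identity; for mx it is the \<alpha>
  of the definition. Apart from monotonicity, the behaviour of \<open>h\<close> on equal arguments
  is left open, so solutions are shifted until the arguments differ where values have to be
  controlled.\<close>

locale min_like =
  fixes \<Gamma> :: rat_structure and h :: "rat \<Rightarrow> rat \<Rightarrow> rat" and \<alpha> :: "rat \<Rightarrow> rat"
  assumes invariant: "(k, R) \<in> set \<Gamma> \<Longrightarrow> order_invariant k R"
    and pres: "preserves h \<Gamma>"
    and h_mono: "x < y \<Longrightarrow> x' < y' \<Longrightarrow> h x x' < h y y'"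
    and \<alpha>_mono: "strict_mono \<alpha>"
    and h_neq: "x \<noteq> y \<Longrightarrow> h x y = \<alpha> (min x y)"
begin

abbreviation rel :: "nat \<Rightarrow> rat list set" where "rel r \<equiv> snd (\<Gamma> ! r)"
abbreviation arity :: "nat \<Rightarrow> nat" where "arity r \<equiv> fst (\<Gamma> ! r)"

lemma rel_invariant: "r < length \<Gamma> \<Longrightarrow> order_invariant (arity r) (rel r)"
  using invariant[of "arity r" "rel r"] by simp

lemma rel_length: "r < length \<Gamma> \<Longrightarrow> u \<in> rel r \<Longrightarrow> length u = arity r"
  using rel_invariant unfolding order_invariant_def by blast

lemma rel_same_order:
  assumes "r < length \<Gamma>" and "s \<in> rel r" and "length t = arity r" and "same_order {..<arity r} ((!) s) ((!) t)"
  shows "t \<in> rel r"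
  using rel_invariant[OF assms(1)] assms(2-4) unfolding order_invariant_def by blast

lemma rel_h: "r < length \<Gamma> \<Longrightarrow> s \<in> rel r \<Longrightarrow> t \<in> rel r \<Longrightarrow> map2 h s t \<in> rel r"
proof -
  assume r: "r < length \<Gamma>" "s \<in> rel r" "t \<in> rel r"
  have "(arity r, rel r) \<in> set \<Gamma>" using r(1) by simp
  then show ?thesis using pres r unfolding preserves_def by blast
qed

lemma \<alpha>_less [simp]: "\<alpha> x < \<alpha> y \<longleftrightarrow> x < y"
  using \<alpha>_mono by (rule strict_mono_less)

definition wf_atoms :: "nat \<Rightarrow> atom list \<Rightarrow> bool" where
  "wf_atoms n as \<longleftrightarrow> (\<forall>(r, ys) \<in> set as. r < length \<Gamma> \<and> length ys = arity r \<and> set ys \<subseteq> {..<n})"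

definition holds :: "atom list \<Rightarrow> (nat \<Rightarrow> rat) \<Rightarrow> bool" where
  "holds as \<sigma> \<longleftrightarrow> (\<forall>(r, ys) \<in> set as. map \<sigma> ys \<in> rel r)"

lemma holds_same_order:
  assumes wf: "wf_atoms n as" and "holds as \<sigma>" and st: "same_order {..<n} \<sigma> \<tau>"
  shows "holds as \<tau>"
  unfolding holds_def
proof (clarify)
  fix r ys assume a: "(r, ys) \<in> set as"
  then have r: "r < length \<Gamma>" "length ys = arity r" "set ys \<subseteq> {..<n}" "map \<sigma> ys \<in> rel r"
    using assms unfolding wf_atoms_def holds_def by auto
  have "same_order {..<arity r} ((!) (map \<sigma> ys)) ((!) (map \<tau> ys))"
    unfolding same_order_def
  proof (intro ballI)
    fix i j assume "i \<in> {..<arity r}" "j \<in> {..<arity r}"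
    then have "i < length ys" "j < length ys" "ys ! i \<in> {..<n}" "ys ! j \<in> {..<n}"
      using r nth_mem by (metis lessThan_iff subsetD)+
    then show "map \<sigma> ys ! i < map \<sigma> ys ! j \<longleftrightarrow> map \<tau> ys ! i < map \<tau> ys ! j"
      using st unfolding same_order_def by simp
  qed
  then show "map \<tau> ys \<in> rel r" using r by (intro rel_same_order[OF r(1,4)]) auto
qed

lemma map2_map: "map2 f (map \<sigma> ys) (map \<tau> ys) = map (\<lambda>y. f (\<sigma> y) (\<tau> y)) ys"
  by (induction ys) auto

lemma holds_h:
  assumes "wf_atoms n as" and "holds as \<sigma>" and "holds as \<tau>"
  shows "holds as (\<lambda>i. h (\<sigma> i) (\<tau> i))"
  unfolding holds_def
proof (clarify)
  fix r ys assume "(r, ys) \<in> set as"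
  then have "map2 h (map \<sigma> ys) (map \<tau> ys) \<in> rel r"
    using assms unfolding wf_atoms_def holds_def by (intro rel_h) auto
  then show "map (\<lambda>i. h (\<sigma> i) (\<tau> i)) ys \<in> rel r" by (simp add: map2_map)
qed

text \<open>The set \<open>L\<close> is empty or consists of the variable that is played low.\<close>

definition guarded :: "nat \<Rightarrow> nat set \<Rightarrow> nat set \<Rightarrow> (nat \<Rightarrow> rat) \<Rightarrow> bool" where
  "guarded n U L \<sigma> \<longleftrightarrow> (\<forall>j<n. \<forall>i<j. (j \<in> U - L \<longrightarrow> \<sigma> i < \<sigma> j) \<and> (j \<in> L \<longrightarrow> \<sigma> j < \<sigma> i))"

definition csat :: "nat \<Rightarrow> atom list \<Rightarrow> nat set \<Rightarrow> nat set \<Rightarrow> bool" where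
  "csat n as U L \<longleftrightarrow> (\<exists>\<sigma>. holds as \<sigma> \<and> guarded n U L \<sigma>)"

section \<open>Strategies and simplified games\<close>

definition univ :: "quantifier list \<Rightarrow> nat set" where
  "univ qs = {j. j < length qs \<and> qs ! j = ForallQ}"

text \<open>The opponent always plays beyond all values so far, below them for variables in
  \<open>L\<close> and above them otherwise. The values at the end of such a play form
  \<sigma>.\<close>

lemma qtrue_strategy:
  assumes "wf_atoms n as" and "length env + length Qs = n" and "qtrue \<Gamma> as Qs env"
  shows "\<exists>\<sigma>. (\<forall>i<length env. \<sigma> i = env ! i) \<and> holds as \<sigma> \<and>
    (\<forall>j<length Qs. Qs ! j = ForallQ \<longrightarrow> (\<forall>i<length env + j.
       if length env + j \<in> L then \<sigma> (length env + j) < \<sigma> i else \<sigma> i < \<sigma> (length env + j)))"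
  using assms(2,3)
proof (induction Qs arbitrary: env)
  case Nil
  have "holds as (\<lambda>y. env ! y)"
    using Nil unfolding holds_def by auto
  then show ?case by auto
next
  case (Cons Q Qs)
  obtain a where a: "qtrue \<Gamma> as Qs (env @ [a])"
    and new: "Q = ForallQ \<Longrightarrow> \<forall>i<length env. if length env \<in> L then a < env ! i else env ! i < a"
  proof (cases Q)
    case ForallQ
    have "\<exists>a. \<forall>i<length env. if length env \<in> L then a < env ! i else env ! i < a"
    proof (cases "length env \<in> L")
      case True
      have "\<exists>b. (\<forall>l\<in>{}. l < b) \<and> (\<forall>u\<in>set env. b < u)" by (rule ex_between) auto
      then show ?thesis using True by (meson nth_mem)
    next
      case False
      have "\<exists>b. (\<forall>l\<in>set env. l < b) \<and> (\<forall>u\<in>{}. b < u)" by (rule ex_between) auto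
      then show ?thesis using False by (meson nth_mem)
    qed
    then show ?thesis using Cons.prems ForallQ that by fastforce
  next
    case ExistsQ
    then show ?thesis using Cons.prems that by auto
  qed
  obtain \<sigma> where \<sigma>: "\<forall>i<length (env @ [a]). \<sigma> i = (env @ [a]) ! i" "holds as \<sigma>"
    "\<forall>j<length Qs. Qs ! j = ForallQ \<longrightarrow> (\<forall>i<length (env @ [a]) + j.
       if length (env @ [a]) + j \<in> L then \<sigma> (length (env @ [a]) + j) < \<sigma> i else \<sigma> i < \<sigma> (length (env @ [a]) + j))"
    using Cons.IH[OF _ a] Cons.prems(1) by auto
  have e: "\<sigma> i = env ! i" if "i < length env" for i
    using \<sigma>(1) that by (auto simp: nth_append dest: spec[of _ i])
  have ea: "\<sigma> (length env) = a" using \<sigma>(1) by auto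
  have "if length env + j \<in> L then \<sigma> (length env + j) < \<sigma> i else \<sigma> i < \<sigma> (length env + j)"
    if "j < length (Q # Qs)" "(Q # Qs) ! j = ForallQ" "i < length env + j" for i j
  proof (cases j)
    case 0 then show ?thesis using new that e ea by auto
  next
    case (Suc k) then show ?thesis using \<sigma>(3) that by auto
  qed
  then show ?case using e \<sigma>(2) by blast
qed

text \<open>Before \<open>j\<close> the result should follow \<sigma>, at \<open>j\<close> it should
  be \<open>a\<close>. So \<sigma> is raised above \<open>a\<close> from \<open>\<sigma> j\<close>
  on, and \<tau> is moved so that \<open>j\<close> gets \<open>a\<close> while the earlier
  variables, which lie above \<open>j\<close> in \<tau>, exceed their values in \<sigma>. Then the
  minimum is the intended value up to \<open>j\<close>, and \<open>h\<close> yields its image under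
  \<alpha>.\<close>

lemma game_step:
  assumes wf: "wf_atoms n as" and j: "j < n" "j \<in> U"
    and \<sigma>: "holds as \<sigma>" "\<And>k i. k \<in> U \<Longrightarrow> j \<le> k \<Longrightarrow> k < n \<Longrightarrow> i < k \<Longrightarrow> \<sigma> i < \<sigma> k"
    and \<tau>: "holds as \<tau>" "guarded n U {j} \<tau>"
  shows "\<exists>\<rho>. holds as \<rho> \<and> (\<forall>i<j. \<rho> i = \<sigma> i) \<and> \<rho> j = a \<and>
    (\<forall>k\<in>U. j < k \<longrightarrow> k < n \<longrightarrow> (\<forall>i<k. \<rho> i < \<rho> k))"
proof -
  \<comment> \<open>\<open>D\<close> has to lift \<open>\<sigma> j\<close> above \<open>a\<close>,
    and it must not be negative so that the shift respects the order.\<close>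
  define D where "D = max 0 (a - \<sigma> j + 1)"
  define \<sigma>1 where "\<sigma>1 i = (if \<sigma> i < \<sigma> j then \<sigma> i else \<sigma> i + D)" for i
  have D: "D \<ge> 0" "\<sigma> j + D > a" by (auto simp: D_def max_def)
  have s1: "\<sigma>1 i < \<sigma>1 k \<longleftrightarrow> \<sigma> i < \<sigma> k" for i k
    using D(1) by (auto simp: \<sigma>1_def)
  have h1: "holds as \<sigma>1"
    by (rule holds_same_order[OF wf \<sigma>(1)]) (simp add: same_order_def s1)
  \<comment> \<open>The first bound on \<open>E\<close> keeps the shift of \<tau> monotone at
    \<open>\<tau> j\<close>; the others lift the earlier variables over \<sigma>.\<close>
  have "\<exists>E. (\<forall>l\<in>insert (a - \<tau> j) ((\<lambda>i. \<sigma> i - \<tau> i) ` {..<j}). l < E) \<and> (\<forall>u\<in>{}. E < u)"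
    by (rule ex_between) auto
  then obtain E where E: "a - \<tau> j < E" "\<And>i. i < j \<Longrightarrow> \<sigma> i - \<tau> i < E" by auto
  define \<tau>1 where "\<tau>1 i = (if \<tau> i \<le> \<tau> j then \<tau> i - \<tau> j + a else \<tau> i + E)" for i
  have t1: "\<tau>1 i < \<tau>1 k \<longleftrightarrow> \<tau> i < \<tau> k" for i k
    using E(1) by (auto simp: \<tau>1_def)
  have g1: "holds as \<tau>1"
    by (rule holds_same_order[OF wf \<tau>(1)]) (simp add: same_order_def t1)
  define \<rho> where "\<rho> i = h (\<sigma>1 i) (\<tau>1 i)" for i
  have \<rho>: "holds as \<rho>" unfolding \<rho>_def by (rule holds_h[OF wf h1 g1])
  have below: "\<rho> i = \<alpha> (\<sigma> i)" if "i < j" for i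
  proof -
    have "\<sigma> i < \<sigma> j" using \<sigma>(2)[of j i] j that by simp
    moreover have "\<tau> j < \<tau> i" using \<tau>(2) j that unfolding guarded_def by blast
    ultimately have "\<sigma>1 i = \<sigma> i" "\<sigma>1 i < \<tau>1 i" using E(2)[OF that] by (auto simp: \<sigma>1_def \<tau>1_def)
    then show ?thesis using h_neq[of "\<sigma>1 i" "\<tau>1 i"] by (simp add: \<rho>_def min_def)
  qed
  have at: "\<rho> j = \<alpha> a"
    using h_neq[of "\<sigma>1 j" "\<tau>1 j"] D(2) by (simp add: \<rho>_def \<sigma>1_def \<tau>1_def min_def)
  have above: "\<rho> i < \<rho> k" if "k \<in> U" "j < k" "k < n" "i < k" for i k
  proof -
    have "\<tau> i < \<tau> k" using \<tau>(2) that unfolding guarded_def by blast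
    then show ?thesis unfolding \<rho>_def using that \<sigma>(2)[of k i] by (intro h_mono) (simp_all add: s1 t1)
  qed
  \<comment> \<open>Up to \<open>j\<close>, the solution \<rho> gives only the images of the desired
    values under \<alpha>. As these have the right order, \<rho> can be replaced by a solution that
    takes the desired values themselves.\<close>
  let ?e = "\<lambda>i. if i = j then a else \<sigma> i"
  have "same_order {..j} \<rho> ?e"
    unfolding same_order_def using below at by (auto simp: le_less)
  from same_order_extend[OF _ _ this, of "{..<n}"]
  obtain \<rho>' where \<rho>': "\<forall>i\<in>{..j}. \<rho>' i = ?e i" "same_order ({..j} \<union> {..<n}) \<rho> \<rho>'" by auto
  have so: "same_order {..<n} \<rho> \<rho>'" using \<rho>'(2) by (rule same_order_subset) auto
  have "holds as \<rho>'" by (rule holds_same_order[OF wf \<rho> so])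
  moreover have "\<rho>' i < \<rho>' k" if "k \<in> U" "j < k" "k < n" "i < k" for i k
    using above[OF that] so that unfolding same_order_def by auto
  ultimately show ?thesis using \<rho>'(1) by (intro exI[of _ \<rho>']) auto
qed

text \<open>The invariant is a solution that extends the values played so far and has all pending
  universal variables above their predecessors. Existential moves follow it; after a universal move
  \<open>game_step\<close> renews it.\<close>

lemma game_sound:
  assumes wf: "wf_atoms n as" and low: "\<And>u. u \<in> U \<Longrightarrow> csat n as U {u}"
    and "length env + length Qs = n" and "\<And>j. j < length Qs \<Longrightarrow> length env + j \<in> U \<longleftrightarrow> Qs ! j = ForallQ"
    and "\<exists>\<sigma>. (\<forall>i<length env. \<sigma> i = env ! i) \<and> holds as \<sigma> \<and>
      (\<forall>k\<in>U. length env \<le> k \<longrightarrow> k < n \<longrightarrow> (\<forall>i<k. \<sigma> i < \<sigma> k))"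
  shows "qtrue \<Gamma> as Qs env"
  using assms(3-5)
proof (induction Qs arbitrary: env)
  case Nil
  then obtain \<sigma> where \<sigma>: "\<forall>i<n. \<sigma> i = env ! i" "holds as \<sigma>" by auto
  have "map ((!) env) ys \<in> rel r" if "(r, ys) \<in> set as" for r ys
  proof -
    have "set ys \<subseteq> {..<n}" using wf that unfolding wf_atoms_def by blast
    then have "map ((!) env) ys = map \<sigma> ys" using \<sigma>(1) by auto
    moreover have "map \<sigma> ys \<in> rel r" using \<sigma>(2) that unfolding holds_def by blast
    ultimately show ?thesis by (simp only:)
  qed
  then show ?case by auto
next
  case (Cons Q Qs)
  obtain \<sigma> where \<sigma>: "\<forall>i<length env. \<sigma> i = env ! i" "holds as \<sigma>"
    "\<forall>k\<in>U. length env \<le> k \<longrightarrow> k < n \<longrightarrow> (\<forall>i<k. \<sigma> i < \<sigma> k)" using Cons.prems(3) by blast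
  have rec: "qtrue \<Gamma> as Qs (env @ [a])"
    if "\<forall>i<length env. \<rho> i = env ! i" "\<rho> (length env) = a" "holds as \<rho>"
      "\<forall>k\<in>U. length env < k \<longrightarrow> k < n \<longrightarrow> (\<forall>i<k. \<rho> i < \<rho> k)" for a \<rho>
  proof (rule Cons.IH)
    show "length (env @ [a]) + length Qs = n" using Cons.prems(1) by simp
    show "length (env @ [a]) + j \<in> U \<longleftrightarrow> Qs ! j = ForallQ" if "j < length Qs" for j
      using Cons.prems(2)[of "Suc j"] that by simp
    show "\<exists>\<sigma>. (\<forall>i<length (env @ [a]). \<sigma> i = (env @ [a]) ! i) \<and> holds as \<sigma> \<and>
      (\<forall>k\<in>U. length (env @ [a]) \<le> k \<longrightarrow> k < n \<longrightarrow> (\<forall>i<k. \<sigma> i < \<sigma> k))"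
      using that by (intro exI[of _ \<rho>]) (auto simp: nth_append less_Suc_eq)
  qed
  show ?case
  proof (cases Q)
    case ExistsQ
    have "qtrue \<Gamma> as Qs (env @ [\<sigma> (length env)])" using \<sigma> by (intro rec[of \<sigma>]) auto
    then show ?thesis using ExistsQ by auto
  next
    case ForallQ
    have j: "length env < n" "length env \<in> U" using Cons.prems(1) Cons.prems(2)[of 0] ForallQ by auto
    obtain \<tau> where \<tau>: "holds as \<tau>" "guarded n U {length env} \<tau>"
      using low[OF j(2)] unfolding csat_def by blast
    have "qtrue \<Gamma> as Qs (env @ [a])" for a
    proof -
      obtain \<rho> where "holds as \<rho>" "\<forall>i<length env. \<rho> i = \<sigma> i" "\<rho> (length env) = a"
        "\<forall>k\<in>U. length env < k \<longrightarrow> k < n \<longrightarrow> (\<forall>i<k. \<rho> i < \<rho> k)"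
        using game_step[OF wf j \<sigma>(2) _ \<tau>, of a] \<sigma>(3) by auto
      then show ?thesis using \<sigma>(1) by (intro rec[of \<rho>]) auto
    qed
    then show ?thesis using ForallQ by simp
  qed
qed

theorem true_in_iff_csat:
  assumes "wf_atoms (length qs) as"
  shows "true_in \<Gamma> \<lparr>quants = qs, atoms = as\<rparr> \<longleftrightarrow>
    csat (length qs) as (univ qs) {} \<and> (\<forall>u\<in>univ qs. csat (length qs) as (univ qs) {u})"
proof
  assume t: "true_in \<Gamma> \<lparr>quants = qs, atoms = as\<rparr>"
  have "csat (length qs) as (univ qs) L" if "L \<subseteq> univ qs" for L
  proof -
    have "qtrue \<Gamma> as qs []" using t by (simp add: true_in_def)
    from qtrue_strategy[OF assms _ this, of L] have "\<exists>\<sigma>. holds as \<sigma> \<and>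
      (\<forall>j<length qs. qs ! j = ForallQ \<longrightarrow> (\<forall>i<j. if j \<in> L then \<sigma> j < \<sigma> i else \<sigma> i < \<sigma> j))"
      by (simp cong: if_cong)
    then obtain \<sigma> where "holds as \<sigma>"
      "\<forall>j<length qs. qs ! j = ForallQ \<longrightarrow> (\<forall>i<j. if j \<in> L then \<sigma> j < \<sigma> i else \<sigma> i < \<sigma> j)" by blast
    then show ?thesis unfolding csat_def guarded_def using that
      by (intro exI[of _ \<sigma>]) (auto simp: univ_def split: if_splits)
  qed
  then show "csat (length qs) as (univ qs) {} \<and> (\<forall>u\<in>univ qs. csat (length qs) as (univ qs) {u})"
    by simp
next
  assume c: "csat (length qs) as (univ qs) {} \<and> (\<forall>u\<in>univ qs. csat (length qs) as (univ qs) {u})"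
  then obtain \<sigma> where "holds as \<sigma>" "guarded (length qs) (univ qs) {} \<sigma>" unfolding csat_def by blast
  then have "qtrue \<Gamma> as qs []"
    using c by (intro game_sound[OF assms, of "univ qs"]) (auto simp: univ_def guarded_def intro!: exI[of _ \<sigma>])
  then show "true_in \<Gamma> \<lparr>quants = qs, atoms = as\<rparr>" by (simp add: true_in_def)
qed

end

section \<open>Peeling off sets of minimal variables\<close>

text \<open>
  The bound \<open>c\<close> need not be attained, so the empty pattern is admitted as soon as \<open>R\<close> is
  nonempty.
\<close>

definition ok_pattern :: "rat list set \<Rightarrow> bool list \<Rightarrow> bool list \<Rightarrow> bool" where
  "ok_pattern R p b \<longleftrightarrow> (\<forall>i<length p. b ! i \<longrightarrow> p ! i) \<and>
     (\<exists>u\<in>R. \<exists>c. \<forall>i<length p. p ! i \<longrightarrow> c \<le> u ! i \<and> (b ! i \<longleftrightarrow> u ! i = c))"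

text \<open>What the guards say about minimal variables of \<open>W\<close>: a universal variable
  that must lie above its predecessors can be minimal only if it is the first one in
  \<open>W\<close>, and nothing that precedes a low variable of \<open>W\<close> can be
  minimal.\<close>

definition allowed :: "nat set \<Rightarrow> nat set \<Rightarrow> nat set \<Rightarrow> nat set" where
  "allowed U L W = {j \<in> W. (j \<in> U - L \<longrightarrow> (\<forall>i\<in>W. \<not> i < j)) \<and> (\<forall>l\<in>L \<inter> W. \<not> j < l)}"

lemma ok_pattern_zero: "R \<noteq> {} \<Longrightarrow> ok_pattern R p (replicate (length p) False)"
proof -
  assume "R \<noteq> {}"
  then obtain u where u: "u \<in> R" by blast
  have "\<exists>c. (\<forall>l\<in>{}. l < c) \<and> (\<forall>x\<in>(\<lambda>i. u ! i) ` {..<length p}. c < x)" by (rule ex_between) auto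
  then obtain c where "\<And>i. i < length p \<Longrightarrow> c < u ! i" by auto
  then show ?thesis unfolding ok_pattern_def using u by (intro conjI bexI[of _ u] exI[of _ c]) (auto simp: less_imp_le order_less_imp_not_eq2)
qed

type_synonym picker = "atom list \<Rightarrow> nat list \<Rightarrow> nat list \<Rightarrow> nat list \<Rightarrow> nat list \<Rightarrow> nat list"

definition peel_off :: "(nat list \<Rightarrow> nat list) \<Rightarrow> nat list \<Rightarrow> nat list" where
  "peel_off pick W = filter (\<lambda>x. x \<notin> set (pick W)) W"

lemma foldl_const: "foldl (\<lambda>a _. f a) a xs = (f ^^ length xs) a"
  by (induction xs arbitrary: a) (auto simp: funpow_swap1)

context min_like
begin

definition compat :: "atom list \<Rightarrow> nat set \<Rightarrow> nat set \<Rightarrow> bool" where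
  "compat as W S \<longleftrightarrow>
     (\<forall>(r, ys) \<in> set as. ok_pattern (rel r) (map (\<lambda>y. y \<in> W) ys) (map (\<lambda>y. y \<in> S) ys))"

text \<open>The witness consists of the minimal variables of a solution over \<open>W\<close>. Since
  \<open>W\<close> is arbitrary, a satisfiable instance never gets stuck, whatever has been peeled
  off before.\<close>

lemma csat_min_set:
  assumes wf: "wf_atoms n as" and "csat n as U L" and W: "W \<subseteq> {..<n}" "W \<noteq> {}"
  shows "\<exists>C. C \<noteq> {} \<and> C \<subseteq> allowed U L W \<and> compat as W C"
proof -
  obtain \<sigma> where \<sigma>: "holds as \<sigma>" "guarded n U L \<sigma>" using assms(2) unfolding csat_def by blast
  define m where "m = Min (\<sigma> ` W)"
  define C where "C = {i \<in> W. \<sigma> i = m}"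
  have fin: "finite W" using W(1) finite_subset by blast
  have m: "\<And>i. i \<in> W \<Longrightarrow> m \<le> \<sigma> i" "m \<in> \<sigma> ` W"
    unfolding m_def using fin W(2) by auto
  have "C \<noteq> {}" using m(2) by (auto simp: C_def)
  moreover have "C \<subseteq> allowed U L W"
  proof
    fix j assume j: "j \<in> C"
    then have jm: "j \<in> W" "j < n" "\<sigma> j = m" using W(1) by (auto simp: C_def)
    have "\<not> i < j" if "j \<in> U - L" "i \<in> W" for i
      using \<sigma>(2) that jm m(1)[of i] unfolding guarded_def by force
    moreover have "\<not> j < l" if "l \<in> L \<inter> W" for l
      using \<sigma>(2) that jm m(1)[of l] W(1) unfolding guarded_def by force
    ultimately show "j \<in> allowed U L W" using jm by (simp add: allowed_def)
  qed
  moreover have "compat as W C"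
    unfolding compat_def
  proof (clarify)
    fix r ys assume "(r, ys) \<in> set as"
    then have "map \<sigma> ys \<in> rel r" using \<sigma>(1) unfolding holds_def by blast
    then show "ok_pattern (rel r) (map (\<lambda>y. y \<in> W) ys) (map (\<lambda>y. y \<in> C) ys)"
      unfolding ok_pattern_def using m(1)
      by (intro conjI bexI[of _ "map \<sigma> ys"] exI[of _ m]) (auto simp: C_def)
  qed
  ultimately show ?thesis by blast
qed

section \<open>Solutions from peelings\<close>

inductive solvable :: "atom list \<Rightarrow> nat set \<Rightarrow> nat set \<Rightarrow> nat set \<Rightarrow> bool" for as U L where
  empty: "solvable as U L {}"
| peel: "solvable as U L (W - S) \<Longrightarrow> S \<subseteq> allowed U L W \<Longrightarrow> compat as W S \<Longrightarrow> solvable as U L W"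

text \<open>An atom with arguments outside \<open>W\<close> cannot be evaluated yet; the order of
  its assigned arguments is required to be that of some tuple in the relation.\<close>

definition partial_solution :: "atom list \<Rightarrow> nat set \<Rightarrow> nat set \<Rightarrow> nat set \<Rightarrow> (nat \<Rightarrow> rat) \<Rightarrow> bool" where
  "partial_solution as U L W \<sigma> \<longleftrightarrow>
     (\<forall>(r, ys) \<in> set as. \<exists>u\<in>rel r. same_order {i. i < length ys \<and> ys ! i \<in> W} (\<lambda>i. \<sigma> (ys ! i)) ((!) u)) \<and>
     (\<forall>j\<in>W. \<forall>i\<in>W. i < j \<longrightarrow> (j \<in> U - L \<longrightarrow> \<sigma> i < \<sigma> j) \<and> (j \<in> L \<longrightarrow> \<sigma> j < \<sigma> i))"

text \<open>
  The tuple \<open>u\<close> is shifted so that its minimal entries lie below \<open>t\<close> and the other ones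
  above it; then \<open>h\<close> copies the former from \<open>u\<close> and the latter from \<open>t\<close>.
\<close>

lemma combine_tuples:
  assumes r: "r < length \<Gamma>" and "u \<in> rel r" and "t \<in> rel r"
  shows "\<exists>v\<in>rel r. \<exists>m. \<forall>i<arity r. \<forall>j<arity r.
    (u ! i = c \<longrightarrow> v ! i = \<alpha> m) \<and> (c < u ! i \<longrightarrow> v ! i = \<alpha> (t ! i)) \<and> m < t ! i"
proof -
  have len: "length u = arity r" "length t = arity r" using assms rel_length by auto
  have "\<exists>m. (\<forall>l\<in>{}. l < m) \<and> (\<forall>x\<in>set t. m < x)" by (rule ex_between) auto
  then obtain m where m: "\<And>x. x \<in> set t \<Longrightarrow> m < x" by auto
  have "\<exists>E. (\<forall>l\<in>insert (m - c) ((\<lambda>i. t ! i - u ! i) ` {..<arity r}). l < E) \<and> (\<forall>x\<in>{}. E < x)"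
    by (rule ex_between) auto
  then obtain E where E: "m - c < E" "\<And>i. i < arity r \<Longrightarrow> t ! i - u ! i < E" by auto
  define w where "w = map (\<lambda>x. if x \<le> c then x - c + m else x + E) u"
  have "w \<in> rel r"
    by (rule rel_same_order[OF assms(1,2)]) (use E(1) in \<open>auto simp: w_def len same_order_def\<close>)
  then have v: "map2 h w t \<in> rel r" using rel_h assms by blast
  have "map2 h w t ! i = \<alpha> m" if "i < arity r" "u ! i = c" for i
  proof -
    have "m < t ! i" using m that len by simp
    then show ?thesis using that h_neq[of m "t ! i"] by (simp add: w_def len min_def)
  qed
  moreover have "map2 h w t ! i = \<alpha> (t ! i)" if "i < arity r" "c < u ! i" for i
  proof -
    have "t ! i < u ! i + E" using E(2)[of i] that by (simp add: algebra_simps)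
    then show ?thesis using that h_neq[of "u ! i + E" "t ! i"] by (simp add: w_def len min_def)
  qed
  ultimately show ?thesis using v m len by (intro bexI[of _ "map2 h w t"] exI[of _ m]) auto
qed

text \<open>Peeled sets are put back in reverse order, each below everything that was left after it.
  In an atom, a tuple with the minima prescribed by \<open>S\<close> and a tuple for the rest are
  merged by \<open>combine_tuples\<close>.\<close>

lemma solvable_partial:
  assumes "solvable as U L W" and wf: "wf_atoms n as" and "W \<subseteq> {..<n}"
    and ne: "\<forall>(r, ys) \<in> set as. rel r \<noteq> {}"
  shows "\<exists>\<sigma>. partial_solution as U L W \<sigma>"
  using assms(1,3)
proof (induction rule: solvable.induct)
  case empty
  have "\<exists>u. u \<in> rel r" if "(r, ys) \<in> set as" for r ys using ne that by blast
  then show ?case by (auto simp: partial_solution_def same_order_def)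
next
  case (peel W S)
  then obtain \<sigma> where \<sigma>: "partial_solution as U L (W - S) \<sigma>" by blast
  have "finite W" using peel.prems finite_subset by blast
  then have "\<exists>m. (\<forall>l\<in>{}. l < m) \<and> (\<forall>x\<in>\<sigma> ` (W - S). m < x)" by (intro ex_between) auto
  then obtain m where m: "\<And>x. x \<in> W - S \<Longrightarrow> m < \<sigma> x" by auto
  define \<sigma>' where "\<sigma>' x = (if x \<in> S then m else \<sigma> x)" for x
  have SW: "S \<subseteq> W" using peel.hyps by (auto simp: allowed_def)
  have "\<exists>v\<in>rel r. same_order {i. i < length ys \<and> ys ! i \<in> W} (\<lambda>i. \<sigma>' (ys ! i)) ((!) v)"
    if a: "(r, ys) \<in> set as" for r ys
  proof -
    have r: "r < length \<Gamma>" "length ys = arity r" using wf a unfolding wf_atoms_def by auto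
    obtain t where t: "t \<in> rel r"
      "same_order {i. i < length ys \<and> ys ! i \<in> W - S} (\<lambda>i. \<sigma> (ys ! i)) ((!) t)"
      using \<sigma> a unfolding partial_solution_def by blast
    \<comment> \<open>Entries of \<open>u\<close> below \<open>c\<close> can occur only at positions
      outside \<open>W\<close>, about which nothing is claimed.\<close>
    obtain u c where u: "u \<in> rel r"
      "\<And>i. i < length ys \<Longrightarrow> ys ! i \<in> W \<Longrightarrow> c \<le> u ! i \<and> (ys ! i \<in> S \<longleftrightarrow> u ! i = c)"
      using peel.hyps(3) a unfolding compat_def ok_pattern_def by fastforce
    obtain v d where v: "v \<in> rel r" "\<And>i. i < arity r \<Longrightarrow> u ! i = c \<Longrightarrow> v ! i = \<alpha> d"
      "\<And>i. i < arity r \<Longrightarrow> c < u ! i \<Longrightarrow> v ! i = \<alpha> (t ! i)" "\<And>i. i < arity r \<Longrightarrow> d < t ! i"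
      using combine_tuples[OF r(1) u(1) t(1), of c] by blast
    have vS: "v ! i = \<alpha> d" if "i < length ys" "ys ! i \<in> W" "ys ! i \<in> S" for i
      using that u(2)[of i] v(2) r by auto
    have vW: "v ! i = \<alpha> (t ! i)" if "i < length ys" "ys ! i \<in> W" "ys ! i \<notin> S" for i
      using that u(2)[of i] v(3) r by (simp add: order_less_le)
    have "\<sigma>' (ys ! i) < \<sigma>' (ys ! j) \<longleftrightarrow> v ! i < v ! j"
      if "i < length ys" "ys ! i \<in> W" "j < length ys" "ys ! j \<in> W" for i j
    proof (cases "ys ! i \<in> S"; cases "ys ! j \<in> S")
      assume "ys ! i \<in> S" "ys ! j \<in> S"
      then show ?thesis using that vS by (simp add: \<sigma>'_def)
    next
      assume "ys ! i \<in> S" "ys ! j \<notin> S"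
      then show ?thesis using that vS[of i] vW[of j] m[of "ys ! j"] v(4)[of j] r by (simp add: \<sigma>'_def)
    next
      assume "ys ! i \<notin> S" "ys ! j \<in> S"
      then show ?thesis using that vS[of j] vW[of i] m[of "ys ! i"] v(4)[of i] r
        by (simp add: \<sigma>'_def not_less less_imp_le)
    next
      assume "ys ! i \<notin> S" "ys ! j \<notin> S"
      then show ?thesis using that vW[of i] vW[of j] t(2) by (simp add: \<sigma>'_def same_order_def)
    qed
    then show ?thesis using v(1) by (auto simp: same_order_def)
  qed
  moreover have "(j \<in> U - L \<longrightarrow> \<sigma>' i < \<sigma>' j) \<and> (j \<in> L \<longrightarrow> \<sigma>' j < \<sigma>' i)"
    if "j \<in> W" "i \<in> W" "i < j" for i j
  proof -
    have \<sigma>ij: "(j \<in> U - L \<longrightarrow> \<sigma> i < \<sigma> j) \<and> (j \<in> L \<longrightarrow> \<sigma> j < \<sigma> i)" if "i \<notin> S" "j \<notin> S"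
      using \<sigma> that \<open>j \<in> W\<close> \<open>i \<in> W\<close> \<open>i < j\<close> unfolding partial_solution_def by blast
    have "j \<notin> S" if "j \<in> U - L"
      using peel.hyps(2) that \<open>i \<in> W\<close> \<open>i < j\<close> by (auto simp: allowed_def)
    moreover have "i \<notin> S" if "j \<in> L"
      using peel.hyps(2) that \<open>j \<in> W\<close> \<open>i < j\<close> by (auto simp: allowed_def)
    ultimately show ?thesis using \<sigma>ij m[of i] m[of j] that by (auto simp: \<sigma>'_def)
  qed
  ultimately have "partial_solution as U L W \<sigma>'" unfolding partial_solution_def by blast
  then show ?case by blast
qed

lemma solvable_csat:
  assumes "solvable as U L {..<n}" and wf: "wf_atoms n as"
    and ne: "\<forall>(r, ys) \<in> set as. rel r \<noteq> {}"
  shows "csat n as U L"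
proof -
  obtain \<sigma> where \<sigma>: "partial_solution as U L {..<n} \<sigma>"
    using solvable_partial[OF assms(1) wf _ ne] by blast
  have "holds as \<sigma>" unfolding holds_def
  proof (clarify)
    fix r ys assume a: "(r, ys) \<in> set as"
    then have r: "r < length \<Gamma>" "length ys = arity r" "set ys \<subseteq> {..<n}" using wf unfolding wf_atoms_def by auto
    obtain u where u: "u \<in> rel r" "same_order {i. i < length ys \<and> ys ! i \<in> {..<n}} (\<lambda>i. \<sigma> (ys ! i)) ((!) u)"
      using \<sigma> a unfolding partial_solution_def by blast
    have "ys ! i < n" if "i < length ys" for i using r(3) that nth_mem by fastforce
    then have "same_order {..<arity r} ((!) u) ((!) (map \<sigma> ys))"
      using u(2) r(2) by (auto simp: same_order_def)
    then show "map \<sigma> ys \<in> rel r" using rel_same_order[OF r(1) u(1)] r(2) by simp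
  qed
  moreover have "guarded n U L \<sigma>" using \<sigma> unfolding partial_solution_def guarded_def by auto
  ultimately show ?thesis unfolding csat_def by blast
qed

text \<open>For a satisfiable instance each round removes a variable until none is left, so
  \<open>n\<close> rounds suffice. An empty choice on a nonempty \<open>W\<close> means that there
  is no nonempty candidate, and then \<open>csat_min_set\<close> refutes the instance.\<close>

lemma peeling_correct:
  assumes wf: "wf_atoms n as" and ne: "\<forall>(r, ys) \<in> set as. rel r \<noteq> {}"
    and pick: "\<And>W. set W \<subseteq> {..<n} \<Longrightarrow>
      set (pick W) \<subseteq> allowed U L (set W) \<and> compat as (set W) (set (pick W))"
    and pick_ne: "\<And>W C. set W \<subseteq> {..<n} \<Longrightarrow> C \<noteq> {} \<Longrightarrow> C \<subseteq> allowed U L (set W) \<Longrightarrow>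
      compat as (set W) C \<Longrightarrow> pick W \<noteq> []"
  shows "foldl (\<lambda>W _. peel_off pick W) [0..<n] [0..<n] = [] \<longleftrightarrow> csat n as U L"
proof
  have *: "(peel_off pick ^^ k) W = [] \<Longrightarrow> set W \<subseteq> {..<n} \<Longrightarrow> solvable as U L (set W)" for k W
  proof (induction k arbitrary: W)
    case 0 then show ?case by (simp add: solvable.empty)
  next
    case (Suc k)
    have s: "set (peel_off pick W) = set W - set (pick W)" by (auto simp: peel_off_def)
    have "solvable as U L (set W - set (pick W))"
      using Suc.IH[of "peel_off pick W"] Suc.prems s by (auto simp: funpow_swap1)
    then show ?case using pick[OF Suc.prems(2)] by (auto intro: solvable.peel)
  qed
  assume "foldl (\<lambda>W _. peel_off pick W) [0..<n] [0..<n] = []"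
  then have "solvable as U L (set [0..<n])" using *[of n "[0..<n]"] by (simp add: foldl_const atLeast0LessThan)
  then show "csat n as U L" using solvable_csat[OF _ wf ne] by (simp add: atLeast0LessThan)
next
  assume c: "csat n as U L"
  have "set W \<subseteq> {..<n} \<Longrightarrow> set ((peel_off pick ^^ k) W) \<subseteq> {..<n} \<and>
    length ((peel_off pick ^^ k) W) \<le> length W - k" for k W
  proof (induction k)
    case (Suc k)
    let ?W = "(peel_off pick ^^ k) W"
    have W: "set ?W \<subseteq> {..<n}" "length ?W \<le> length W - k" using Suc by auto
    show ?case
    proof (cases "?W = []")
      case True
      then have "peel_off pick ?W = []" by (simp only: peel_off_def filter.simps)
      then show ?thesis by simp
    next
      case False
      then obtain C where "C \<noteq> {}" "C \<subseteq> allowed U L (set ?W)" "compat as (set ?W) C"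
        using csat_min_set[OF wf c W(1)] by auto
      then have "pick ?W \<noteq> []" using pick_ne[OF W(1)] by blast
      then obtain x where x: "x \<in> set (pick ?W)" by (cases "pick ?W") auto
      then have "x \<in> set ?W" using pick[OF W(1)] by (auto simp: allowed_def)
      with x have "length (peel_off pick ?W) < length ?W"
        unfolding peel_off_def by (intro length_filter_less) auto
      moreover have "set (peel_off pick ?W) \<subseteq> set ?W" by (auto simp: peel_off_def)
      ultimately show ?thesis using W by auto
    qed
  qed auto
  from this[of "[0..<n]" n] show "foldl (\<lambda>W _. peel_off pick W) [0..<n] [0..<n] = []"
    by (simp add: foldl_const atLeast0LessThan)
qed

end

section \<open>Languages preserved by min\<close>

text \<open>List access with a default value, in a form to which \<open>polyc_case_list\<close>
  applies.\<close>

definition look :: "'a \<Rightarrow> 'a list \<Rightarrow> nat \<Rightarrow> 'a" where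
  "look d xs i = (case drop i xs of [] \<Rightarrow> d | x # _ \<Rightarrow> x)"

lemma look_nth: "i < length xs \<Longrightarrow> look d xs i = xs ! i"
  by (simp add: look_def Cons_nth_drop_Suc [symmetric])

text \<open>All that a test has to know about the arguments of an atom. As arities are bounded, this
  ranges over a finite set and the tests become finite tables.\<close>

definition marks :: "nat list \<Rightarrow> nat list \<Rightarrow> nat list \<Rightarrow> (bool \<times> bool) list" where
  "marks W S ys = map (\<lambda>y. (y \<in> set W, y \<in> set S)) ys"

lemma map_fst_marks: "map fst (marks W S ys) = map (\<lambda>y. y \<in> set W) ys"
  and map_snd_marks: "map snd (marks W S ys) = map (\<lambda>y. y \<in> set S) ys"
  and length_marks: "length (marks W S ys) = length ys"
  by (simp_all add: marks_def)

lemma filter_same_length: "length (filter P xs) = length xs \<Longrightarrow> filter P xs = xs"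
proof (induction xs)
  case (Cons x xs)
  then show ?case using length_filter_le[of P xs] by (cases "P x") simp_all
qed simp

context min_like
begin

text \<open>The sum bounds every single arity, and it makes sense for the empty language
  too.\<close>

definition max_arity :: nat where "max_arity = sum_list (map fst \<Gamma>)"

lemma arity_le: "r < length \<Gamma> \<Longrightarrow> arity r \<le> max_arity"
  unfolding max_arity_def by (intro member_le_sum_list) auto

lemma shift_tuple:
  assumes "r < length \<Gamma>" and "u \<in> rel r"
  shows "map (\<lambda>x. x + d) u \<in> rel r"
  by (rule rel_same_order[OF assms]) (use rel_length[OF assms] in \<open>auto simp: same_order_def\<close>)

text \<open>Translation by \<open>c - d\<close> aligns the lower bounds of the two witnessing
  tuples; then \<open>h\<close> is applied to them. For min, \<open>g\<close> is disjunction and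
  \<open>e\<close> the identity; for mx, \<open>g\<close> is exclusive or and \<open>e\<close> is
  \<alpha>.\<close>

lemma ok_pattern_map2:
  assumes r: "r < length \<Gamma>" and p: "length p = arity r" "length b = arity r" "length b' = arity r"
    and b: "ok_pattern (rel r) p b" "ok_pattern (rel r) p b'"
    and h: "\<And>x y c. c \<le> x \<Longrightarrow> c \<le> y \<Longrightarrow> e c \<le> h x y \<and> (g (x = c) (y = c) \<longleftrightarrow> h x y = e c)"
    and g: "\<not> g False False"
  shows "ok_pattern (rel r) p (map2 g b b')"
proof -
  obtain u c where u: "u \<in> rel r" "\<And>i. i < length p \<Longrightarrow> p ! i \<Longrightarrow> c \<le> u ! i \<and> (b ! i \<longleftrightarrow> u ! i = c)"
    using b(1) unfolding ok_pattern_def by blast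
  obtain v d where v: "v \<in> rel r" "\<And>i. i < length p \<Longrightarrow> p ! i \<Longrightarrow> d \<le> v ! i \<and> (b' ! i \<longleftrightarrow> v ! i = d)"
    using b(2) unfolding ok_pattern_def by blast
  let ?w = "map2 h u (map (\<lambda>x. x + (c - d)) v)"
  have w: "?w \<in> rel r" using rel_h[OF r u(1) shift_tuple[OF r v(1)]] .
  have len: "length u = arity r" "length v = arity r" using u v rel_length r by auto
  show ?thesis unfolding ok_pattern_def
  proof (intro conjI bexI[of _ ?w] exI[of _ "e c"] allI impI w)
    fix i assume "i < length p" "map2 g b b' ! i"
    then show "p ! i" using b p g unfolding ok_pattern_def by (cases "b ! i"; cases "b' ! i") auto
  next
    fix i assume i: "i < length p" "p ! i"
    have *: "c \<le> u ! i" "c \<le> v ! i + (c - d)" "b ! i \<longleftrightarrow> u ! i = c" "b' ! i \<longleftrightarrow> v ! i + (c - d) = c"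
      using u(2)[OF i] v(2)[OF i] by auto
    have e: "?w ! i = h (u ! i) (v ! i + (c - d))" "map2 g b b' ! i = g (b ! i) (b' ! i)"
      using i p len by auto
    show "e c \<le> ?w ! i" "map2 g b b' ! i = (?w ! i = e c)"
      unfolding e *(3,4) using h[OF *(1,2)] by blast+
  qed
qed

text \<open>Bad positions have to be deleted from the candidate.\<close>

definition bad :: "nat \<Rightarrow> (bool \<times> bool) list \<Rightarrow> nat \<Rightarrow> bool" where
  "bad r m i \<longleftrightarrow> r < length \<Gamma> \<and> length m = arity r \<and> i < arity r \<and>
     \<not> (\<exists>b. length b = arity r \<and> (\<forall>j<arity r. b ! j \<longrightarrow> snd (m ! j)) \<and>
          ok_pattern (rel r) (map fst m) b \<and> b ! i)"

definition shrink :: "nat list \<Rightarrow> nat list \<Rightarrow> atom \<Rightarrow> nat list" where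
  "shrink W S a = filter (\<lambda>x. \<forall>i\<in>set [0..<max_arity].
     bad (fst a) (marks W S (snd a)) i \<longrightarrow> x \<noteq> look 0 (snd a) i) S"

text \<open>The outer fold uses \<open>V\<close> as a counter: a sweep over the atoms that changes
  anything shortens the list, so as many sweeps as there are variables reach a fixed point.\<close>

definition pick_min :: picker where
  "pick_min as V U L W =
     foldl (\<lambda>S _. foldl (\<lambda>S a. shrink W S a) S as) (filter (\<lambda>j. j \<in> allowed (set U) (set L) (set W)) V) V"

lemma set_shrink_subset: "set (shrink W S a) \<subseteq> set S"
  by (auto simp: shrink_def)

lemma length_shrink: "length (shrink W S a) \<le> length S"
  by (simp add: shrink_def)

lemma shrink_same: "length (shrink W S a) = length S \<Longrightarrow> shrink W S a = S"
  unfolding shrink_def by (rule filter_same_length)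

lemma foldl_shrink_length: "length (foldl (shrink W) S as) \<le> length S"
  by (induction as arbitrary: S) (auto intro: le_trans[OF _ length_shrink])

lemma foldl_shrink_subset: "set (foldl (shrink W) S as) \<subseteq> set S"
proof (induction as arbitrary: S)
  case (Cons a as)
  then show ?case using set_shrink_subset[of W S a] by (metis foldl_Cons subset_trans)
qed simp

lemma foldl_shrink_fixed:
  "length (foldl (shrink W) S as) = length S \<Longrightarrow> a \<in> set as \<Longrightarrow> shrink W S a = S"
proof (induction as)
  case (Cons b as)
  have "length (shrink W S b) = length S"
    using Cons.prems(1) foldl_shrink_length[of W "shrink W S b" as] length_shrink[of W S b] by simp
  then have "shrink W S b = S" by (rule shrink_same)
  then show ?case using Cons by auto
qed simp

text \<open>No position of \<open>C\<close> is bad, since the pattern of \<open>C\<close> itself is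
  the witness. Hence a candidate inside \<open>S\<close> survives all deletions.\<close>

lemma shrink_keeps:
  assumes "wf_atoms n as" and "compat as (set W) C" and "(r, ys) \<in> set as" and "C \<subseteq> set S"
  shows "C \<subseteq> set (shrink W S (r, ys))"
proof
  fix x assume x: "x \<in> C"
  have r: "length ys = arity r" using assms unfolding wf_atoms_def by auto
  have ok: "ok_pattern (rel r) (map (\<lambda>y. y \<in> set W) ys) (map (\<lambda>y. y \<in> C) ys)"
    using assms unfolding compat_def by blast
  have "x \<noteq> look 0 ys i" if b: "bad r (marks W S ys) i" for i
  proof
    assume eq: "x = look 0 ys i"
    have i: "i < arity r" using b by (simp add: bad_def)
    then have "map (\<lambda>y. y \<in> C) ys ! i" using eq x r by (simp add: look_nth)
    moreover have "\<forall>j<arity r. map (\<lambda>y. y \<in> C) ys ! j \<longrightarrow> snd (marks W S ys ! j)"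
      using assms(4) r by (auto simp: marks_def)
    ultimately have "\<not> bad r (marks W S ys) i"
      using ok r unfolding bad_def map_fst_marks by (metis length_map)
    then show False using b by simp
  qed
  then show "x \<in> set (shrink W S (r, ys))" using x assms(4) by (auto simp: shrink_def)
qed

lemma foldl_shrink_keeps:
  assumes "wf_atoms n as" and "compat as (set W) C" and "set bs \<subseteq> set as" and "C \<subseteq> set S"
  shows "C \<subseteq> set (foldl (shrink W) S bs)"
  using assms(3,4)
proof (induction bs arbitrary: S)
  case (Cons b bs)
  obtain r ys where b: "b = (r, ys)" by (cases b)
  show ?case using Cons.IH[of "shrink W S b"] Cons.prems shrink_keeps[OF assms(1,2), of r ys S] b by auto
qed simp

end

section \<open>Candidates closed under union\<close>

locale min_case = min_like +
  assumes h_min: "h = min"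
begin

lemma ok_pattern_or:
  assumes "r < length \<Gamma>" and "length p = arity r" "length b = arity r" "length b' = arity r"
    and "ok_pattern (rel r) p b" "ok_pattern (rel r) p b'"
  shows "ok_pattern (rel r) p (map2 (\<or>) b b')"
  by (rule ok_pattern_map2[OF assms, where e = "\<lambda>c. c"]) (auto simp: h_min min_def)

text \<open>Each position whose variable lies in \<open>S\<close> is contained in some admissible
  pattern inside \<open>S\<close>. The disjunction of these patterns, begun with the empty one, is
  the pattern of \<open>S\<close>.\<close>

lemma shrink_fixed_ok:
  assumes wf: "wf_atoms n as" and a: "(r, ys) \<in> set as" and ne: "rel r \<noteq> {}"
    and fixed: "shrink W S (r, ys) = S"
  shows "ok_pattern (rel r) (map (\<lambda>y. y \<in> set W) ys) (map (\<lambda>y. y \<in> set S) ys)"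
proof -
  have r: "r < length \<Gamma>" "length ys = arity r" using wf a unfolding wf_atoms_def by auto
  let ?p = "map (\<lambda>y. y \<in> set W) ys"
  have ex: "\<exists>b. length b = arity r \<and> (\<forall>j<arity r. b ! j \<longrightarrow> ys ! j \<in> set S) \<and> ok_pattern (rel r) ?p b \<and> b ! i"
    if i: "i < arity r" "ys ! i \<in> set S" for i
  proof -
    have "i < max_arity" using arity_le[OF r(1)] i by simp
    have "ys ! i \<in> set (shrink W S (r, ys))" using fixed i by simp
    then have "\<not> bad r (marks W S ys) i" using \<open>i < max_arity\<close> i r by (auto simp: shrink_def look_nth)
    then obtain b where b: "length b = arity r" "\<forall>j<arity r. b ! j \<longrightarrow> snd (marks W S ys ! j)"
      "ok_pattern (rel r) ?p b" "b ! i"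
      using r i unfolding bad_def map_fst_marks by (auto simp: length_marks)
    moreover have "snd (marks W S ys ! j) = (ys ! j \<in> set S)" if "j < arity r" for j
      using that r by (simp add: marks_def)
    ultimately show ?thesis by blast
  qed
  have "\<exists>b. length b = arity r \<and> (\<forall>j<arity r. b ! j \<longrightarrow> ys ! j \<in> set S) \<and> ok_pattern (rel r) ?p b \<and>
    (\<forall>i<m. ys ! i \<in> set S \<longrightarrow> b ! i)" if "m \<le> arity r" for m
    using that
  proof (induction m)
    case 0
    have "ok_pattern (rel r) ?p (replicate (arity r) False)" using ok_pattern_zero[OF ne, of ?p] r by simp
    then show ?case by (intro exI[of _ "replicate (arity r) False"]) auto
  next
    case (Suc m)
    then obtain b where b: "length b = arity r" "\<forall>j<arity r. b ! j \<longrightarrow> ys ! j \<in> set S"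
      "ok_pattern (rel r) ?p b" "\<forall>i<m. ys ! i \<in> set S \<longrightarrow> b ! i" by auto
    show ?case
    proof (cases "ys ! m \<in> set S")
      case True
      obtain b' where b': "length b' = arity r" "\<forall>j<arity r. b' ! j \<longrightarrow> ys ! j \<in> set S"
        "ok_pattern (rel r) ?p b'" "b' ! m" using ex[of m] True Suc.prems by auto
      have "ok_pattern (rel r) ?p (map2 (\<or>) b b')"
        using r b b' by (intro ok_pattern_or) auto
      then show ?thesis using b b' Suc.prems
        by (intro exI[of _ "map2 (\<or>) b b'"]) (auto simp: less_Suc_eq)
    next
      case False
      then show ?thesis using b by (intro exI[of _ b]) (auto simp: less_Suc_eq)
    qed
  qed
  from this[of "arity r"] obtain b where b: "length b = arity r" "\<forall>j<arity r. b ! j \<longrightarrow> ys ! j \<in> set S"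
      "ok_pattern (rel r) ?p b" "\<forall>i<arity r. ys ! i \<in> set S \<longrightarrow> b ! i" by auto
  have "b = map (\<lambda>y. y \<in> set S) ys"
    using b r by (intro nth_equalityI) auto
  then show ?thesis using b(3) by simp
qed

lemma foldl_shrink_same: "length (foldl (shrink W) S as) = length S \<Longrightarrow> foldl (shrink W) S as = S"
proof (induction as)
  case (Cons a as)
  have "shrink W S a = S" using foldl_shrink_fixed[OF Cons.prems] by simp
  then show ?case using Cons by simp
qed simp

lemma pick_min_fixed: "foldl (shrink W) (pick_min as V U L W) as = pick_min as V U L W"
proof -
  let ?F = "\<lambda>S. foldl (shrink W) S as" and ?A = "filter (\<lambda>j. j \<in> allowed (set U) (set L) (set W)) V"
  have "?F ((?F ^^ k) ?A) = (?F ^^ k) ?A \<or> length ((?F ^^ k) ?A) + k \<le> length ?A" for k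
  proof (induction k)
    case (Suc k)
    let ?S = "(?F ^^ k) ?A"
    show ?case
    proof (cases "?F ?S = ?S")
      case False
      then have "length (?F ?S) < length ?S"
        using foldl_shrink_length[of W ?S as] foldl_shrink_same[of W ?S as] by linarith
      then show ?thesis using Suc False by auto
    qed simp
  qed simp
  from this[of "length V"] have "?F ((?F ^^ length V) ?A) = (?F ^^ length V) ?A"
  proof
    assume "length ((?F ^^ length V) ?A) + length V \<le> length ?A"
    moreover have "length ?A \<le> length V" by simp
    ultimately have "length ((?F ^^ length V) ?A) = 0" by linarith
    then have "(?F ^^ length V) ?A = []" by (simp only: length_0_conv)
    then show ?thesis using foldl_shrink_length[of W "[]" as] by simp
  qed
  then show ?thesis by (simp add: pick_min_def foldl_const)
qed

lemma pick_min_subset: "set (pick_min as V U L W) \<subseteq> allowed (set U) (set L) (set W)"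
proof -
  let ?A = "filter (\<lambda>j. j \<in> allowed (set U) (set L) (set W)) V"
  have "set (((\<lambda>S. foldl (shrink W) S as) ^^ k) ?A) \<subseteq> set ?A" for k
    by (induction k) (use foldl_shrink_subset in \<open>auto simp del: set_filter, blast\<close>)
  from this[of "length V"] show ?thesis by (auto simp: pick_min_def foldl_const)
qed

lemma pick_min_keeps:
  assumes wf: "wf_atoms n as" and C: "C \<subseteq> allowed (set U) (set L) (set W)" "compat as (set W) C" "C \<subseteq> set V"
  shows "C \<subseteq> set (pick_min as V U L W)"
proof -
  let ?A = "filter (\<lambda>j. j \<in> allowed (set U) (set L) (set W)) V"
  have "C \<subseteq> set (((\<lambda>S. foldl (shrink W) S as) ^^ k) ?A)" for k
  proof (induction k)
    case 0 then show ?case using C by auto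
  next
    case (Suc k)
    then show ?case using foldl_shrink_keeps[OF wf C(2) subset_refl] by simp
  qed
  then show ?thesis by (simp add: pick_min_def foldl_const)
qed

lemma pick_min_correct:
  assumes wf: "wf_atoms n as" and ne: "\<forall>(r, ys) \<in> set as. rel r \<noteq> {}"
  shows "foldl (\<lambda>W _. peel_off (pick_min as [0..<n] U L) W) [0..<n] [0..<n] = [] \<longleftrightarrow>
    csat n as (set U) (set L)"
proof (rule peeling_correct[OF wf ne])
  fix W assume "set W \<subseteq> {..<n}"
  have "ok_pattern (rel r) (map (\<lambda>y. y \<in> set W) ys) (map (\<lambda>y. y \<in> set (pick_min as [0..<n] U L W)) ys)"
    if a: "(r, ys) \<in> set as" for r ys
    using foldl_shrink_fixed[OF _ a, of W "pick_min as [0..<n] U L W"] ne a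
    by (intro shrink_fixed_ok[OF wf a]) (auto simp: pick_min_fixed)
  then show "set (pick_min as [0..<n] U L W) \<subseteq> allowed (set U) (set L) (set W) \<and>
     compat as (set W) (set (pick_min as [0..<n] U L W))"
    using pick_min_subset by (auto simp: compat_def)
next
  fix W C assume W: "set W \<subseteq> {..<n}" "C \<noteq> {}" "C \<subseteq> allowed (set U) (set L) (set W)" "compat as (set W) C"
  then have "C \<subseteq> set [0..<n]" by (auto simp: allowed_def)
  then show "pick_min as [0..<n] U L W \<noteq> []" using pick_min_keeps[OF wf W(3,4)] W(2) by fastforce
qed

end

locale mx_case = min_like +
  fixes \<beta> :: "rat \<Rightarrow> rat"
  assumes h_eq: "h x x = \<beta> x" and \<beta>_mono: "strict_mono \<beta>"
    and \<alpha>_\<beta>: "\<alpha> x < \<beta> x" and \<beta>_\<alpha>: "x < y \<Longrightarrow> \<beta> x < \<alpha> y"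
begin

text \<open>If both arguments are \<open>c\<close>, the value is \<open>\<beta> c\<close> and lies
  strictly above \<open>\<alpha> c\<close>; if exactly one is, the value is
  \<open>\<alpha> c\<close>. So ties cancel, and minima combine by exclusive or.\<close>

lemma h_minimal:
  assumes "c \<le> x" "c \<le> y"
  shows "\<alpha> c \<le> h x y \<and> (((x = c) \<noteq> (y = c)) \<longleftrightarrow> h x y = \<alpha> c)"
proof (cases "x = y")
  case True
  have "\<alpha> c < \<beta> x"
    using assms \<alpha>_\<beta>[of c] strict_mono_less_eq[OF \<beta>_mono, of c x] by linarith
  then show ?thesis using True h_eq[of x] by auto
next
  case False
  then have "h x y = \<alpha> (min x y)" by (rule h_neq)
  moreover have "\<alpha> c \<le> \<alpha> (min x y)" using assms by (simp add: strict_mono_less_eq[OF \<alpha>_mono])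
  moreover have "\<alpha> (min x y) = \<alpha> c \<longleftrightarrow> min x y = c" by (simp add: strict_mono_eq[OF \<alpha>_mono])
  ultimately show ?thesis using assms False by (auto simp: min_def)
qed

lemma ok_pattern_xor:
  assumes "r < length \<Gamma>" and "length p = arity r" "length b = arity r" "length b' = arity r"
    and "ok_pattern (rel r) p b" "ok_pattern (rel r) p b'"
  shows "ok_pattern (rel r) p (map2 (\<noteq>) b b')"
  by (rule ok_pattern_map2[OF assms, where e = \<alpha>]) (use h_minimal in blast)+

end

section \<open>Languages preserved by mx\<close>

definition xor_list :: "bool list \<Rightarrow> bool list \<Rightarrow> bool list" where
  "xor_list = map2 (\<noteq>)"

lemma xor_list_simps [simp]:
  "xor_list [] b = []" "xor_list a [] = []"
  "xor_list (x # a) (y # b) = (x \<noteq> y) # xor_list a b"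
  by (simp_all add: xor_list_def)

lemma length_xor_list [simp]: "length (xor_list a b) = min (length a) (length b)"
  by (simp add: xor_list_def)

lemma xor_list_comm: "xor_list a b = xor_list b a"
proof (induction a arbitrary: b)
  case (Cons x a) then show ?case by (cases b) auto
qed simp

lemma xor_list_assoc: "xor_list (xor_list a b) c = xor_list a (xor_list b c)"
proof (induction a arbitrary: b c)
  case (Cons x a) then show ?case by (cases b; cases c) auto
qed simp

lemma xor_list_cancel: "length a = length b \<Longrightarrow> xor_list a (xor_list a b) = b"
  by (induction a b rule: list_induct2) auto

text \<open>Over the field with two elements, nonmembership in \<open>M\<close> is a linear
  functional on the vectors of length \<open>k\<close>. The whole space is included.\<close>

definition hyperplane :: "nat \<Rightarrow> bool list set \<Rightarrow> bool" where
  "hyperplane k M \<longleftrightarrow> (\<forall>a b. length a = k \<longrightarrow> length b = k \<longrightarrow>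
     (xor_list a b \<in> M \<longleftrightarrow> (a \<in> M \<longleftrightarrow> b \<in> M)))"

text \<open>A maximal subspace avoiding \<open>x\<close> has index two.\<close>

lemma separating_hyperplane:
  assumes S: "S \<subseteq> {b. length b = k}" "S \<noteq> {}" "\<And>a b. a \<in> S \<Longrightarrow> b \<in> S \<Longrightarrow> xor_list a b \<in> S"
    and x: "length x = k" "x \<notin> S"
  shows "\<exists>M. M \<subseteq> {b. length b = k} \<and> hyperplane k M \<and> S \<subseteq> M \<and> x \<notin> M"
proof -
  define F where "F = {M. S \<subseteq> M \<and> M \<subseteq> {b. length b = k} \<and> (\<forall>a\<in>M. \<forall>b\<in>M. xor_list a b \<in> M) \<and> x \<notin> M}"
  have fin: "finite {b :: bool list. length b = k}"
    using finite_lists_length_eq[of "UNIV :: bool set" k] by simp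
  have "finite F" unfolding F_def by (rule finite_subset[of _ "Pow {b. length b = k}"]) (use fin in auto)
  moreover have "S \<in> F" using S x by (auto simp: F_def)
  ultimately obtain M where M: "M \<in> F" "\<And>M'. M' \<in> F \<Longrightarrow> M \<subseteq> M' \<Longrightarrow> M' = M"
    using finite_has_maximal[of F] by (metis empty_iff)
  have Mk: "length a = k" if "a \<in> M" for a using M(1) that by (auto simp: F_def)
  have cl: "xor_list a b \<in> M" if "a \<in> M" "b \<in> M" for a b using M(1) that by (auto simp: F_def)
  \<comment> \<open>By maximality, \<open>M\<close> together with its coset \<open>y + M\<close>
    must contain \<open>x\<close>. As \<open>x\<close> is not in \<open>M\<close>, it is in the
    coset, so \<open>x + y\<close> is in \<open>M\<close>.\<close>
  have out: "xor_list x y \<in> M" if y: "length y = k" "y \<notin> M" for y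
  proof -
    let ?M = "M \<union> xor_list y ` M"
    obtain z where z: "z \<in> M" using M(1) S(2) by (auto simp: F_def)
    have zero: "xor_list z z \<in> M" using z z by (rule cl)
    have "xor_list y (xor_list z z) = y"
      using y(1) Mk[OF z] by (metis xor_list_assoc xor_list_cancel xor_list_comm)
    then have "y \<in> ?M" using zero by (metis UnI2 image_eqI)
    then have "?M \<noteq> M" using y by auto
    then have "?M \<notin> F" using M(2) by blast
    moreover have "xor_list a b \<in> ?M" if "a \<in> ?M" "b \<in> ?M" for a b
    proof -
      have 1: "xor_list (xor_list y c) d \<in> ?M" if "c \<in> M" "d \<in> M" for c d
        using cl[OF that] by (simp add: xor_list_assoc)
      have 2: "xor_list (xor_list y c) (xor_list y d) \<in> ?M" if "c \<in> M" "d \<in> M" for c d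
      proof -
        have "xor_list (xor_list y c) (xor_list y d) = xor_list y (xor_list y (xor_list c d))"
          by (metis xor_list_assoc xor_list_comm)
        also have "\<dots> = xor_list c d" using y(1) Mk[OF that(1)] Mk[OF that(2)] by (intro xor_list_cancel) simp
        finally show ?thesis using cl[OF that] by simp
      qed
      have 3: "xor_list c (xor_list y d) \<in> ?M" if "c \<in> M" "d \<in> M" for c d
        using 1[OF that(2,1)] by (simp add: xor_list_comm)
      show ?thesis using that cl 1 2 3 by blast
    qed
    ultimately have "x \<in> ?M" using M(1) y(1) by (auto simp: F_def)
    then obtain m where m: "m \<in> M" "x = xor_list y m" using M(1) by (auto simp: F_def)
    then have "xor_list x y = m" using y(1) Mk by (metis xor_list_cancel xor_list_comm)
    then show ?thesis using m by simp
  qed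
  have "xor_list a b \<in> M \<longleftrightarrow> (a \<in> M \<longleftrightarrow> b \<in> M)" if ab: "length a = k" "length b = k" for a b
  proof -
    have one: "xor_list a b \<notin> M" if "a \<in> M" "b \<notin> M" "length a = k" "length b = k" for a b
      using cl[OF that(1), of "xor_list a b"] that by (auto simp: xor_list_cancel)
    \<comment> \<open>Both \<open>x + a\<close> and \<open>x + b\<close> are in \<open>M\<close>,
      and \<open>x\<close> cancels in their sum.\<close>
    have both: "xor_list a b \<in> M" if "a \<notin> M" "b \<notin> M"
    proof -
      have "xor_list (xor_list x a) (xor_list x b) = xor_list x (xor_list x (xor_list a b))"
        by (metis xor_list_assoc xor_list_comm)
      also have "\<dots> = xor_list a b" using x ab by (intro xor_list_cancel) simp
      finally show ?thesis using cl[OF out[OF ab(1) that(1)] out[OF ab(2) that(2)]] by simp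
    qed
    show ?thesis using cl one[of a b] one[of b a] both ab by (metis xor_list_comm)
  qed
  then show ?thesis using M(1) unfolding hyperplane_def F_def by blast
qed

section \<open>Gaussian elimination on sets of variables\<close>

inductive_set sym_span :: "nat set set \<Rightarrow> nat set set" for B where
  empty: "{} \<in> sym_span B"
| add: "v \<in> B \<Longrightarrow> x \<in> sym_span B \<Longrightarrow> sym_diff v x \<in> sym_span B"

text \<open>On subsets of \<open>N\<close>, with symmetric difference as addition, \<open>q\<close>
  holds exactly on the kernel of a linear functional; \<open>True\<close> stands for zero.\<close>

definition additive_on :: "nat set \<Rightarrow> (nat set \<Rightarrow> bool) \<Rightarrow> bool" where
  "additive_on N q \<longleftrightarrow> (\<forall>X Y. X \<subseteq> N \<longrightarrow> Y \<subseteq> N \<longrightarrow> (q (sym_diff X Y) \<longleftrightarrow> (q X \<longleftrightarrow> q Y)))"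

lemma span_subset: "X \<in> sym_span B \<Longrightarrow> (\<And>v. v \<in> B \<Longrightarrow> v \<subseteq> N) \<Longrightarrow> X \<subseteq> N"
  by (induction rule: sym_span.induct) auto

text \<open>Reduces the search for a nonempty element of a span to the generators.\<close>

lemma span_nonempty: "X \<in> sym_span B \<Longrightarrow> X \<noteq> {} \<Longrightarrow> \<exists>v\<in>B. v \<noteq> {}"
proof (induction rule: sym_span.induct)
  case (add v x) then show ?case by (cases "v = {}") auto
qed simp

lemma span_singletons: "finite X \<Longrightarrow> X \<subseteq> A \<Longrightarrow> X \<in> sym_span ((\<lambda>j. {j}) ` A)"
proof (induction X rule: finite_induct)
  case (insert x X)
  then have "sym_diff {x} X \<in> sym_span ((\<lambda>j. {j}) ` A)" by (intro sym_span.add) auto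
  moreover have "sym_diff {x} X = insert x X" using insert by auto
  ultimately show ?case by simp
qed (rule sym_span.empty)

text \<open>The pivot \<open>p\<close> is added to all generators outside the kernel, itself
  included, which thereby becomes empty. Elements \<open>X\<close> outside the kernel are covered
  too, corrected by the pivot, to make the induction work.\<close>

lemma span_eliminate:
  assumes add: "additive_on N q" and B: "\<And>v. v \<in> B \<Longrightarrow> v \<subseteq> N" and p: "p \<in> B" "\<not> q p"
    and "X \<in> sym_span B"
  shows "(if q X then X else sym_diff X p) \<in> sym_span ((\<lambda>v. if q v then v else sym_diff v p) ` B)"
    (is "_ \<in> sym_span ?B")
  using assms(5)
proof (induction rule: sym_span.induct)
  case empty
  have "q {}" using add unfolding additive_on_def by (metis Diff_cancel Un_absorb empty_subsetI)
  then show ?case by (simp add: sym_span.empty)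
next
  case (add v x)
  let ?v = "if q v then v else sym_diff v p" and ?x = "if q x then x else sym_diff x p"
  have "?v \<in> ?B" using add.hyps by blast
  then have s: "sym_diff ?v ?x \<in> sym_span ?B" using add.IH by (rule sym_span.add)
  have "x \<subseteq> N" using span_subset[OF add.hyps(2) B] .
  then have q: "q (sym_diff v x) \<longleftrightarrow> (q v \<longleftrightarrow> q x)"
    using assms(1) B[OF add.hyps(1)] unfolding additive_on_def by blast
  have "sym_diff ?v ?x = (if q (sym_diff v x) then sym_diff v x else sym_diff (sym_diff v x) p)"
    unfolding q by auto
  then show ?case using s by simp
qed

definition xor_on :: "nat list \<Rightarrow> nat list \<Rightarrow> nat list \<Rightarrow> nat list" where
  "xor_on V v p = filter (\<lambda>x. (x \<in> set v) \<noteq> (x \<in> set p)) V"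

text \<open>The pivot is not removed but becomes the empty list, so the number of vectors stays the
  same; empty vectors are skipped by the final choice.\<close>

definition eliminate :: "nat list \<Rightarrow> (nat list \<Rightarrow> bool) \<Rightarrow> nat list list \<Rightarrow> nat list list" where
  "eliminate V t B = (case filter (\<lambda>v. \<not> t v) B of [] \<Rightarrow> B
     | p # _ \<Rightarrow> map (\<lambda>v. if t v then v else xor_on V v p) B)"

text \<open>Generators of the common kernel of the functionals in \<open>T\<close> among the subsets
  of \<open>A\<close>; they may be linearly dependent.\<close>

definition kernel_basis :: "nat set \<Rightarrow> (nat set \<Rightarrow> bool) set \<Rightarrow> nat list list \<Rightarrow> bool" where
  "kernel_basis A T B \<longleftrightarrow> (\<forall>q\<in>T. additive_on A q) \<and>
     (\<forall>v\<in>set B. set v \<subseteq> A \<and> (\<forall>q\<in>T. q (set v))) \<and>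
     (\<forall>X. X \<subseteq> A \<longrightarrow> (\<forall>q\<in>T. q X) \<longrightarrow> X \<in> sym_span (set ` set B))"

lemma kernel_basis_eliminate:
  assumes B: "kernel_basis A T B" and "A \<subseteq> set V" and q: "additive_on A q"
  shows "kernel_basis A (insert q T) (eliminate V (\<lambda>v. q (set v)) B)"
proof (cases "filter (\<lambda>v. \<not> q (set v)) B")
  case Nil
  then have "\<forall>v\<in>set B. q (set v)" by (simp add: filter_empty_conv)
  moreover have "eliminate V (\<lambda>v. q (set v)) B = B" by (simp add: eliminate_def Nil)
  ultimately show ?thesis using B q unfolding kernel_basis_def by auto
next
  case (Cons p ps)
  then have "p \<in> set (filter (\<lambda>v. \<not> q (set v)) B)" by simp
  then have p: "p \<in> set B" "\<not> q (set p)" by auto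
  have sub: "set v \<subseteq> A" if "v \<in> set B" for v using B that unfolding kernel_basis_def by blast
  have x: "set (xor_on V v p) = sym_diff (set v) (set p)" if "v \<in> set B" for v
    using sub[OF that] sub[OF p(1)] assms(2) by (auto simp: xor_on_def)
  have e: "eliminate V (\<lambda>v. q (set v)) B = map (\<lambda>v. if q (set v) then v else xor_on V v p) B"
    by (simp add: eliminate_def Cons)
  have img: "set ` set (eliminate V (\<lambda>v. q (set v)) B) =
    (\<lambda>X. if q X then X else sym_diff X (set p)) ` set ` set B"
    unfolding e set_map image_image using x by (intro image_cong) auto
  have good: "v \<subseteq> A \<and> (\<forall>q'\<in>insert q T. q' v)" if v: "v \<in> set ` set (eliminate V (\<lambda>v. q (set v)) B)" for v
  proof -
    obtain w where w: "w \<in> set B" "v = (if q (set w) then set w else sym_diff (set w) (set p))"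
      using v unfolding img by auto
    have T: "\<forall>q'\<in>T. q' (set w) \<and> q' (set p) \<and> additive_on A q'"
      using B w(1) p(1) unfolding kernel_basis_def by blast
    have s: "set w \<subseteq> A" "set p \<subseteq> A" using sub w p by auto
    show ?thesis
    proof (cases "q (set w)")
      case True then show ?thesis using w T s by auto
    next
      case False
      have "q (sym_diff (set w) (set p))" using q s p(2) False unfolding additive_on_def by blast
      moreover have "\<forall>q'\<in>T. q' (sym_diff (set w) (set p))" using T s unfolding additive_on_def by blast
      ultimately show ?thesis using w(2) False s by auto
    qed
  qed
  have "X \<in> sym_span (set ` set (eliminate V (\<lambda>v. q (set v)) B))"
    if X: "X \<subseteq> A" "\<forall>q'\<in>insert q T. q' X" for X
  proof -
    have "X \<in> sym_span (set ` set B)" using B X unfolding kernel_basis_def by blast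
    from span_eliminate[OF q _ _ p(2) this] sub p(1) X(2) show ?thesis unfolding img by auto
  qed
  with good show ?thesis using B q unfolding kernel_basis_def by blast
qed

lemma kernel_basis_foldl:
  assumes "kernel_basis A T B" and "A \<subseteq> set V" and "\<And>M. M \<in> set Ms \<Longrightarrow> additive_on A (q M)"
  shows "kernel_basis A (T \<union> q ` set Ms) (foldl (\<lambda>B M. eliminate V (\<lambda>v. q M (set v)) B) B Ms)"
  using assms(1,3)
proof (induction Ms arbitrary: T B)
  case (Cons M Ms)
  have "kernel_basis A (insert (q M) T) (eliminate V (\<lambda>v. q M (set v)) B)"
    by (rule kernel_basis_eliminate[OF Cons.prems(1) assms(2)]) (simp add: Cons.prems(2))
  from Cons.IH[OF this] Cons.prems(2) show ?case by simp
qed simp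

section \<open>Linear tests for candidates\<close>

context min_like
begin

text \<open>All sets of patterns of bounded length, each written as a list. This is a constant of
  the language; \<open>test\<close> singles out the hyperplanes.\<close>

definition hyper_lists :: "bool list list list" where
  "hyper_lists = (SOME xs. set xs = {M. set M \<subseteq> {b. length b \<le> max_arity} \<and> distinct M})"

lemma finite_patterns: "finite {b :: bool list. length b \<le> k}"
  using finite_lists_length_le[of "UNIV :: bool set" k] by simp

lemma set_hyper_lists: "set hyper_lists = {M. set M \<subseteq> {b. length b \<le> max_arity} \<and> distinct M}"
  unfolding hyper_lists_def
  by (rule someI_ex, rule finite_list, rule finite_subset_distinct, rule finite_patterns)

text \<open>One linear equation for the pattern \<open>map snd m\<close>. If \<open>M\<close> is not
  a hyperplane containing all admissible patterns, the test is constantly true, so running through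
  all \<open>M\<close> is harmless.\<close>

definition test :: "nat \<Rightarrow> (bool \<times> bool) list \<Rightarrow> bool list list \<Rightarrow> bool" where
  "test r m M \<longleftrightarrow> (r < length \<Gamma> \<and> length m = arity r \<and> M \<in> set hyper_lists \<and>
     hyperplane (arity r) (set M) \<and> {b. length b = arity r \<and> ok_pattern (rel r) (map fst m) b} \<subseteq> set M \<longrightarrow>
     map snd m \<in> set M)"

definition kernel :: "atom list \<Rightarrow> nat list \<Rightarrow> nat list \<Rightarrow> nat list list \<Rightarrow> nat list list" where
  "kernel as V W B = foldl (\<lambda>B a. foldl (\<lambda>B M.
     eliminate V (\<lambda>v. test (fst a) (marks W v (snd a)) M) B) B hyper_lists) B as"

definition pick_mx :: picker where
  "pick_mx as V U L W =
     (case filter (\<lambda>v. v \<noteq> [])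
         (kernel as V W (map (\<lambda>j. [j]) (filter (\<lambda>j. j \<in> allowed (set U) (set L) (set W)) V)))
      of [] \<Rightarrow> [] | v # _ \<Rightarrow> v)"

definition atom_test :: "nat set \<Rightarrow> atom \<Rightarrow> bool list list \<Rightarrow> nat set \<Rightarrow> bool" where
  "atom_test W a M X = test (fst a) (map (\<lambda>y. (y \<in> W, y \<in> X)) (snd a)) M"

text \<open>The premises of \<open>test\<close> do not depend on \<open>X\<close>: the test is
  either constantly true or asks for membership of the pattern of \<open>X\<close> in a hyperplane.
  Symmetric differences become sums of patterns, also if an atom repeats a variable.\<close>

lemma atom_test_additive:
  "additive_on A (atom_test W a M)"
proof -
  obtain r ys where a: "a = (r, ys)" by (cases a)
  have x: "map (\<lambda>y. y \<in> sym_diff X Y) ys = xor_list (map (\<lambda>y. y \<in> X) ys) (map (\<lambda>y. y \<in> Y) ys)" for X Y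
    by (induction ys) auto
  have f: "map fst (map (\<lambda>y. (y \<in> W, y \<in> X)) ys) = map (\<lambda>y. y \<in> W) ys"
    "map snd (map (\<lambda>y. (y \<in> W, y \<in> X)) ys) = map (\<lambda>y. y \<in> X) ys" for X by simp_all
  show ?thesis unfolding additive_on_def atom_test_def test_def a fst_conv snd_conv f x length_map
    by (auto simp: hyperplane_def)
qed

lemma kernel_basis_kernel:
  assumes "kernel_basis A T B" and "A \<subseteq> set V"
  shows "kernel_basis A (T \<union> {atom_test (set W) a M | a M. a \<in> set as \<and> M \<in> set hyper_lists})
    (kernel as V W B)"
  using assms(1)
proof (induction as arbitrary: T B)
  case Nil then show ?case by (simp add: kernel_def)
next
  case (Cons a as)
  have e: "test (fst a) (marks W v (snd a)) M = atom_test (set W) a M (set v)" for v M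
    by (simp add: atom_test_def marks_def)
  have "kernel_basis A (T \<union> atom_test (set W) a ` set hyper_lists)
    (foldl (\<lambda>B M. eliminate V (\<lambda>v. test (fst a) (marks W v (snd a)) M) B) B hyper_lists)"
    unfolding e by (rule kernel_basis_foldl[OF Cons.prems assms(2) atom_test_additive])
  from Cons.IH[OF this]
  have "kernel_basis A (T \<union> atom_test (set W) a ` set hyper_lists \<union>
    {atom_test (set W) a M | a M. a \<in> set as \<and> M \<in> set hyper_lists}) (kernel (a # as) V W B)"
    by (simp add: kernel_def)
  moreover have "T \<union> atom_test (set W) a ` set hyper_lists \<union>
    {atom_test (set W) a M | a M. a \<in> set as \<and> M \<in> set hyper_lists} =
    T \<union> {atom_test (set W) b M | b M. b \<in> set (a # as) \<and> M \<in> set hyper_lists}"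
    by (simp only: list.set) blast
  ultimately show ?case by simp
qed

end

context mx_case
begin

text \<open>By \<open>ok_pattern_zero\<close> and \<open>ok_pattern_xor\<close> the admissible
  patterns form a subspace. A forbidden pattern is separated from it by a hyperplane, and the test
  for this hyperplane fails.\<close>

lemma compat_iff_tests:
  assumes wf: "wf_atoms n as" and ne: "\<forall>(r, ys) \<in> set as. rel r \<noteq> {}" and "X \<subseteq> W"
  shows "compat as W X \<longleftrightarrow> (\<forall>a\<in>set as. \<forall>M\<in>set hyper_lists. atom_test W a M X)"
proof
  assume c: "compat as W X"
  have "atom_test W (r, ys) M X" if "(r, ys) \<in> set as" for r ys M
    using c that unfolding compat_def atom_test_def test_def by (auto simp: comp_def)
  then show "\<forall>a\<in>set as. \<forall>M\<in>set hyper_lists. atom_test W a M X" by auto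
next
  assume t: "\<forall>a\<in>set as. \<forall>M\<in>set hyper_lists. atom_test W a M X"
  show "compat as W X" unfolding compat_def
  proof (clarify, rule ccontr)
    fix r ys assume a: "(r, ys) \<in> set as"
    let ?p = "map (\<lambda>y. y \<in> W) ys" and ?b = "map (\<lambda>y. y \<in> X) ys"
    assume no: "\<not> ok_pattern (rel r) ?p ?b"
    have r: "r < length \<Gamma>" "length ys = arity r" "rel r \<noteq> {}" using wf ne a unfolding wf_atoms_def by auto
    let ?S = "{b. length b = arity r \<and> ok_pattern (rel r) ?p b}"
    have zero: "replicate (arity r) False \<in> ?S" using ok_pattern_zero[OF r(3), of ?p] r(2) by simp
    have "\<exists>M. M \<subseteq> {b. length b = arity r} \<and> hyperplane (arity r) M \<and> ?S \<subseteq> M \<and> ?b \<notin> M"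
    proof (intro separating_hyperplane)
      show "xor_list a b \<in> ?S" if "a \<in> ?S" "b \<in> ?S" for a b
        using ok_pattern_xor[OF r(1), of ?p a b] that r(2) by (simp add: xor_list_def)
    qed (use no r zero in auto)
    then obtain M where M: "M \<subseteq> {b. length b = arity r}" "hyperplane (arity r) M" "?S \<subseteq> M" "?b \<notin> M" by blast
    have "finite M" by (rule finite_subset[OF _ finite_patterns[of "arity r"]]) (use M(1) in auto)
    then obtain Ml where Ml: "set Ml = M" "distinct Ml" using finite_distinct_list by blast
    then have "Ml \<in> set hyper_lists" using M(1) arity_le[OF r(1)] by (auto simp: set_hyper_lists)
    then have "atom_test W (r, ys) Ml X" using t a by blast
    then show False using M Ml r \<open>Ml \<in> set hyper_lists\<close>
      by (simp add: atom_test_def test_def comp_def)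
  qed
qed

text \<open>The singletons span all subsets of the allowed set, and elimination with all tests
  leaves generators of the space of candidates. If there is a nonempty candidate, some generator is
  nonempty, and it is itself a candidate.\<close>

lemma pick_mx_correct:
  assumes wf: "wf_atoms n as" and ne: "\<forall>(r, ys) \<in> set as. rel r \<noteq> {}"
  shows "foldl (\<lambda>W _. peel_off (pick_mx as [0..<n] U L) W) [0..<n] [0..<n] = [] \<longleftrightarrow>
    csat n as (set U) (set L)"
proof -
  define A where "A W = allowed (set U) (set L) (set W)" for W
  define K where "K W = kernel as [0..<n] W (map (\<lambda>j. [j]) (filter (\<lambda>j. j \<in> A W) [0..<n]))" for W
  have pick: "pick_mx as [0..<n] U L W = (case filter (\<lambda>v. v \<noteq> []) (K W) of [] \<Rightarrow> [] | v # _ \<Rightarrow> v)" for W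
    by (simp add: pick_mx_def K_def A_def)
  have AW: "A W \<subseteq> set W" for W by (auto simp: A_def allowed_def)
  have basis: "kernel_basis (A W) {atom_test (set W) a M | a M. a \<in> set as \<and> M \<in> set hyper_lists} (K W)"
    if W: "set W \<subseteq> {..<n}" for W
  proof -
    have An: "A W \<subseteq> set [0..<n]" using W AW[of W] by auto
    have "set ` set (map (\<lambda>j. [j]) (filter (\<lambda>j. j \<in> A W) [0..<n])) = (\<lambda>j. {j}) ` A W"
      using An by (auto simp: image_iff)
    moreover have "X \<in> sym_span ((\<lambda>j. {j}) ` A W)" if "X \<subseteq> A W" for X
      using that An by (intro span_singletons) (auto intro: finite_subset)
    ultimately have "kernel_basis (A W) {} (map (\<lambda>j. [j]) (filter (\<lambda>j. j \<in> A W) [0..<n]))"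
      unfolding kernel_basis_def by auto
    from kernel_basis_kernel[OF this An] show ?thesis by (simp add: K_def)
  qed
  show ?thesis
  proof (rule peeling_correct[OF wf ne])
    fix W assume W: "set W \<subseteq> {..<n}"
    have good: "set v \<subseteq> A W \<and> compat as (set W) (set v)" if "v \<in> set (K W)" for v
    proof -
      have "set v \<subseteq> A W" "\<forall>a\<in>set as. \<forall>M\<in>set hyper_lists. atom_test (set W) a M (set v)"
        using basis[OF W] that unfolding kernel_basis_def by blast+
      then show ?thesis using compat_iff_tests[OF wf ne, of "set v" "set W"] AW by blast
    qed
    have zero: "compat as (set W) {}"
      unfolding compat_def
    proof (clarify)
      fix r ys assume "(r, ys) \<in> set as"
      then have "ok_pattern (rel r) (map (\<lambda>y. y \<in> set W) ys) (replicate (length ys) False)"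
        using ok_pattern_zero[of "rel r" "map (\<lambda>y. y \<in> set W) ys"] ne by auto
      then show "ok_pattern (rel r) (map (\<lambda>y. y \<in> set W) ys) (map (\<lambda>y. y \<in> {}) ys)"
        by (simp add: map_replicate_const)
    qed
    show "set (pick_mx as [0..<n] U L W) \<subseteq> allowed (set U) (set L) (set W) \<and>
      compat as (set W) (set (pick_mx as [0..<n] U L W))"
    proof (cases "filter (\<lambda>v. v \<noteq> []) (K W)")
      case Nil then show ?thesis using zero by (simp add: pick)
    next
      case (Cons v vs)
      then have "v \<in> set (filter (\<lambda>v. v \<noteq> []) (K W))" by simp
      then have "v \<in> set (K W)" by auto
      then show ?thesis using good[of v] by (simp add: pick Cons A_def)
    qed
  next
    fix W C assume W: "set W \<subseteq> {..<n}" "C \<noteq> {}" "C \<subseteq> allowed (set U) (set L) (set W)" "compat as (set W) C"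
    then have CA: "C \<subseteq> A W" by (simp add: A_def)
    then have "\<forall>a\<in>set as. \<forall>M\<in>set hyper_lists. atom_test (set W) a M C"
      using compat_iff_tests[OF wf ne, of C "set W"] W(4) AW by blast
    then have "C \<in> sym_span (set ` set (K W))" using basis[OF W(1)] CA unfolding kernel_basis_def by blast
    from span_nonempty[OF this W(2)] obtain v where "v \<in> set (K W)" "v \<noteq> []" by auto
    then have "filter (\<lambda>v. v \<noteq> []) (K W) \<noteq> []" by (auto simp: filter_empty_conv)
    then obtain u us where "filter (\<lambda>v. v \<noteq> []) (K W) = u # us" by (cases "filter (\<lambda>v. v \<noteq> []) (K W)") auto
    moreover from this have "u \<in> set (filter (\<lambda>v. v \<noteq> []) (K W))" by simp
    then have "u \<noteq> []" by auto
    ultimately show "pick_mx as [0..<n] U L W \<noteq> []" by (simp add: pick)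
  qed
qed

end

section \<open>Polynomial-time bounds for the algorithm\<close>

lemmas polyc_proj = polyc_fst polyc_snd polyc_id

lemma polyc_comp4:
  assumes "polyc (\<lambda>p. g (fst p) (fst2 p) (fst3 p) (snd3 p))"
    and "polyc f1" and "polyc f2" and "polyc f3" and "polyc f4"
  shows "polyc (\<lambda>x. g (f1 x) (f2 x) (f3 x) (f4 x))"
  using polyc_comp[OF polyc_pair[OF assms(2) polyc_pair[OF assms(3) polyc_pair[OF assms(4,5)]]] assms(1)] by simp

lemma polyc_comp5:
  assumes "polyc (\<lambda>p. g (fst p) (fst2 p) (fst3 p) (fst4 p) (snd4 p))"
    and "polyc f1" and "polyc f2" and "polyc f3" and "polyc f4" and "polyc f5"
  shows "polyc (\<lambda>x. g (f1 x) (f2 x) (f3 x) (f4 x) (f5 x))"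
  using polyc_comp[OF polyc_pair[OF assms(2) polyc_pair[OF assms(3) polyc_pair[OF assms(4) polyc_pair[OF assms(5,6)]]]] assms(1)] by simp

lemma size_fst: "size_of (fst z) < size_of (z :: 'a::enc \<times> 'b::enc)"
  and size_snd: "size_of (snd z) < size_of (z :: 'a::enc \<times> 'b::enc)"
  by (cases z; simp)+

lemma polyc_finite_UNIV:
  fixes F :: "'a::{enc,finite} \<Rightarrow> 'b::enc"
  shows "polyc f \<Longrightarrow> polyc (\<lambda>x. F (f x))"
  by (rule polyc_finite_support[of UNIV F undefined]) auto

lemma polyc_look:
  assumes "polyc f" and "polyc g"
  shows "polyc (\<lambda>z. look d (f z) (g z) :: 'a::enc)"
proof -
  have "polyc (\<lambda>p::'a list \<times> nat. look d (fst p) (snd p))"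
    unfolding look_def by (intro polyc_case_list polyc_drop polyc_const polyc_proj)
  then show ?thesis by (rule polyc_comp2[OF _ assms])
qed

lemma polyc_marks_tuple: "polyc (\<lambda>p. marks (fst p) (fst2 p) (snd2 p))"
  unfolding marks_def by (intro polyc_map polyc_pair polyc_member polyc_proj)

lemmas polyc_marks = polyc_comp3 [where g = marks, OF polyc_marks_tuple]

lemma allowed_iff: "j \<in> allowed (set U) (set L) (set W) \<longleftrightarrow> j \<in> set W \<and>
    (j \<in> set U \<and> j \<notin> set L \<longrightarrow> (\<forall>i\<in>set W. \<not> i < j)) \<and> (\<forall>l\<in>set L. l \<in> set W \<longrightarrow> \<not> j < l)"
  by (auto simp: allowed_def)

lemma polyc_allowed_tuple: "polyc (\<lambda>p. fst p \<in> allowed (set (fst2 p)) (set (fst3 p)) (set (snd3 p)))"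
  unfolding allowed_iff
  by (intro polyc_conj polyc_imp polyc_ball polyc_Not polyc_member polyc_less polyc_proj)

lemmas polyc_allowed = polyc_comp4 [where g = "\<lambda>j U L W. j \<in> allowed (set U) (set L) (set W)", OF polyc_allowed_tuple]

lemma polyc_xor_on:
  assumes "polyc f1" and "polyc f2" and "polyc f3"
  shows "polyc (\<lambda>z. xor_on (f1 z) (f2 z) (f3 z))"
proof -
  have ne: "(a \<noteq> b) = (if a then \<not> b else b)" for a b :: bool by simp
  have "polyc (\<lambda>p. xor_on (fst p) (fst2 p) (snd2 p))"
    unfolding xor_on_def ne by (intro polyc_filter polyc_if polyc_Not polyc_member polyc_proj)
  then show ?thesis by (rule polyc_comp3[OF _ assms])
qed

lemma size_xor_on: "size_of (xor_on V v p) \<le> size_of V"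
  unfolding xor_on_def by (rule size_filter)

text \<open>Peeling only filters the list, so the initial list bounds all intermediate ones.\<close>

lemma polyc_peel:
  fixes pick :: picker
  assumes pick: "polyc (\<lambda>t. pick (fst t) (fst2 t) (fst3 t) (fst4 t) (snd4 t))"
    and f: "polyc f1" "polyc f2" "polyc f3" "polyc f4"
  shows "polyc (\<lambda>z. foldl (\<lambda>W _. peel_off (pick (f1 z) (f2 z) (f3 z) (f4 z)) W) (f2 z) (f2 z) = [])"
proof -
  have "polyc (\<lambda>z. foldl (\<lambda>W _. peel_off (pick (fst z) (fst2 z) (fst3 z) (snd3 z)) W)
      (fst2 z) (fst2 z))"
  proof (rule polyc_foldl)
    show "polyc (\<lambda>p. peel_off (pick (fst (fst p)) (fst2 (fst p)) (fst3 (fst p)) (snd3 (fst p))) (snd2 p))"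
      unfolding peel_off_def
      by (intro polyc_filter polyc_Not polyc_member polyc_comp5[OF pick] polyc_proj)
    fix z :: "atom list \<times> nat list \<times> nat list \<times> nat list" and xs ys :: "nat list"
    have "size_of (foldl (\<lambda>W _. peel_off q W) W xs) \<le> size_of W" for W :: "nat list" and q
    proof (induction xs arbitrary: W)
      case (Cons x xs)
      from Cons[of "peel_off q W"] show ?case
        using size_filter[of "\<lambda>x. x \<notin> set (q W)" W] by (simp add: peel_off_def)
    qed simp
    then show "size_of (foldl (\<lambda>W _. peel_off (pick (fst z) (fst2 z) (fst3 z) (snd3 z)) W)
      (fst2 z) xs) \<le> size_of z"
      using size_fst[of "snd z"] size_snd[of z] by (meson le_trans less_imp_le)
  qed (intro pb_intros polyc_proj)+
  then have "polyc (\<lambda>z. foldl (\<lambda>W _. peel_off (pick (fst z) (fst2 z) (fst3 z) (snd3 z)) W)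
      (fst2 z) (fst2 z) = [])" by (rule polyc_eq_const)
  then show ?thesis
    by (rule polyc_comp4[where g = "\<lambda>a b c d. foldl (\<lambda>W _. peel_off (pick a b c d) W) b b = []", OF _ f])
qed

text \<open>New vectors are sublists of \<open>V\<close>, so the sizes stay bounded however many
  eliminations are made.\<close>

lemma eliminate_bound:
  assumes "size_of V \<le> s" and "\<forall>v\<in>set B. size_of v \<le> s"
  shows "length (eliminate V t B) = length B \<and> (\<forall>v\<in>set (eliminate V t B). size_of v \<le> s)"
proof -
  have "size_of (xor_on V v p) \<le> s" for v p using size_xor_on assms(1) le_trans by blast
  then show ?thesis using assms(2) by (auto simp: eliminate_def split: list.split)
qed

lemma eliminate_foldl_bound:
  assumes "size_of V \<le> s" and "\<forall>v\<in>set B. size_of v \<le> s"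
  shows "length (foldl (\<lambda>B M. eliminate V (\<lambda>v. t v M) B) B Ms) = length B \<and>
    (\<forall>v\<in>set (foldl (\<lambda>B M. eliminate V (\<lambda>v. t v M) B) B Ms). size_of v \<le> s)"
  using assms(2)
proof (induction Ms arbitrary: B)
  case (Cons M Ms)
  have e: "length (eliminate V (\<lambda>v. t v M) B) = length B \<and> (\<forall>v\<in>set (eliminate V (\<lambda>v. t v M) B). size_of v \<le> s)"
    by (rule eliminate_bound[OF assms(1) Cons.prems])
  show ?case unfolding foldl_Cons using e Cons.IH[OF conjunct2[OF e]] by simp
qed simp

lemma basis_size:
  assumes "length B' = length B" and "\<forall>v\<in>set B'. size_of v \<le> s" and "size_of B \<le> s"
  shows "size_of (B' :: nat list list) \<le> 1 + s * (1 + s)"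
proof -
  have "size_of B' \<le> 1 + length B' * (1 + s)" using assms(2) by (intro size_list_le) auto
  also have "\<dots> \<le> 1 + s * (1 + s)" using assms(1,3) length_size[of B] by (intro add_mono mult_right_mono) auto
  finally show ?thesis .
qed

context min_like
begin

text \<open>The existence of suitable tuples in a relation is not computed but tabulated: outside a
  finite set of arguments \<open>bad\<close> is false.\<close>

lemma polyc_bad:
  assumes "polyc f1" and "polyc f2" and "polyc f3"
  shows "polyc (\<lambda>z. bad (f1 z) (f2 z) (f3 z))"
proof -
  let ?A = "{..<length \<Gamma>} \<times> {m :: (bool \<times> bool) list. length m \<le> max_arity} \<times> {..<max_arity}"
  have "polyc (\<lambda>t. bad (fst t) (fst2 t) (snd2 t))"
  proof (rule polyc_finite_support[OF _ _ polyc_id, of ?A _ False])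
    show "finite ?A" using finite_lists_length_le[of "UNIV :: (bool \<times> bool) set"] by simp
    show "bad (fst t) (fst2 t) (snd2 t) = False" if "t \<notin> ?A" for t
      using that arity_le[of "fst t"] by (cases t) (auto simp: bad_def)
  qed
  then show ?thesis by (rule polyc_comp3[OF _ assms])
qed

lemma polyc_test:
  assumes "polyc f1" and "polyc f2" and "polyc f3"
  shows "polyc (\<lambda>z. test (f1 z) (f2 z) (f3 z))"
proof -
  let ?A = "{..<length \<Gamma>} \<times> {m :: (bool \<times> bool) list. length m \<le> max_arity} \<times> set hyper_lists"
  have "polyc (\<lambda>t. test (fst t) (fst2 t) (snd2 t))"
  proof (rule polyc_finite_support[OF _ _ polyc_id, of ?A _ True])
    show "finite ?A" using finite_lists_length_le[of "UNIV :: (bool \<times> bool) set"] by simp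
    show "test (fst t) (fst2 t) (snd2 t) = True" if "t \<notin> ?A" for t
      using that arity_le[of "fst t"] by (cases t) (auto simp: test_def)
  qed
  then show ?thesis by (rule polyc_comp3[OF _ assms])
qed

lemma polyc_shrink_tuple: "polyc (\<lambda>p. shrink (fst p) (fst2 p) (snd2 p))"
  unfolding shrink_def
  by (intro polyc_filter polyc_ball polyc_imp polyc_bad polyc_marks polyc_Not polyc_eq_nat polyc_look
    polyc_const polyc_proj)

lemmas polyc_shrink = polyc_comp3 [where g = shrink, OF polyc_shrink_tuple]

lemma size_foldl_shrink: "size_of (foldl (\<lambda>S a. shrink W S a) S as) \<le> size_of S"
proof (induction as arbitrary: S)
  case (Cons a as)
  from Cons[of "shrink W S a"] show ?case
    unfolding foldl_Cons using size_filter le_trans unfolding shrink_def by fastforce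
qed simp

lemma polyc_foldl_shrink:
  assumes "polyc f1" and "polyc f2" and "polyc f3"
  shows "polyc (\<lambda>z. foldl (\<lambda>S a. shrink (f1 z) S a) (f2 z) (f3 z))"
proof -
  have "polyc (\<lambda>z. foldl (\<lambda>S a. shrink (fst z) S a) (fst2 z) (snd2 z))"
  proof (rule polyc_foldl)
    fix z :: "nat list \<times> nat list \<times> atom list" and xs ys
    show "size_of (foldl (\<lambda>S a. shrink (fst z) S a) (fst2 z) xs) \<le> size_of z"
      using size_foldl_shrink[of "fst z" "fst2 z" xs] size_fst[of "snd z"] size_snd[of z] by linarith
  qed (intro pb_intros polyc_shrink polyc_proj)+
  then show ?thesis
    by (rule polyc_comp3[where g = "\<lambda>W S as. foldl (\<lambda>S a. shrink W S a) S as", OF _ assms])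
qed

lemma polyc_pick_min:
  "polyc (\<lambda>t. pick_min (fst t) (fst2 t) (fst3 t) (fst4 t) (snd4 t))"
  unfolding pick_min_def
proof (rule polyc_foldl)
  fix z :: "atom list \<times> nat list \<times> nat list \<times> nat list \<times> nat list" and xs ys :: "nat list"
  have "size_of (foldl (\<lambda>S _. foldl (\<lambda>S a. shrink (snd4 z) S a) S (fst z)) S xs) \<le> size_of S" for S
  proof (induction xs arbitrary: S)
    case (Cons x xs)
    then show ?case unfolding foldl_Cons using size_foldl_shrink le_trans by blast
  qed simp
  note le_trans[OF this size_filter]
  then have "size_of (foldl (\<lambda>S _. foldl (\<lambda>S a. shrink (snd4 z) S a) S (fst z))
    (filter (\<lambda>j. j \<in> allowed (set (fst3 z)) (set (fst4 z)) (set (snd4 z)))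
      (fst2 z)) xs) \<le> size_of (fst2 z)" .
  then show "size_of (foldl (\<lambda>S _. foldl (\<lambda>S a. shrink (snd4 z) S a) S (fst z))
    (filter (\<lambda>j. j \<in> allowed (set (fst3 z)) (set (fst4 z)) (set (snd4 z)))
      (fst2 z)) xs) \<le> size_of z"
    using size_fst[of "snd z"] size_snd[of z] by linarith
qed (intro pb_intros polyc_filter polyc_foldl_shrink polyc_allowed polyc_proj)+

lemma polyc_eliminate:
  "polyc (\<lambda>p. eliminate (fst p) (\<lambda>v. test (fst (fst2 p)) (marks (fst3 p) v (snd (fst2 p)))
     (fst4 p)) (snd4 p))"
  unfolding eliminate_def
  by (intro polyc_case_list polyc_filter polyc_map polyc_if polyc_Not polyc_test polyc_marks polyc_xor_on polyc_proj)

lemma polyc_eliminate_atom: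
  "polyc (\<lambda>p. foldl (\<lambda>B M. eliminate (fst p) (\<lambda>v. test (fst (fst2 p))
     (marks (fst3 p) v (snd (fst2 p))) M) B) (snd3 p) hyper_lists)"
proof (rule polyc_foldl)
  show "polyc (\<lambda>p. eliminate (fst (fst p)) (\<lambda>v. test (fst (fst2 (fst p)))
    (marks (fst3 (fst p)) v (snd (fst2 (fst p)))) (fst2 p)) (snd2 p))"
    by (rule polyc_comp5[where g = "\<lambda>V a W M B. eliminate V (\<lambda>v. test (fst a) (marks W v (snd a)) M) B",
      OF polyc_eliminate]) (intro polyc_proj)+
  show "pb (\<lambda>s. 1 + s * (1 + s))" by (intro pb_intros)
  fix z :: "nat list \<times> atom \<times> nat list \<times> nat list list" and xs ys
  have B: "size_of (snd3 z) \<le> size_of z"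
    using size_snd[of z] size_snd[of "snd z"] size_snd[of "snd2 z"] by linarith
  have "size_of (fst z) \<le> size_of z" using size_fst[of z] by simp
  moreover have "\<forall>v\<in>set (snd3 z). size_of v \<le> size_of z"
    using B size_elem le_trans less_imp_le by blast
  ultimately show "size_of (foldl (\<lambda>B M. eliminate (fst z) (\<lambda>v. test (fst (fst2 z))
     (marks (fst3 z) v (snd (fst2 z))) M) B) (snd3 z) xs) \<le> 1 + size_of z * (1 + size_of z)"
    using eliminate_foldl_bound[of "fst z" "size_of z" "snd3 z"
      "\<lambda>v M. test (fst (fst2 z)) (marks (fst3 z) v (snd (fst2 z))) M" xs]
    by (intro basis_size[OF _ _ B]) auto
qed (intro polyc_const polyc_proj)+

lemma kernel_bound:
  assumes "size_of V \<le> s" and "\<forall>v\<in>set B. size_of v \<le> s"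
  shows "length (kernel as V W B) = length B \<and> (\<forall>v\<in>set (kernel as V W B). size_of v \<le> s)"
  using assms(2)
proof (induction as arbitrary: B)
  case (Cons a as)
  let ?B = "foldl (\<lambda>B M. eliminate V (\<lambda>v. test (fst a) (marks W v (snd a)) M) B) B hyper_lists"
  have e: "length ?B = length B \<and> (\<forall>v\<in>set ?B. size_of v \<le> s)"
    by (rule eliminate_foldl_bound[OF assms(1) Cons.prems])
  have "kernel (a # as) V W B = kernel as V W ?B" by (simp add: kernel_def)
  then show ?case using e Cons.IH[OF conjunct2[OF e]] by simp
qed (simp add: kernel_def)

lemma polyc_kernel:
  assumes "polyc f1" and "polyc f2" and "polyc f3" and "polyc f4"
  shows "polyc (\<lambda>z. kernel (f1 z) (f2 z) (f3 z) (f4 z))"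
proof -
  have "polyc (\<lambda>z. kernel (fst z) (fst2 z) (fst3 z) (snd3 z))"
    unfolding kernel_def
  proof (rule polyc_foldl)
    show "polyc (\<lambda>p. foldl (\<lambda>B M. eliminate (fst2 (fst p)) (\<lambda>v. test (fst (fst2 p))
      (marks (fst3 (fst p)) v (snd (fst2 p))) M) B) (snd2 p) hyper_lists)"
      by (rule polyc_comp4[where g = "\<lambda>V a W B. foldl (\<lambda>B M. eliminate V (\<lambda>v. test (fst a)
        (marks W v (snd a)) M) B) B hyper_lists", OF polyc_eliminate_atom]) (intro polyc_proj)+
    show "pb (\<lambda>s. 1 + s * (1 + s))" by (intro pb_intros)
    fix z :: "atom list \<times> nat list \<times> nat list \<times> nat list list" and xs ys
    have B: "size_of (snd3 z) \<le> size_of z"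
      using size_snd[of z] size_snd[of "snd z"] size_snd[of "snd2 z"] by linarith
    have "size_of (fst2 z) \<le> size_of z" using size_fst[of "snd z"] size_snd[of z] by simp
    moreover have "\<forall>v\<in>set (snd3 z). size_of v \<le> size_of z"
      using B size_elem le_trans less_imp_le by blast
    ultimately show "size_of (foldl (\<lambda>B a. foldl (\<lambda>B M. eliminate (fst2 z) (\<lambda>v. test (fst a)
      (marks (fst3 z) v (snd a)) M) B) B hyper_lists) (snd3 z) xs) \<le> 1 + size_of z * (1 + size_of z)"
      using kernel_bound[of "fst2 z" "size_of z" "snd3 z" xs "fst3 z"]
      unfolding kernel_def by (intro basis_size[OF _ _ B]) auto
  qed (intro polyc_proj)+
  then show ?thesis by (rule polyc_comp4[OF _ assms])
qed

lemma polyc_pick_mx: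
  "polyc (\<lambda>t. pick_mx (fst t) (fst2 t) (fst3 t) (fst4 t) (snd4 t))"
  unfolding pick_mx_def
  by (intro polyc_case_list polyc_filter polyc_Not polyc_eq_const polyc_kernel polyc_map polyc_Cons polyc_const
    polyc_allowed polyc_proj)

end

section \<open>Parsing and the decision procedure\<close>

lemma polyc_eq_symbols:
  assumes "polyc f1" and "polyc f2"
  shows "polyc (\<lambda>z. f1 z = (f2 z :: symbol list))"
proof -
  have eq: "xs = ys \<longleftrightarrow> length xs = length ys \<and> (\<forall>i\<in>set [0..<length xs]. look Tick xs i = look Tick ys i)"
    for xs ys :: "symbol list"
    by (auto simp: look_nth intro: nth_equalityI)
  have "polyc (\<lambda>p::symbol \<times> symbol. fst p = snd p)"
    using polyc_finite_UNIV[of "\<lambda>p. p" "\<lambda>p::symbol \<times> symbol. fst p = snd p"] polyc_id by blast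
  note sym = polyc_comp2[OF this]
  have "polyc (\<lambda>p::symbol list \<times> symbol list. fst p = snd p)"
    unfolding eq
    by (intro polyc_conj polyc_ball polyc_eq_nat polyc_length polyc_upt sym polyc_look polyc_proj)
  then show ?thesis by (rule polyc_comp2[OF _ assms])
qed

text \<open>The encoding with projections in place of pattern matching, as the \<open>polyc\<close>
  rules require.\<close>

definition encode_atoms :: "atom list \<Rightarrow> symbol list" where
  "encode_atoms as = concat (map (\<lambda>a. AtomSym # replicate (fst a) Tick @
     concat (map (\<lambda>y. ArgSym # replicate y Tick) (snd a))) as)"

lemma encode_atoms: "concat (map encode_atom as) = encode_atoms as"
proof -
  have "encode_atom a = AtomSym # replicate (fst a) Tick @
     concat (map (\<lambda>y. ArgSym # replicate y Tick) (snd a))" for a by (cases a) simp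
  then have "encode_atom = (\<lambda>a. AtomSym # replicate (fst a) Tick @
     concat (map (\<lambda>y. ArgSym # replicate y Tick) (snd a)))" by blast
  then show ?thesis unfolding encode_atoms_def by (simp only:)
qed

lemma polyc_encode_atoms:
  assumes "polyc f"
  shows "polyc (\<lambda>z. encode_atoms (f z))"
proof -
  have "polyc encode_atoms"
    unfolding encode_atoms_def
    by (intro polyc_concat polyc_map polyc_Cons polyc_append polyc_replicate polyc_const polyc_proj)
  then show ?thesis by (rule polyc_comp[OF assms])
qed

text \<open>
  The input is read from right to left.  The state consists of the number of ticks and the
  arguments that have been read since the last complete atom, the atoms, and the quantifiers.
\<close>

type_synonym parse_state = "nat \<times> nat list \<times> atom list \<times> quantifier list"

definition parse_step :: "symbol \<Rightarrow> parse_state \<Rightarrow> parse_state" where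
  "parse_step x st =
     (if x = Tick then (Suc (fst st), snd st)
      else if x = ArgSym then (0, fst st # fst2 st, snd2 st)
      else if x = AtomSym then (0, [], (fst st, fst2 st) # fst3 st, snd3 st)
      else if x = QuantSym ForallQ then (fst st, fst2 st, fst3 st, ForallQ # snd3 st)
      else (fst st, fst2 st, fst3 st, ExistsQ # snd3 st))"

text \<open>Every word is parsed into something. \<open>decide\<close> encodes the result again and
  compares it with the word, so malformed words need no treatment here.\<close>

definition parse :: "symbol list \<Rightarrow> parse_state" where
  "parse w = foldr parse_step w (0, [], [], [])"

lemma parse_step_simps [simp]:
  "parse_step Tick (t, st1) = (Suc t, st1)"
  "parse_step ArgSym (t, ys, st) = (0, t # ys, st)"
  "parse_step AtomSym (t, ys, as, qs) = (0, [], (t, ys) # as, qs)"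
  "parse_step (QuantSym q) (t, ys, as, qs) = (t, ys, as, q # qs)"
  by (cases q; simp add: parse_step_def)+

lemma parse_ticks: "(parse_step Tick ^^ n) (t, st) = (n + t, st)"
  by (induction n) auto

lemma parse_args:
  "foldr parse_step (concat (map (\<lambda>y. ArgSym # replicate y Tick) ys)) (0, zs, st) = (0, ys @ zs, st)"
  by (induction ys) (auto simp: parse_ticks)

lemma parse_atoms:
  "foldr parse_step (concat (map encode_atom as)) (0, [], bs, qs) = (0, [], as @ bs, qs)"
proof (induction as)
  case (Cons a as)
  obtain r ys where "a = (r, ys)" by (cases a)
  then show ?case using Cons by (simp add: parse_args parse_ticks)
qed simp

lemma parse_encode: "parse (encode \<Phi>) = (0, [], atoms \<Phi>, quants \<Phi>)"
proof -
  have "foldr parse_step (map QuantSym qs) (0, [], as, []) = (0, [], as, qs)" for qs as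
    by (induction qs) auto
  then show ?thesis by (simp add: parse_def encode_def parse_atoms)
qed

lemma size_parse_step: "size_of (parse_step x st) \<le> size_of st + 4"
  by (cases st) (auto simp: parse_step_def to_tree_quantifier_def)

lemma polyc_parse: "polyc parse"
  unfolding parse_def
proof (rule polyc_foldr)
  show "polyc (\<lambda>p. parse_step (fst2 p) (snd2 p))"
    unfolding parse_step_def
    by (intro polyc_if polyc_eq_const polyc_pair polyc_Cons polyc_Suc polyc_const polyc_proj)
  \<comment> \<open>The initial state has size 7, and each symbol adds at most 4.\<close>
  show "pb (\<lambda>n. 7 + 4 * n)" by (intro pb_intros)
  fix z xs ys :: "symbol list" assume z: "z = xs @ ys"
  have "size_of (foldr parse_step ys (0, [], [], [])) \<le> 7 + 4 * length ys"
  proof (induction ys)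
    case (Cons y ys)
    then show ?case using size_parse_step[of y "foldr parse_step ys (0, [], [], [])"] by simp
  qed simp
  also have "\<dots> \<le> 7 + 4 * size_of z" using length_size[of z] z by simp
  finally show "size_of (foldr parse_step ys (0, [], [], [])) \<le> 7 + 4 * size_of z" .
qed (intro polyc_const polyc_proj)+

definition decide_csat :: "picker \<Rightarrow> atom list \<Rightarrow> nat list \<Rightarrow> nat list \<Rightarrow> nat list \<Rightarrow> bool" where
  "decide_csat pick as V U L \<longleftrightarrow> foldl (\<lambda>W _. peel_off (pick as V U L) W) V V = []"

definition univ_list :: "quantifier list \<Rightarrow> nat list" where
  "univ_list qs = filter (\<lambda>j. look ExistsQ qs j = ForallQ) [0..<length qs]"

context min_like
begin

lemma set_univ_list: "set (univ_list qs) = univ qs"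
  by (auto simp: univ_list_def univ_def look_nth)

text \<open>A sentence with an atom over an empty relation is false, and peeling presupposes
  nonempty relations; such sentences are rejected at once. Symbol and number of arguments are
  checked against a finite set, hence by a table.\<close>

definition well_formed :: "atom list \<Rightarrow> nat \<Rightarrow> bool" where
  "well_formed as n \<longleftrightarrow> (\<forall>a\<in>set as.
     (fst a, length (snd a)) \<in> {(r, k). r < length \<Gamma> \<and> k = arity r \<and> rel r \<noteq> {}} \<and>
     (\<forall>y\<in>set (snd a). y < n))"

lemma well_formed_iff:
  "well_formed as n \<longleftrightarrow> wf_atoms n as \<and> (\<forall>(r, ys) \<in> set as. rel r \<noteq> {})"
  by (fastforce simp: well_formed_def wf_atoms_def)

lemma polyc_well_formed:
  assumes "polyc f1" and "polyc f2"
  shows "polyc (\<lambda>z. well_formed (f1 z) (f2 z))"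
proof -
  let ?A = "{(r, k). r < length \<Gamma> \<and> k = arity r \<and> rel r \<noteq> {}}"
  have fin: "finite ?A"
    by (rule finite_subset[of _ "{..<length \<Gamma>} \<times> {..max_arity}"]) (use arity_le in auto)
  have A: "polyc f \<Longrightarrow> polyc (\<lambda>z. f z \<in> ?A)" for f :: "'z::enc \<Rightarrow> nat \<times> nat"
    using polyc_finite_support[OF fin, of "\<lambda>p. p \<in> ?A" False f] by blast
  have "polyc (\<lambda>p. well_formed (fst p) (snd p))"
    unfolding well_formed_def
    by (intro polyc_ball polyc_conj A polyc_pair polyc_length polyc_less polyc_proj)
  then show ?thesis by (rule polyc_comp2[OF _ assms])
qed

definition decide :: "picker \<Rightarrow> atom list \<Rightarrow> quantifier list \<Rightarrow> symbol list \<Rightarrow> bool" where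
  "decide pick as qs w \<longleftrightarrow> map QuantSym qs @ encode_atoms as = w \<and> well_formed as (length qs) \<and>
     decide_csat pick as [0..<length qs] (univ_list qs) [] \<and>
     (\<forall>u\<in>set (univ_list qs). decide_csat pick as [0..<length qs] (univ_list qs) [u])"

lemma decide_correct:
  assumes pick: "\<And>n as U L. wf_atoms n as \<Longrightarrow> \<forall>(r, ys) \<in> set as. rel r \<noteq> {} \<Longrightarrow>
    decide_csat pick as [0..<n] U L \<longleftrightarrow> csat n as (set U) (set L)"
  shows "decide pick (fst3 (parse w)) (snd3 (parse w)) w \<longleftrightarrow> w \<in> QCSP \<Gamma>"
proof -
  have wf: "sentence_of \<Gamma> \<Phi> \<longleftrightarrow> wf_atoms (length (quants \<Phi>)) (atoms \<Phi>)" for \<Phi>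
    unfolding sentence_of_def wf_atoms_def by fastforce
  have sem: "decide pick as qs (map QuantSym qs @ encode_atoms as) \<longleftrightarrow>
    sentence_of \<Gamma> \<lparr>quants = qs, atoms = as\<rparr> \<and> true_in \<Gamma> \<lparr>quants = qs, atoms = as\<rparr>" for as qs
  proof
    assume d: "decide pick as qs (map QuantSym qs @ encode_atoms as)"
    then have w: "wf_atoms (length qs) as" "\<forall>(r, ys) \<in> set as. rel r \<noteq> {}"
      unfolding decide_def well_formed_iff by auto
    show "sentence_of \<Gamma> \<lparr>quants = qs, atoms = as\<rparr> \<and> true_in \<Gamma> \<lparr>quants = qs, atoms = as\<rparr>"
      using d w unfolding true_in_iff_csat[OF w(1)] wf decide_def pick[OF w] set_univ_list by simp
  next
    assume s: "sentence_of \<Gamma> \<lparr>quants = qs, atoms = as\<rparr> \<and> true_in \<Gamma> \<lparr>quants = qs, atoms = as\<rparr>"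
    then have w: "wf_atoms (length qs) as" unfolding wf by simp
    have c: "csat (length qs) as (univ qs) {} \<and> (\<forall>u\<in>univ qs. csat (length qs) as (univ qs) {u})"
      using s unfolding true_in_iff_csat[OF w] by simp
    \<comment> \<open>A solution of a simplified game satisfies every atom, so the relations that
      occur are nonempty.\<close>
    then have ne: "\<forall>(r, ys) \<in> set as. rel r \<noteq> {}" unfolding csat_def holds_def by blast
    show "decide pick as qs (map QuantSym qs @ encode_atoms as)"
      unfolding decide_def well_formed_iff pick[OF w ne] set_univ_list using w ne c by simp
  qed
  show ?thesis
  proof
    assume d: "decide pick (fst3 (parse w)) (snd3 (parse w)) w"
    let ?\<Phi> = "\<lparr>quants = snd3 (parse w), atoms = fst3 (parse w)\<rparr>"
    from d have e: "map QuantSym (snd3 (parse w)) @ encode_atoms (fst3 (parse w)) = w"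
      by (simp add: decide_def)
    then have "w = encode ?\<Phi>" unfolding encode_def encode_atoms by simp
    moreover have "sentence_of \<Gamma> ?\<Phi> \<and> true_in \<Gamma> ?\<Phi>"
      using d sem[of "fst3 (parse w)" "snd3 (parse w)"] unfolding e by simp
    ultimately show "w \<in> QCSP \<Gamma>" unfolding QCSP_def by blast
  next
    assume "w \<in> QCSP \<Gamma>"
    then obtain \<Phi> where \<Phi>: "w = encode \<Phi>" "sentence_of \<Gamma> \<Phi>" "true_in \<Gamma> \<Phi>" unfolding QCSP_def by blast
    moreover obtain qs as where "\<Phi> = \<lparr>quants = qs, atoms = as\<rparr>" by (cases \<Phi>) simp
    ultimately have "decide pick (atoms \<Phi>) (quants \<Phi>) (encode \<Phi>)"
      using sem[of as qs] by (simp add: encode_def encode_atoms)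
    then show "decide pick (fst3 (parse w)) (snd3 (parse w)) w"
      by (simp add: \<Phi>(1) parse_encode)
  qed
qed

lemma QCSP_polytime:
  assumes correct: "\<And>n as U L. wf_atoms n as \<Longrightarrow> \<forall>(r, ys) \<in> set as. rel r \<noteq> {} \<Longrightarrow>
    decide_csat pick as [0..<n] U L \<longleftrightarrow> csat n as (set U) (set L)"
    and pick: "polyc (\<lambda>t. pick (fst t) (fst2 t) (fst3 t) (fst4 t) (snd4 t))"
  shows "polytime_decidable (QCSP \<Gamma>)"
proof (rule polytime_decidableI)
  have csat: "polyc (\<lambda>z. decide_csat pick (f1 z) (f2 z) (f3 z) (f4 z))"
    if "polyc f1" "polyc f2" "polyc f3" "polyc f4" for f1 f2 f3 f4
    unfolding decide_csat_def by (rule polyc_peel[OF pick that])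
  have forall: "polyc f \<Longrightarrow> polyc (\<lambda>z. f z = ForallQ)" for f :: "'z::enc \<Rightarrow> quantifier"
    by (rule polyc_eq_const)
  have "polyc univ_list" unfolding univ_list_def
    by (intro polyc_filter polyc_eq_const polyc_look polyc_upt polyc_length polyc_proj)
  note univ = polyc_comp[OF _ this]
  have "q \<in> {ForallQ, ExistsQ}" for q by (cases q) auto
  then have "polyc QuantSym"
    by (intro polyc_finite_support[OF _ _ polyc_id, of "{ForallQ, ExistsQ}" _ undefined]) auto
  note quant = polyc_comp[OF _ this]
  have "polyc (\<lambda>p. decide pick (fst p) (fst2 p) (snd2 p))"
    unfolding decide_def
    by (intro polyc_conj polyc_ball polyc_eq_symbols polyc_append polyc_map quant polyc_encode_atoms
      polyc_well_formed csat univ polyc_upt polyc_length polyc_Cons polyc_const polyc_proj)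
  then have "polyc (\<lambda>w. decide pick (fst3 (parse w)) (snd3 (parse w)) w)"
    by (rule polyc_comp3) (intro polyc_proj polyc_parse)+
  then show "polyc (\<lambda>w. w \<in> QCSP \<Gamma>)" by (simp add: decide_correct[OF correct])
qed

end

theorem theorem4p1:
  fixes \<Gamma> :: rat_structure and h :: "rat \<Rightarrow> rat \<Rightarrow> rat"
  assumes "temporal_constraint_language \<Gamma>"
    and "h = min \<or> is_mx h"
    and "preserves h \<Gamma>"
  shows "polytime_decidable (QCSP \<Gamma>)"
proof -
  have inv: "order_invariant k R" if "(k, R) \<in> set \<Gamma>" for k R
    using assms(1) that fo_definable_invariant unfolding temporal_constraint_language_def by blast
  from assms(2) show ?thesis
  proof
    assume h: "h = min"
    interpret min_case \<Gamma> h "\<lambda>x. x"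
      using inv assms(3) by unfold_locales (auto simp: h strict_mono_def)
    show ?thesis
      by (rule QCSP_polytime[where pick = pick_min]) (simp_all add: decide_csat_def pick_min_correct polyc_pick_min)
  next
    assume "is_mx h"
    then obtain \<alpha> \<beta> :: "rat \<Rightarrow> rat" where ab: "strict_mono \<alpha>" "strict_mono \<beta>"
      "\<And>x \<epsilon>. \<epsilon> > 0 \<Longrightarrow> \<alpha> x < \<beta> x \<and> \<beta> x < \<alpha> (x + \<epsilon>)"
      "\<And>x y. h x y = (if x \<noteq> y then \<alpha> (min x y) else \<beta> x)"
      unfolding is_mx_def by blast
    have \<alpha>\<beta>: "\<alpha> x < \<beta> x" for x using ab(3)[of 1 x] by simp
    have \<beta>\<alpha>: "\<beta> x < \<alpha> y" if "x < y" for x y using ab(3)[of "y - x" x] that by simp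
    \<comment> \<open>Each value \<open>h x y\<close> lies between \<alpha> and \<beta> of
      \<open>min x y\<close>, and for a smaller minimum this whole interval lies below.\<close>
    have mono: "h x x' < h y y'" if "x < y" "x' < y'" for x x' y y'
    proof -
      have "h x x' \<le> \<beta> (min x x')" using \<alpha>\<beta>[of "min x x'"] by (auto simp: ab(4))
      also have "\<dots> < \<alpha> (min y y')" using that by (intro \<beta>\<alpha>) (auto simp: min_def)
      also have "\<dots> \<le> h y y'" using \<alpha>\<beta>[of "min y y'"] by (auto simp: ab(4))
      finally show ?thesis .
    qed
    interpret mx_case \<Gamma> h \<alpha> \<beta>
      using inv assms(3) mono ab(1,2) \<alpha>\<beta> \<beta>\<alpha> by unfold_locales (auto simp: ab(4))
    show ?thesis
      by (rule QCSP_polytime[where pick = pick_mx]) (simp_all add: decide_csat_def pick_mx_correct polyc_pick_mx)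
  qed
qed

end
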